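(* Let $\mathcal{M}$ be a type II$_1$ factor, let $\mathcal{A}$ be a masa in $\mathcal{M}$ and let $E:\mathcal M\to\mathcal A$ denote the trace preserving conditional expectation onto $\mathcal A$. Let $\mathbf{A}\in\mathcal A^n$ and $\mathbf{S}\in\mathcal M^n$ be $n$-tuples of commuting hermitian operators, both with finite (joint) spectrum, such that $\mathbf{A} \prec \mathbf{S}$. Then there is a unitary $U$ in $\mathcal{M}$ such that $$E(U\mathbf{S}U^{*}) = \mathbf{A}.$$
   Context: $\tau$ denotes the normalized trace of $\mathcal M$; a masa is a maximal abelian self-adjoint subalgebra. A doubly stochastic map on $\mathcal M$ is a linear, unital, positive, trace preserving map $D:\mathcal M\to\mathcal M$. For $\mathbf A=(A_1,\dots,A_n)$, $\mathbf S=(S_1,\dots,S_n)$ in $\mathcal M^n$, $\mathbf A\prec\mathbf S$ means that there is a doubly stochastic map $D$ on $\mathcal M$ with $D(S_i)=A_i$ for $1\le i\le n$. Operations act on tuples entrywise: $E(U\mathbf SU^* )=(E(US_1U^* ),\dots,E(US_nU^* ))$. *)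

theory Defs
  imports "HOL-Analysis.Analysis"
begin

subsection \<open>Complex Hilbert spaces\<close>

class complex_vector = real_vector +
  fixes scaleC :: "complex \<Rightarrow> 'a \<Rightarrow> 'a" (infixr "*\<^sub>C" 75)
  assumes scaleC_add_right: "a *\<^sub>C (x + y) = a *\<^sub>C x + a *\<^sub>C y"
    and scaleC_add_left: "(a + b) *\<^sub>C x = a *\<^sub>C x + b *\<^sub>C x"
    and scaleC_scaleC: "a *\<^sub>C (b *\<^sub>C x) = (a * b) *\<^sub>C x"
    and scaleC_one: "1 *\<^sub>C x = x"
    and scaleR_scaleC: "r *\<^sub>R x = complex_of_real r *\<^sub>C x"

text \<open>The inner product is conjugate linear in its first argument. The last axiom makes it
  positive definite, since \<open>norm\<close> is a norm.\<close>

class chilbert_space = complex_vector + banach +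
  fixes cinner :: "'a \<Rightarrow> 'a \<Rightarrow> complex"
  assumes cinner_commute: "cinner x y = cnj (cinner y x)"
    and cinner_add_right: "cinner x (y + z) = cinner x y + cinner x z"
    and cinner_scaleC_right: "cinner x (c *\<^sub>C y) = c * cinner x y"
    and cinner_self: "cinner x x = complex_of_real ((norm x)\<^sup>2)"

instantiation complex :: complex_vector
begin

definition scaleC_complex :: "complex \<Rightarrow> complex \<Rightarrow> complex"
  where "scaleC_complex c z = c * z"

instance
  by standard (simp_all add: scaleC_complex_def algebra_simps scaleR_conv_of_real)

end

lemma norm_scaleC: "norm (c *\<^sub>C x) = cmod c * norm (x :: 'a::chilbert_space)"
proof -
  have "cinner (c *\<^sub>C x) (c *\<^sub>C x) = c * cnj c * cinner x x"
    by (subst cinner_scaleC_right, subst cinner_commute, subst cinner_scaleC_right)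
      (simp add: cinner_self)
  then have "(norm (c *\<^sub>C x))\<^sup>2 = (cmod c * norm x)\<^sup>2"
    by (simp only: cinner_self complex_norm_square [symmetric] power_mult_distrib
        of_real_mult [symmetric] of_real_eq_iff)
  then show ?thesis
    by simp
qed

lemma bounded_linear_scaleC: "bounded_linear (\<lambda>x :: 'a::chilbert_space. c *\<^sub>C x)"
  by (rule bounded_linear_intro [where K = "cmod c"])
    (simp_all add: scaleC_add_right scaleR_scaleC scaleC_scaleC mult.commute norm_scaleC)

instantiation blinfun :: (real_normed_vector, chilbert_space) complex_vector
begin

lift_definition scaleC_blinfun :: "complex \<Rightarrow> ('a \<Rightarrow>\<^sub>L 'b) \<Rightarrow> ('a \<Rightarrow>\<^sub>L 'b)"
  is "\<lambda>c f x. c *\<^sub>C f x"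
  by (rule bounded_linear_compose [OF bounded_linear_scaleC])

instance
  by standard
    (transfer, simp add: fun_eq_iff scaleC_add_right scaleC_add_left scaleC_scaleC scaleC_one
      scaleR_scaleC)+

end

subsection \<open>Bounded operators\<close>

text \<open>The library type \<open>'h \<Rightarrow>\<^sub>L 'h\<close> consists of the bounded real linear maps; the bounded
  operators of the complex Hilbert space are the elements of the following set.\<close>

definition cbounded_ops :: "('h::chilbert_space \<Rightarrow>\<^sub>L 'h) set"
  where "cbounded_ops = {T. \<forall>c x. blinfun_apply T (c *\<^sub>C x) = c *\<^sub>C blinfun_apply T x}"

text \<open>Well defined on \<^const>\<open>cbounded_ops\<close> by the Riesz representation theorem.\<close>

definition cadj :: "('h::chilbert_space \<Rightarrow>\<^sub>L 'h) \<Rightarrow> ('h \<Rightarrow>\<^sub>L 'h)"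
  where "cadj T =
    (THE S. \<forall>x y. cinner (blinfun_apply T x) y = cinner x (blinfun_apply S y))"

definition hermitian_op :: "('h::chilbert_space \<Rightarrow>\<^sub>L 'h) \<Rightarrow> bool"
  where "hermitian_op T \<longleftrightarrow> T \<in> cbounded_ops \<and> cadj T = T"

definition positive_op :: "('h::chilbert_space \<Rightarrow>\<^sub>L 'h) \<Rightarrow> bool"
  where "positive_op T \<longleftrightarrow>
    T \<in> cbounded_ops \<and> (\<forall>x. cinner x (blinfun_apply T x) \<in> \<real>\<^sub>\<ge>\<^sub>0)"

definition unitary_op :: "('h::chilbert_space \<Rightarrow>\<^sub>L 'h) \<Rightarrow> bool"
  where "unitary_op U \<longleftrightarrow>
    U \<in> cbounded_ops \<and> cadj U o\<^sub>L U = id_blinfun \<and> U o\<^sub>L cadj U = id_blinfun"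

definition projection_op :: "('h::chilbert_space \<Rightarrow>\<^sub>L 'h) \<Rightarrow> bool"
  where "projection_op P \<longleftrightarrow> hermitian_op P \<and> P o\<^sub>L P = P"

subsection \<open>Von Neumann algebras\<close>

definition commutant :: "('h::chilbert_space \<Rightarrow>\<^sub>L 'h) set \<Rightarrow> ('h \<Rightarrow>\<^sub>L 'h) set"
  where "commutant X = {T \<in> cbounded_ops. \<forall>S\<in>X. T o\<^sub>L S = S o\<^sub>L T}"

definition von_neumann_algebra :: "('h::chilbert_space \<Rightarrow>\<^sub>L 'h) set \<Rightarrow> bool"
  where "von_neumann_algebra M \<longleftrightarrow>
    M \<subseteq> cbounded_ops \<and> (\<forall>x\<in>M. cadj x \<in> M) \<and> commutant (commutant M) = M"

definition factor :: "('h::chilbert_space \<Rightarrow>\<^sub>L 'h) set \<Rightarrow> bool"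
  where "factor M \<longleftrightarrow>
    von_neumann_algebra M \<and> (id_blinfun :: 'h \<Rightarrow>\<^sub>L 'h) \<noteq> 0 \<and>
    M \<inter> commutant M = range (\<lambda>c. c *\<^sub>C id_blinfun)"

text \<open>Finiteness says that the identity is not Murray-von Neumann equivalent to a proper
  subprojection.\<close>

definition finite_vna :: "('h::chilbert_space \<Rightarrow>\<^sub>L 'h) set \<Rightarrow> bool"
  where "finite_vna M \<longleftrightarrow>
    (\<forall>v\<in>M. cadj v o\<^sub>L v = id_blinfun \<longrightarrow> v o\<^sub>L cadj v = id_blinfun)"

definition abelian_projection ::
    "('h::chilbert_space \<Rightarrow>\<^sub>L 'h) set \<Rightarrow> ('h \<Rightarrow>\<^sub>L 'h) \<Rightarrow> bool"
  where "abelian_projection M p \<longleftrightarrow>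
    p \<in> M \<and> projection_op p \<and>
    (\<forall>x\<in>M. \<forall>y\<in>M. (p o\<^sub>L x o\<^sub>L p) o\<^sub>L (p o\<^sub>L y o\<^sub>L p) = (p o\<^sub>L y o\<^sub>L p) o\<^sub>L (p o\<^sub>L x o\<^sub>L p))"

definition type_II1_factor :: "('h::chilbert_space \<Rightarrow>\<^sub>L 'h) set \<Rightarrow> bool"
  where "type_II1_factor M \<longleftrightarrow>
    factor M \<and> finite_vna M \<and> (\<forall>p. abelian_projection M p \<longrightarrow> p = 0)"

subsection \<open>Maps on operator algebras\<close>

definition clinear_on :: "'a::complex_vector set \<Rightarrow> ('a \<Rightarrow> 'b::complex_vector) \<Rightarrow> bool"
  where "clinear_on M f \<longleftrightarrow>
    (\<forall>x\<in>M. \<forall>y\<in>M. f (x + y) = f x + f y) \<and> (\<forall>c. \<forall>x\<in>M. f (c *\<^sub>C x) = c *\<^sub>C f x)"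

text \<open>Normality: the functional preserves suprema of increasing nets of hermitian elements. For
  a positive functional this only requires every upper bound of the values to bound the value at
  the supremum.\<close>

definition normal_functional ::
    "('h::chilbert_space \<Rightarrow>\<^sub>L 'h) set \<Rightarrow> (('h \<Rightarrow>\<^sub>L 'h) \<Rightarrow> complex) \<Rightarrow> bool"
  where "normal_functional M \<phi> \<longleftrightarrow>
    (\<forall>X s. X \<noteq> {} \<and> X \<subseteq> {x \<in> M. hermitian_op x} \<and>
       (\<forall>x\<in>X. \<forall>y\<in>X. \<exists>z\<in>X. positive_op (z - x) \<and> positive_op (z - y)) \<and>
       s \<in> M \<and> hermitian_op s \<and> (\<forall>x\<in>X. positive_op (s - x)) \<and>
       (\<forall>t\<in>M. hermitian_op t \<and> (\<forall>x\<in>X. positive_op (t - x)) \<longrightarrow> positive_op (t - s)) \<longrightarrow>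
       (\<forall>r. (\<forall>x\<in>X. Re (\<phi> x) \<le> r) \<longrightarrow> Re (\<phi> s) \<le> r))"

definition normalized_trace ::
    "('h::chilbert_space \<Rightarrow>\<^sub>L 'h) set \<Rightarrow> (('h \<Rightarrow>\<^sub>L 'h) \<Rightarrow> complex) \<Rightarrow> bool"
  where "normalized_trace M \<tau> \<longleftrightarrow>
    clinear_on M \<tau> \<and>
    \<tau> id_blinfun = 1 \<and>
    (\<forall>x\<in>M. positive_op x \<longrightarrow> \<tau> x \<in> \<real>\<^sub>\<ge>\<^sub>0) \<and>
    (\<forall>x\<in>M. \<forall>y\<in>M. \<tau> (x o\<^sub>L y) = \<tau> (y o\<^sub>L x)) \<and>
    (\<forall>x\<in>M. positive_op x \<and> \<tau> x = 0 \<longrightarrow> x = 0) \<and>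
    normal_functional M \<tau>"

definition doubly_stochastic ::
    "('h::chilbert_space \<Rightarrow>\<^sub>L 'h) set \<Rightarrow> (('h \<Rightarrow>\<^sub>L 'h) \<Rightarrow> complex) \<Rightarrow>
     (('h \<Rightarrow>\<^sub>L 'h) \<Rightarrow> ('h \<Rightarrow>\<^sub>L 'h)) \<Rightarrow> bool"
  where "doubly_stochastic M \<tau> D \<longleftrightarrow>
    (\<forall>x\<in>M. D x \<in> M) \<and>
    clinear_on M D \<and>
    D id_blinfun = id_blinfun \<and>
    (\<forall>x\<in>M. positive_op x \<longrightarrow> positive_op (D x)) \<and>
    (\<forall>x\<in>M. \<tau> (D x) = \<tau> x)"

text \<open>Tuples are indexed by a finite type.\<close>

definition majorized ::
    "('h::chilbert_space \<Rightarrow>\<^sub>L 'h) set \<Rightarrow> (('h \<Rightarrow>\<^sub>L 'h) \<Rightarrow> complex) \<Rightarrow>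
     ('n::finite \<Rightarrow> ('h \<Rightarrow>\<^sub>L 'h)) \<Rightarrow> ('n \<Rightarrow> ('h \<Rightarrow>\<^sub>L 'h)) \<Rightarrow> bool"
  where "majorized M \<tau> A S \<longleftrightarrow> (\<exists>D. doubly_stochastic M \<tau> D \<and> (\<forall>i. D (S i) = A i))"

subsection \<open>Self-adjoint subalgebras\<close>

definition star_subalgebra :: "('h::chilbert_space \<Rightarrow>\<^sub>L 'h) set \<Rightarrow> bool"
  where "star_subalgebra B \<longleftrightarrow>
    B \<subseteq> cbounded_ops \<and> 0 \<in> B \<and>
    (\<forall>x\<in>B. \<forall>y\<in>B. x + y \<in> B \<and> x o\<^sub>L y \<in> B) \<and>
    (\<forall>c. \<forall>x\<in>B. c *\<^sub>C x \<in> B) \<and>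
    (\<forall>x\<in>B. cadj x \<in> B)"

definition abelian_star_subalgebra ::
    "('h::chilbert_space \<Rightarrow>\<^sub>L 'h) set \<Rightarrow> ('h \<Rightarrow>\<^sub>L 'h) set \<Rightarrow> bool"
  where "abelian_star_subalgebra M B \<longleftrightarrow>
    star_subalgebra B \<and> B \<subseteq> M \<and> (\<forall>x\<in>B. \<forall>y\<in>B. x o\<^sub>L y = y o\<^sub>L x)"

definition masa :: "('h::chilbert_space \<Rightarrow>\<^sub>L 'h) set \<Rightarrow> ('h \<Rightarrow>\<^sub>L 'h) set \<Rightarrow> bool"
  where "masa M A \<longleftrightarrow>
    abelian_star_subalgebra M A \<and>
    (\<forall>B. abelian_star_subalgebra M B \<and> A \<subseteq> B \<longrightarrow> B = A)"

definition trace_preserving_expectation ::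
    "('h::chilbert_space \<Rightarrow>\<^sub>L 'h) set \<Rightarrow> (('h \<Rightarrow>\<^sub>L 'h) \<Rightarrow> complex) \<Rightarrow> ('h \<Rightarrow>\<^sub>L 'h) set \<Rightarrow>
     (('h \<Rightarrow>\<^sub>L 'h) \<Rightarrow> ('h \<Rightarrow>\<^sub>L 'h)) \<Rightarrow> bool"
  where "trace_preserving_expectation M \<tau> A E \<longleftrightarrow>
    (\<forall>x\<in>M. E x \<in> A) \<and>
    clinear_on M E \<and>
    (\<forall>x\<in>M. positive_op x \<longrightarrow> positive_op (E x)) \<and>
    (\<forall>a\<in>A. E a = a) \<and>
    (\<forall>a\<in>A. \<forall>x\<in>M. \<forall>b\<in>A. E (a o\<^sub>L x o\<^sub>L b) = a o\<^sub>L E x o\<^sub>L b) \<and>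
    (\<forall>x\<in>M. \<tau> (E x) = \<tau> x)"

subsection \<open>Joint spectrum\<close>

text \<open>The joint spectrum of a commuting tuple of hermitian operators is the set of its images
  under the characters of the unital C*-algebra it generates.\<close>

definition cstar_generated :: "('h::chilbert_space \<Rightarrow>\<^sub>L 'h) set \<Rightarrow> ('h \<Rightarrow>\<^sub>L 'h) set"
  where "cstar_generated X =
    \<Inter> {B. star_subalgebra B \<and> id_blinfun \<in> B \<and> closed B \<and> X \<subseteq> B}"

definition algebra_character ::
    "('h::chilbert_space \<Rightarrow>\<^sub>L 'h) set \<Rightarrow> (('h \<Rightarrow>\<^sub>L 'h) \<Rightarrow> complex) \<Rightarrow> bool"
  where "algebra_character B \<gamma> \<longleftrightarrow>
    clinear_on B \<gamma> \<and> \<gamma> id_blinfun = 1 \<and> (\<forall>x\<in>B. \<forall>y\<in>B. \<gamma> (x o\<^sub>L y) = \<gamma> x * \<gamma> y)"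

definition joint_spectrum ::
    "('n::finite \<Rightarrow> ('h::chilbert_space \<Rightarrow>\<^sub>L 'h)) \<Rightarrow> (complex ^ 'n) set"
  where "joint_spectrum S =
    {\<chi> i. \<gamma> (S i) | \<gamma>. algebra_character (cstar_generated (range S)) \<gamma>}"

definition commuting_hermitian :: "('n::finite \<Rightarrow> ('h::chilbert_space \<Rightarrow>\<^sub>L 'h)) \<Rightarrow> bool"
  where "commuting_hermitian S \<longleftrightarrow>
    (\<forall>i. hermitian_op (S i)) \<and> (\<forall>i j. S i o\<^sub>L S j = S j o\<^sub>L S i)"

end

theory Submission
  imports Defs
begin

text \<open>Finite joint spectra reduce the tuples to partitions of unity \<open>(p\<^sub>k)\<close> in \<open>\<A>\<close> and \<open>(q\<^sub>l)\<close> in \<open>\<M>\<close>, and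
  the doubly stochastic map \<open>D\<close> to the weights \<open>c\<^sub>k\<^sub>l = \<tau> (p\<^sub>k D(q\<^sub>l)) / \<tau> p\<^sub>k\<close>. Suppose each \<open>p\<^sub>k\<close> is a sum
  of orthogonal projections \<open>r\<^sub>k\<^sub>l\<close> of \<open>\<M>\<close> with \<open>E r\<^sub>k\<^sub>l = c\<^sub>k\<^sub>l p\<^sub>k\<close>. Then \<open>r\<^sub>l = \<Sum>\<^sub>k r\<^sub>k\<^sub>l\<close> and \<open>q\<^sub>l\<close> have
  the same trace, hence are equivalent, and the unitary assembled from the equivalences is as required.
  The point is thus to split a projection of the masa into projections with prescribed scalar
  expectations. For rational scalars, partition \<open>p \<in> \<A>\<close> into \<open>n\<close> pieces of equal trace in \<open>\<A>\<close> and
  apply the Fourier matrix to partial isometries between them: off-diagonal terms are killed by \<open>E\<close>.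
  Real scalars are reached by an infinite chain of rotations between such rational partitions.\<close>


section \<open>Complex Hilbert spaces\<close>

text \<open>Rational weights cost finitely many partial isometries; a real weight could only be
  approximated by them, and the compactness needed for a limit is available in the weak topology,
  where limits of projections need not be projections. So no approximation is taken. A projection of
  the masa is cut into infinitely many orthogonal parts, and a rotation that corrects the weight on
  one part disturbs only the next, where the following rotation absorbs it. Over each part only two
  members of the infinite sum survive, so the expectation is found by finite algebra and is exact.

  Everything infinite is countable: the trace bounds every orthogonal family, so a greedy choice
  stands in for a maximality argument, and strong limits of sequences stand in for nets. Functional
  calculus is reduced to one iteration for square roots. Spectral partitions of the tuples come from
  approximate joint eigenvectors, each of which defines a character and hence a point of the finite
  joint spectrum.\<close>

lemma scaleC_zero_left [simp]: "0 *\<^sub>C (x::'a::complex_vector) = 0"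
  using scaleC_add_left [of 0 0 x] by simp

lemma scaleC_zero_right [simp]: "c *\<^sub>C (0::'a::complex_vector) = 0"
  using scaleC_add_right [of c 0 "0::'a"] by simp

lemma scaleC_minus_left [simp]: "(- c) *\<^sub>C (x::'a::complex_vector) = - (c *\<^sub>C x)"
  using scaleC_add_left [of c "- c" x] by (simp add: eq_neg_iff_add_eq_0 add.commute)

lemma scaleC_minus_right [simp]: "c *\<^sub>C (- x::'a::complex_vector) = - (c *\<^sub>C x)"
  using scaleC_add_right [of c x "- x"] by (simp add: eq_neg_iff_add_eq_0 add.commute)

lemma scaleC_diff_left: "(a - b) *\<^sub>C (x::'a::complex_vector) = a *\<^sub>C x - b *\<^sub>C x"
  using scaleC_add_left [of a "- b" x] by simp

lemma scaleC_diff_right: "c *\<^sub>C (x - y::'a::complex_vector) = c *\<^sub>C x - c *\<^sub>C y"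
  using scaleC_add_right [of c x "- y"] by simp

lemma scaleC_sum_right: "c *\<^sub>C (\<Sum>i\<in>I. f i) = (\<Sum>i\<in>I. c *\<^sub>C (f i::'a::complex_vector))"
  by (induction I rule: infinite_finite_induct) (simp_all add: scaleC_add_right)

lemma scaleC_sum_left: "(\<Sum>i\<in>I. f i) *\<^sub>C (x::'a::complex_vector) = (\<Sum>i\<in>I. f i *\<^sub>C x)"
  by (induction I rule: infinite_finite_induct) (simp_all add: scaleC_add_left)

declare scaleC_one [simp]

lemma scaleC_cancel:
  "c *\<^sub>C (x::'a::complex_vector) = c *\<^sub>C y \<longleftrightarrow> x = y \<or> c = 0"
proof -
  have "x = y" if "c *\<^sub>C x = c *\<^sub>C y" "c \<noteq> 0"
    using arg_cong [OF that(1), of "\<lambda>z. inverse c *\<^sub>C z"] that(2) by (simp add: scaleC_scaleC)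
  then show ?thesis by auto
qed

lemma cinner_add_left: "cinner (x + y) (z::'h::chilbert_space) = cinner x z + cinner y z"
  by (metis cinner_commute cinner_add_right complex_cnj_add)

lemma cinner_scaleC_left: "cinner (c *\<^sub>C x) (z::'h::chilbert_space) = cnj c * cinner x z"
  by (metis cinner_commute cinner_scaleC_right complex_cnj_mult)

lemma cinner_zero_right [simp]: "cinner (x::'h::chilbert_space) 0 = 0"
  using cinner_scaleC_right [of x 0 0] by simp

lemma cinner_zero_left [simp]: "cinner 0 (x::'h::chilbert_space) = 0"
  using cinner_scaleC_left [of 0 0 x] by simp

lemma cinner_minus_right [simp]: "cinner x (- y) = - cinner x (y::'h::chilbert_space)"
  using cinner_scaleC_right [of x "-1" y] by simp

lemma cinner_minus_left [simp]: "cinner (- x) y = - cinner x (y::'h::chilbert_space)"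
  using cinner_scaleC_left [of "-1" x y] by simp

lemma cinner_diff_right: "cinner x (y - z) = cinner x y - cinner x (z::'h::chilbert_space)"
  using cinner_add_right [of x y "- z"] by simp

lemma cinner_diff_left: "cinner (x - y) z = cinner x z - cinner y (z::'h::chilbert_space)"
  using cinner_add_left [of x "- y" z] by simp

lemma cinner_self_eq_zero [simp]: "cinner x x = 0 \<longleftrightarrow> x = (0::'h::chilbert_space)"
  by (simp add: cinner_self)

lemma norm_sq_cinner: "(norm x)\<^sup>2 = Re (cinner x (x::'h::chilbert_space))"
  by (simp add: cinner_self)

lemma Re_cinner_commute: "Re (cinner y x) = Re (cinner x (y::'h::chilbert_space))"
  by (subst cinner_commute) simp

lemma norm_add_sq:
  "(norm (x + y))\<^sup>2 = (norm x)\<^sup>2 + (norm y)\<^sup>2 + 2 * Re (cinner x (y::'h::chilbert_space))"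
  using Re_cinner_commute [of y x] by (simp add: norm_sq_cinner cinner_add_left cinner_add_right)

lemma norm_diff_sq:
  "(norm (x - y))\<^sup>2 = (norm x)\<^sup>2 + (norm y)\<^sup>2 - 2 * Re (cinner x (y::'h::chilbert_space))"
  using Re_cinner_commute [of y x] by (simp add: norm_sq_cinner cinner_diff_left cinner_diff_right)

lemma parallelogram:
  "(norm (x + y))\<^sup>2 + (norm (x - y))\<^sup>2 = 2 * (norm x)\<^sup>2 + 2 * (norm (y::'h::chilbert_space))\<^sup>2"
  by (simp add: norm_add_sq norm_diff_sq)

lemma norm_add_sq_orth:
  "cinner x y = 0 \<Longrightarrow> (norm (x + y))\<^sup>2 = (norm x)\<^sup>2 + (norm (y::'h::chilbert_space))\<^sup>2"
  by (simp add: norm_add_sq)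

lemma cinner_eq_zero_commute: "cinner x y = 0 \<longleftrightarrow> cinner y (x::'h::chilbert_space) = 0"
  by (metis cinner_commute complex_cnj_zero)

lemma cauchy_schwarz: "cmod (cinner x y) \<le> norm x * norm (y::'h::chilbert_space)"
proof (cases "x = 0")
  case False
  define t where "t = cinner x y / complex_of_real ((norm x)\<^sup>2)"
  define z where "z = y - t *\<^sub>C x"
  have nx: "complex_of_real ((norm x)\<^sup>2) \<noteq> 0"
    using False by simp
  have xz: "cinner x z = 0"
    using nx by (simp add: z_def t_def cinner_diff_right cinner_scaleC_right cinner_self)
  then have "cinner (t *\<^sub>C x) z = 0"
    by (simp add: cinner_scaleC_left)
  then have "(norm (t *\<^sub>C x + z))\<^sup>2 = (norm (t *\<^sub>C x))\<^sup>2 + (norm z)\<^sup>2"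
    by (rule norm_add_sq_orth)
  then have "(cmod t * norm x)\<^sup>2 \<le> (norm y)\<^sup>2"
    by (simp add: z_def norm_scaleC)
  then have "cmod t * norm x \<le> norm y"
    by (rule power2_le_imp_le) simp
  moreover have "cmod t * norm x * norm x = cmod (cinner x y)"
    using False by (simp add: t_def norm_divide norm_mult power2_eq_square)
  ultimately show ?thesis
    by (metis mult.commute mult_right_mono norm_ge_zero)
qed simp

lemma bounded_bilinear_cinner: "bounded_bilinear (cinner :: 'h::chilbert_space \<Rightarrow> 'h \<Rightarrow> complex)"
proof
  show "\<exists>K. \<forall>a b :: 'h. cmod (cinner a b) \<le> norm a * norm b * K"
    by (rule exI [of _ 1]) (simp add: cauchy_schwarz)
qed (simp_all add: cinner_add_left cinner_add_right scaleR_scaleC cinner_scaleC_left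
    cinner_scaleC_right scaleC_complex_def)

lemmas tendsto_cinner = bounded_bilinear.tendsto [OF bounded_bilinear_cinner]

lemma cinner_ext: "(\<And>z. cinner z x = cinner z y) \<Longrightarrow> x = (y::'h::chilbert_space)"
  using cinner_self_eq_zero [of "x - y"] by (simp add: cinner_diff_right)

section \<open>Orthogonal decomposition and the Riesz representation theorem\<close>

definition closed_csubspace :: "'h::chilbert_space set \<Rightarrow> bool"
  where "closed_csubspace V \<longleftrightarrow> closed V \<and> 0 \<in> V \<and> (\<forall>x\<in>V. \<forall>y\<in>V. x + y \<in> V) \<and> (\<forall>c. \<forall>x\<in>V. c *\<^sub>C x \<in> V)"

lemma closed_csubspace_diff: "closed_csubspace V \<Longrightarrow> x \<in> V \<Longrightarrow> y \<in> V \<Longrightarrow> x - y \<in> V"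
  unfolding closed_csubspace_def
  by (metis scaleC_minus_left scaleC_one add_uminus_conv_diff)

text \<open>A minimizing sequence is Cauchy: midpoints stay in \<open>V\<close>, so by the
  parallelogram law two almost optimal points are close to each other. Completeness supplies the
  limit.\<close>

lemma csubspace_nearest_point:
  assumes V: "closed_csubspace V"
  obtains y where "y \<in> V" "\<And>v. v \<in> V \<Longrightarrow> norm (x - y) \<le> norm (x - v)"
proof -
  define D where "D = (INF v\<in>V. (norm (x - v))\<^sup>2)"
  have bdd: "bdd_below ((\<lambda>v. (norm (x - v))\<^sup>2) ` V)"
    by (rule bdd_belowI [of _ 0]) auto
  have ne: "V \<noteq> {}"
    using V by (auto simp: closed_csubspace_def)
  have Dle: "D \<le> (norm (x - v))\<^sup>2" if "v \<in> V" for v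
    unfolding D_def using bdd that by (rule cINF_lower)
  have "\<exists>v\<in>V. (norm (x - v))\<^sup>2 < D + 1 / real (Suc n)" for n
    using cINF_less_iff [OF ne bdd, of "D + 1 / real (Suc n)"] by (simp add: D_def)
  then obtain v where vV: "\<And>n. v n \<in> V" and vD: "\<And>n. (norm (x - v n))\<^sup>2 < D + 1 / real (Suc n)"
    by metis
  have near: "(norm (v m - v n))\<^sup>2 \<le> 2 / real (Suc m) + 2 / real (Suc n)" for m n
  proof -
    have "(1/2::complex) *\<^sub>C (v m + v n) \<in> V"
      using V vV by (auto simp: closed_csubspace_def)
    then have "D \<le> (norm (x - (1/2::complex) *\<^sub>C (v m + v n)))\<^sup>2"
      by (rule Dle)
    moreover have "(x - v n) + (x - v m) = (2::complex) *\<^sub>C (x - (1/2::complex) *\<^sub>C (v m + v n))"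
      using scaleC_add_left [of 1 1 x] by (simp add: scaleC_diff_right scaleC_scaleC)
    then have "norm ((x - v n) + (x - v m)) = 2 * norm (x - (1/2::complex) *\<^sub>C (v m + v n))"
      by (simp only: norm_scaleC) simp
    ultimately have "4 * D \<le> (norm ((x - v n) + (x - v m)))\<^sup>2"
      by (simp add: power_mult_distrib)
    moreover have "(x - v n) - (x - v m) = v m - v n"
      by simp
    ultimately show ?thesis
      using parallelogram [of "x - v n" "x - v m"] vD [of m] vD [of n] by (simp only:)
  qed
  have "Cauchy v"
  proof (rule metric_CauchyI)
    fix e :: real assume e: "e > 0"
    obtain M where M: "4 / e\<^sup>2 < real M"
      using reals_Archimedean2 by blast
    have "dist (v m) (v n) < e" if "m \<ge> M" "n \<ge> M" for m n
    proof -
      have M0: "real M > 0"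
        using M e by (smt (verit) divide_nonneg_nonneg zero_le_power2)
      have "2 / real (Suc m) \<le> 2 / real M" "2 / real (Suc n) \<le> 2 / real M"
        using M0 that by (auto intro!: divide_left_mono)
      moreover have "2 / real (Suc m) < 2 / real M"
        using M0 that by (auto intro!: divide_strict_left_mono)
      ultimately have "(norm (v m - v n))\<^sup>2 < 4 / real M"
        using near [of m n] by linarith
      also have "\<dots> < e\<^sup>2"
        using M M0 e by (simp add: pos_divide_less_eq mult.commute)
      finally show ?thesis
        using e by (simp add: dist_norm power_less_imp_less_base)
    qed
    then show "\<exists>M. \<forall>m\<ge>M. \<forall>n\<ge>M. dist (v m) (v n) < e"
      by blast
  qed
  then obtain y where y: "v \<longlonglongrightarrow> y"
    using Cauchy_convergent_iff convergent_def by blast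
  have "y \<in> V"
    using V vV y closed_sequentially [of V v y] by (simp add: closed_csubspace_def)
  moreover have "norm (x - y) \<le> norm (x - w)" if "w \<in> V" for w
  proof -
    have lim: "(\<lambda>n. (norm (x - v n))\<^sup>2) \<longlonglongrightarrow> (norm (x - y))\<^sup>2"
      by (intro tendsto_intros y)
    have lim2: "(\<lambda>n. D + 1 / real (Suc n)) \<longlonglongrightarrow> D + 0"
      by (intro tendsto_intros LIMSEQ_inverse_real_of_nat [unfolded inverse_eq_divide])
    have "(norm (x - y))\<^sup>2 \<le> D + 0"
      by (rule LIMSEQ_le [OF lim lim2]) (use vD in \<open>auto intro: less_imp_le\<close>)
    also have "D + 0 \<le> (norm (x - w))\<^sup>2"
      using Dle [OF that] by simp
    finally show ?thesis
      by (rule power2_le_imp_le) simp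
  qed
  ultimately show ?thesis
    by (rule that)
qed

text \<open>First variation at the nearest point: unless \<open>cinner v z\<close> vanishes, a small
  move of \<open>y\<close> along a multiple of \<open>v\<close> would decrease the distance to
  \<open>x\<close>.\<close>

lemma orthogonal_decomposition:
  assumes V: "closed_csubspace V"
  obtains y where "y \<in> V" "\<And>v. v \<in> V \<Longrightarrow> cinner v (x - y) = 0"
proof -
  obtain y where y: "y \<in> V" and min: "\<And>v. v \<in> V \<Longrightarrow> norm (x - y) \<le> norm (x - v)"
    using csubspace_nearest_point [OF V] by blast
  define z where "z = x - y"
  have "cinner v z = 0" if v: "v \<in> V" for v
  proof -
    \<comment> \<open>With this step length the quadratic term stays below the linear gain; the
      added 1 covers \<open>v = 0\<close>.\<close>
    define s where "s = 1 / ((norm v)\<^sup>2 + 1)"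
    define c where "c = cinner v z"
    have s: "s > 0" "s * (norm v)\<^sup>2 < 1"
      by (simp_all add: s_def divide_less_eq add_nonneg_pos)
    define u where "u = (complex_of_real s * c) *\<^sub>C v"
    have "y + u \<in> V"
      using V y v by (auto simp: closed_csubspace_def u_def)
    then have "norm z \<le> norm (z - u)"
      using min [of "y + u"] by (simp add: z_def algebra_simps)
    then have "(norm z)\<^sup>2 \<le> (norm (z - u))\<^sup>2"
      by (rule power_mono) simp
    moreover have "Re (cinner z u) = s * (cmod c)\<^sup>2"
    proof -
      have "cinner z u = complex_of_real s * (c * cnj c)"
        by (simp add: u_def cinner_scaleC_right c_def cinner_commute [of z v])
      then show ?thesis
        by (simp only: complex_norm_square [symmetric] of_real_mult [symmetric] of_real_power [symmetric] Re_complex_of_real)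
    qed
    moreover have "(norm u)\<^sup>2 = s * (s * (norm v)\<^sup>2) * (cmod c)\<^sup>2"
      using s by (simp add: u_def norm_scaleC norm_mult power_mult_distrib power2_eq_square)
    ultimately have "0 \<le> (s * (s * (norm v)\<^sup>2) - 2 * s) * (cmod c)\<^sup>2"
      by (simp add: norm_diff_sq algebra_simps)
    moreover have "s * (s * (norm v)\<^sup>2) - 2 * s < 0"
    proof -
      have "s * (s * (norm v)\<^sup>2) < s * 1"
        using s by (intro mult_strict_left_mono)
      then show ?thesis using s by simp
    qed
    ultimately show ?thesis
      by (simp add: c_def zero_le_mult_iff)
  qed
  with y show ?thesis
    using that by (simp add: z_def)
qed

lemma orthogonal_decomposition_unique:
  assumes V: "closed_csubspace V"
    and "y \<in> V" "\<And>v. v \<in> V \<Longrightarrow> cinner v (x - y) = 0"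
    and "y' \<in> V" "\<And>v. v \<in> V \<Longrightarrow> cinner v (x - y') = 0"
  shows "y = y'"
proof -
  have "y - y' \<in> V"
    using assms closed_csubspace_diff by blast
  then have "cinner (y - y') (x - y') = 0" "cinner (y - y') (x - y) = 0"
    using assms by auto
  then have "cinner (y - y') ((x - y') - (x - y)) = 0"
    by (simp only: cinner_diff_right [of "y - y'" "x - y'"]) simp
  then show ?thesis
    by simp
qed

text \<open>The kernel has codimension at most one, so a nonzero vector \<open>z\<close> orthogonal
  to it determines \<open>f\<close> up to the scalar fixed by \<open>f z\<close>.\<close>

lemma riesz_representation:
  fixes f :: "'h::chilbert_space \<Rightarrow> complex"
  assumes f: "bounded_linear f" and fC: "\<And>c x. f (c *\<^sub>C x) = c * f x"
  obtains y where "\<And>x. f x = cinner y x"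
proof -
  define V where "V = {x. f x = 0}"
  have V: "closed_csubspace V"
    unfolding closed_csubspace_def V_def
    using closed_Collect_eq [OF linear_continuous_on [OF f] continuous_on_const, of 0]
      linear_add [OF bounded_linear.linear [OF f]] linear_0 [OF bounded_linear.linear [OF f]]
    by (auto simp: fC)
  show ?thesis
  proof (cases "\<forall>x. f x = 0")
    case True
    then show ?thesis
      using that [of 0] by simp
  next
    case False
    then obtain x0 where x0: "f x0 \<noteq> 0" by blast
    obtain y where y: "y \<in> V" and yo: "\<And>v. v \<in> V \<Longrightarrow> cinner v (x0 - y) = 0"
      using orthogonal_decomposition [OF V] by blast
    define z where "z = x0 - y"
    have fz: "f z \<noteq> 0"
      using x0 y by (simp add: z_def V_def linear_diff [OF bounded_linear.linear [OF f]])
    then have z: "z \<noteq> 0"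
      using linear_0 [OF bounded_linear.linear [OF f]] by auto
    have "f x = cinner ((cnj (f z) / complex_of_real ((norm z)\<^sup>2)) *\<^sub>C z) x" for x
    proof -
      have "x - (f x / f z) *\<^sub>C z \<in> V"
        using fz by (simp add: V_def linear_diff [OF bounded_linear.linear [OF f]] fC)
      then have "cinner (x - (f x / f z) *\<^sub>C z) z = 0"
        using yo z_def by blast
      then have "cinner z (x - (f x / f z) *\<^sub>C z) = 0"
        by (simp add: cinner_eq_zero_commute)
      then have "cinner z x = (f x / f z) * complex_of_real ((norm z)\<^sup>2)"
        by (simp add: cinner_diff_right cinner_scaleC_right cinner_self)
      then show ?thesis
        using fz z by (simp add: cinner_scaleC_left)
    qed
    then show ?thesis
      by (rule that)
  qed
qed


section \<open>The algebra of bounded operators\<close>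

text \<open>Complex linear operators form a type of their own so that products, sums and adjoints
  obey the algebraic simplification rules without side conditions. The notions of the statement are
  recovered through \<open>Rep_cop\<close>.\<close>

typedef (overloaded) 'h cop = "cbounded_ops :: ('h::chilbert_space \<Rightarrow>\<^sub>L 'h) set"
  by (rule exI [of _ 0]) (simp add: cbounded_ops_def)

setup_lifting type_definition_cop

instantiation cop :: (chilbert_space) real_vector
begin
lift_definition zero_cop :: "'a cop" is 0
  by (simp add: cbounded_ops_def)
lift_definition plus_cop :: "'a cop \<Rightarrow> 'a cop \<Rightarrow> 'a cop" is "(+)"
  by (simp add: cbounded_ops_def blinfun.add_left scaleC_add_right)
lift_definition minus_cop :: "'a cop \<Rightarrow> 'a cop \<Rightarrow> 'a cop" is "(-)"
  by (simp add: cbounded_ops_def blinfun.diff_left scaleC_diff_right)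
lift_definition uminus_cop :: "'a cop \<Rightarrow> 'a cop" is uminus
  by (simp add: cbounded_ops_def blinfun.minus_left)
lift_definition scaleR_cop :: "real \<Rightarrow> 'a cop \<Rightarrow> 'a cop" is scaleR
  by (simp add: cbounded_ops_def scaleR_scaleC scaleC_blinfun.rep_eq scaleC_scaleC mult.commute)
instance
  by standard (transfer, simp add: scaleR_add_right scaleR_add_left)+
end

instantiation cop :: (chilbert_space) complex_vector
begin
lift_definition scaleC_cop :: "complex \<Rightarrow> 'a cop \<Rightarrow> 'a cop" is scaleC
  by (simp add: cbounded_ops_def scaleC_blinfun.rep_eq scaleC_scaleC mult.commute)
instance
  by standard (transfer, simp add: scaleC_add_right scaleC_add_left scaleC_scaleC scaleR_scaleC)+
end

instantiation cop :: (chilbert_space) real_normed_vector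
begin
lift_definition norm_cop :: "'a cop \<Rightarrow> real" is norm .
definition dist_cop :: "'a cop \<Rightarrow> 'a cop \<Rightarrow> real" where "dist_cop x y = norm (x - y)"
definition uniformity_cop :: "('a cop \<times> 'a cop) filter"
  where "uniformity_cop = (INF e\<in>{0 <..}. principal {(x, y). dist x y < e})"
definition open_cop :: "'a cop set \<Rightarrow> bool"
  where "open_cop U = (\<forall>x\<in>U. eventually (\<lambda>(x', y). x' = x \<longrightarrow> y \<in> U) uniformity)"
definition sgn_cop :: "'a cop \<Rightarrow> 'a cop" where "sgn_cop x = x /\<^sub>R norm x"
instance
proof
  fix x y :: "'a cop" and a :: real
  show "norm x = 0 \<longleftrightarrow> x = 0" by transfer simp
  show "norm (x + y) \<le> norm x + norm y" by transfer (rule norm_triangle_ineq)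
  show "norm (a *\<^sub>R x) = \<bar>a\<bar> * norm x" by transfer simp
qed (simp_all add: dist_cop_def uniformity_cop_def open_cop_def sgn_cop_def)
end

text \<open>The unit comes without the axiom \<open>norm 1 = 1\<close>, which fails on the zero
  space; hence \<open>monoid_mult\<close> next to \<open>real_normed_algebra\<close>.\<close>

instantiation cop :: (chilbert_space) monoid_mult
begin
lift_definition one_cop :: "'a cop" is id_blinfun
  by (simp add: cbounded_ops_def)
lift_definition times_cop :: "'a cop \<Rightarrow> 'a cop \<Rightarrow> 'a cop" is "(o\<^sub>L)"
  by (simp add: cbounded_ops_def)
instance
  by standard (transfer, rule blinfun_eqI, simp)+
end

instance cop :: (chilbert_space) real_normed_algebra
proof
  fix x y z :: "'a cop" and a :: real
  show "(x + y) * z = x * z + y * z" "x * (y + z) = x * y + x * z"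
    by (transfer, rule blinfun_eqI, simp add: blinfun.add_left blinfun.add_right)+
  show "a *\<^sub>R x * y = a *\<^sub>R (x * y)" "x * a *\<^sub>R y = a *\<^sub>R (x * y)"
    by (transfer, rule blinfun_eqI, simp add: blinfun.scaleR_left blinfun.scaleR_right)+
  show "norm (x * y) \<le> norm x * norm y"
    by transfer (rule norm_blinfun_compose)
qed

lemma closed_cbounded_ops: "closed (cbounded_ops :: ('h::chilbert_space \<Rightarrow>\<^sub>L 'h) set)"
proof -
  have "closed {T :: 'h \<Rightarrow>\<^sub>L 'h. blinfun_apply T (c *\<^sub>C x) = c *\<^sub>C blinfun_apply T x}" for c x
    by (intro closed_Collect_eq continuous_intros
        linear_continuous_on bounded_linear_compose [OF bounded_linear_scaleC]
        blinfun.bounded_linear_left)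
  then have "closed (\<Inter>c. \<Inter>x. {T :: 'h \<Rightarrow>\<^sub>L 'h. blinfun_apply T (c *\<^sub>C x) = c *\<^sub>C blinfun_apply T x})"
    by (intro closed_INT ballI)
  then show ?thesis
    by (simp add: cbounded_ops_def Collect_all_eq)
qed

instance cop :: (chilbert_space) banach
proof
  fix X :: "nat \<Rightarrow> 'a cop"
  assume X: "Cauchy X"
  have d: "dist x y = dist (Rep_cop x) (Rep_cop y)" for x y :: "'a cop"
    by (simp add: dist_cop_def norm_cop.rep_eq minus_cop.rep_eq dist_norm)
  have "Cauchy (\<lambda>n. Rep_cop (X n))"
    using X by (simp add: Cauchy_def d)
  then obtain L where L: "(\<lambda>n. Rep_cop (X n)) \<longlonglongrightarrow> L"
    using Cauchy_convergent_iff convergent_def by blast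
  then have "L \<in> cbounded_ops"
    by (rule closed_sequentially [OF closed_cbounded_ops, rotated]) (rule Rep_cop)
  then have "Rep_cop (Abs_cop L) = L"
    by (rule Abs_cop_inverse)
  then have "X \<longlonglongrightarrow> Abs_cop L"
    using L by (simp add: lim_sequentially d)
  then show "convergent X"
    by (rule convergentI)
qed

lift_definition app :: "'h::chilbert_space cop \<Rightarrow> 'h \<Rightarrow> 'h" (infixr "\<rhd>" 68) is blinfun_apply .

lemma app_zero_left [simp]: "0 \<rhd> \<xi> = 0" by transfer simp
lemma app_zero_right [simp]: "x \<rhd> 0 = 0" by transfer (simp add: blinfun.zero_right)
lemma app_one [simp]: "1 \<rhd> \<xi> = \<xi>" by transfer simp
lemma app_mult: "(x * y) \<rhd> \<xi> = x \<rhd> (y \<rhd> \<xi>)" by transfer simp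
lemma app_add_left: "(x + y) \<rhd> \<xi> = (x \<rhd> \<xi>) + (y \<rhd> \<xi>)" by transfer (simp add: blinfun.add_left)
lemma app_add_right: "x \<rhd> (\<xi> + \<eta>) = (x \<rhd> \<xi>) + (x \<rhd> \<eta>)" by transfer (simp add: blinfun.add_right)
lemma app_diff_left: "(x - y) \<rhd> \<xi> = (x \<rhd> \<xi>) - (y \<rhd> \<xi>)" by transfer (simp add: blinfun.diff_left)
lemma app_diff_right: "x \<rhd> (\<xi> - \<eta>) = (x \<rhd> \<xi>) - (x \<rhd> \<eta>)" by transfer (simp add: blinfun.diff_right)
lemma app_minus_left: "(- x) \<rhd> \<xi> = - (x \<rhd> \<xi>)" by transfer (simp add: blinfun.minus_left)
lemma app_scaleC_left: "(c *\<^sub>C x) \<rhd> \<xi> = c *\<^sub>C (x \<rhd> \<xi>)" by transfer (simp add: scaleC_blinfun.rep_eq)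
lemma app_scaleC_right: "x \<rhd> (c *\<^sub>C \<xi>) = c *\<^sub>C (x \<rhd> \<xi>)" by transfer (simp add: cbounded_ops_def)
lemma app_scaleR_left: "(r *\<^sub>R x) \<rhd> \<xi> = r *\<^sub>R (x \<rhd> \<xi>)" by transfer (simp add: blinfun.scaleR_left)
lemma app_scaleR_right: "x \<rhd> (r *\<^sub>R \<xi>) = r *\<^sub>R (x \<rhd> \<xi>)" by transfer (simp add: blinfun.scaleR_right)
lemma norm_app: "norm (x \<rhd> \<xi>) \<le> norm x * norm \<xi>" by transfer (rule norm_blinfun)

lemma cinner_scaleR_right: "cinner \<xi> (r *\<^sub>R \<eta>) = complex_of_real r * cinner \<xi> (\<eta>::'h::chilbert_space)"
  by (simp add: scaleR_scaleC cinner_scaleC_right)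

lemma app_sum_left: "(\<Sum>i\<in>I. x i) \<rhd> \<xi> = (\<Sum>i\<in>I. x i \<rhd> \<xi>)"
  by (induction I rule: infinite_finite_induct) (simp_all add: app_add_left)

lemma cop_eqI: "(\<And>\<xi>. x \<rhd> \<xi> = y \<rhd> \<xi>) \<Longrightarrow> x = y"
  by transfer (rule blinfun_eqI)

lemma norm_cop_bound: "0 \<le> c \<Longrightarrow> (\<And>\<xi>. norm (x \<rhd> \<xi>) \<le> c * norm \<xi>) \<Longrightarrow> norm x \<le> c"
  by transfer (rule norm_blinfun_bound)

lemma bounded_bilinear_app: "bounded_bilinear (app :: 'h::chilbert_space cop \<Rightarrow> 'h \<Rightarrow> 'h)"
proof
  show "\<exists>K. \<forall>(a :: 'h cop) b. norm (a \<rhd> b) \<le> norm a * norm b * K"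
    by (rule exI [of _ 1]) (simp add: norm_app)
qed (simp_all add: app_add_left app_add_right app_scaleR_left app_scaleR_right)

lemma bounded_linear_app: "bounded_linear ((\<rhd>) x)"
  by (rule bounded_bilinear.bounded_linear_right [OF bounded_bilinear_app])

lemma scaleC_mult_left: "(c *\<^sub>C x) * y = c *\<^sub>C (x * (y::'h::chilbert_space cop))"
  by (rule cop_eqI) (simp add: app_mult app_scaleC_left)

lemma scaleC_mult_right: "x * (c *\<^sub>C y) = c *\<^sub>C (x * (y::'h::chilbert_space cop))"
  by (rule cop_eqI) (simp add: app_mult app_scaleC_left app_scaleC_right)

lemmas scaleC_mult = scaleC_mult_left scaleC_mult_right

lemma cop_of_function:
  assumes "\<And>\<xi> \<eta>. f (\<xi> + \<eta>) = f \<xi> + f \<eta>" "\<And>c \<xi>. f (c *\<^sub>C \<xi>) = c *\<^sub>C f \<xi>"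
    and "\<And>\<xi>. norm (f \<xi>) \<le> K * norm (\<xi>::'h::chilbert_space)"
  obtains x where "\<And>\<xi>. x \<rhd> \<xi> = f \<xi>"
proof -
  have bl: "bounded_linear f"
    using assms by (intro bounded_linear_intro [of f K]) (auto simp: scaleR_scaleC mult.commute)
  have "Blinfun f \<in> cbounded_ops"
    by (simp add: cbounded_ops_def bounded_linear_Blinfun_apply [OF bl] assms)
  then have "Abs_cop (Blinfun f) \<rhd> \<xi> = f \<xi>" for \<xi>
    by (simp add: app.rep_eq Abs_cop_inverse bounded_linear_Blinfun_apply [OF bl])
  then show ?thesis
    by (rule that)
qed

subsection \<open>Adjoints\<close>

text \<open>Riesz representation of the functional taking \<open>\<eta>\<close> to
  \<open>cinner \<xi> (x \<rhd> \<eta>)\<close> defines the operator pointwise; Cauchy-Schwarz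
  bounds it by \<open>norm x\<close>.\<close>

lemma adjoint_exists:
  "\<exists>s. \<forall>\<xi> \<eta>. cinner (s \<rhd> \<xi>) \<eta> = cinner \<xi> (x \<rhd> (\<eta>::'h::chilbert_space))"
proof -
  have "\<exists>\<zeta>. \<forall>\<eta>. cinner \<xi> (x \<rhd> \<eta>) = cinner \<zeta> \<eta>" for \<xi>
  proof -
    have bl: "bounded_linear (\<lambda>\<eta>. cinner \<xi> (x \<rhd> \<eta>))"
      by (rule bounded_linear_compose [OF bounded_bilinear.bounded_linear_right
            [OF bounded_bilinear_cinner] bounded_linear_app])
    show ?thesis
      by (rule riesz_representation [OF bl]) (auto simp: app_scaleC_right cinner_scaleC_right)
  qed
  then obtain f where f: "\<And>\<xi> \<eta>. cinner (f \<xi>) \<eta> = cinner \<xi> (x \<rhd> \<eta>)"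
    by metis
  have flip: "cinner \<eta> (f \<xi>) = cinner (x \<rhd> \<eta>) \<xi>" for \<xi> \<eta>
    by (metis f cinner_commute)
  obtain s where "\<And>\<xi>. s \<rhd> \<xi> = f \<xi>"
  proof (rule cop_of_function)
    show "f (\<xi> + \<eta>) = f \<xi> + f \<eta>" for \<xi> \<eta>
      by (rule cinner_ext) (simp add: flip cinner_add_right)
    show "f (c *\<^sub>C \<xi>) = c *\<^sub>C f \<xi>" for c \<xi>
      by (rule cinner_ext) (simp add: flip cinner_scaleC_right)
    show "norm (f \<xi>) \<le> norm x * norm \<xi>" for \<xi>
    proof -
      have "(norm (f \<xi>))\<^sup>2 = cmod (cinner (f \<xi>) (f \<xi>))"
        by (simp add: cinner_self norm_power)
      also have "\<dots> \<le> norm \<xi> * norm (x \<rhd> f \<xi>)"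
        unfolding f by (rule cauchy_schwarz)
      also have "\<dots> \<le> norm \<xi> * (norm x * norm (f \<xi>))"
        by (intro mult_left_mono norm_app) simp
      finally have "norm (f \<xi>) * norm (f \<xi>) \<le> (norm x * norm \<xi>) * norm (f \<xi>)"
        by (simp add: power2_eq_square mult_ac)
      then show ?thesis
        by (cases "f \<xi> = 0") simp_all
    qed
  qed blast
  then show ?thesis
    using f by metis
qed

definition adj :: "'h::chilbert_space cop \<Rightarrow> 'h cop"
  where "adj x = (SOME s. \<forall>\<xi> \<eta>. cinner (s \<rhd> \<xi>) \<eta> = cinner \<xi> (x \<rhd> \<eta>))"

lemma cinner_adj_left: "cinner (adj x \<rhd> \<xi>) \<eta> = cinner \<xi> (x \<rhd> \<eta>)"
  unfolding adj_def using someI_ex [OF adjoint_exists [of x]] by blast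

lemma cinner_adj_right: "cinner \<xi> (adj x \<rhd> \<eta>) = cinner (x \<rhd> \<xi>) \<eta>"
  by (metis cinner_adj_left cinner_commute)

lemma adj_eqI:
  assumes "\<And>\<xi> \<eta>. cinner \<xi> (s \<rhd> \<eta>) = cinner (x \<rhd> \<xi>) \<eta>" shows "adj x = s"
  by (rule cop_eqI, rule cinner_ext) (simp add: cinner_adj_right assms)

lemma adj_adj [simp]: "adj (adj x) = x"
  by (rule adj_eqI) (simp add: cinner_adj_left)

lemma adj_mult [simp]: "adj (x * y) = adj y * adj x"
  by (rule adj_eqI) (simp add: cinner_adj_right app_mult)

lemma adj_add [simp]: "adj (x + y) = adj x + adj y"
  by (rule adj_eqI) (simp add: cinner_adj_right app_add_left cinner_add_left cinner_add_right)

lemma adj_diff [simp]: "adj (x - y) = adj x - adj y"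
  by (rule adj_eqI) (simp add: cinner_adj_right app_diff_left cinner_diff_left cinner_diff_right)

lemma adj_minus [simp]: "adj (- x) = - adj x"
  by (rule adj_eqI) (simp add: cinner_adj_right app_minus_left)

lemma adj_scaleC [simp]: "adj (c *\<^sub>C x) = cnj c *\<^sub>C adj x"
  by (rule adj_eqI) (simp add: cinner_adj_right app_scaleC_left cinner_scaleC_left cinner_scaleC_right)

lemma adj_scaleR [simp]: "adj (r *\<^sub>R x) = r *\<^sub>R adj x"
  by (simp add: scaleR_scaleC)

lemma adj_one [simp]: "adj 1 = 1"
  by (rule adj_eqI) simp

lemma adj_zero [simp]: "adj 0 = 0"
  by (rule adj_eqI) simp

lemma adj_sum: "adj (\<Sum>i\<in>I. x i) = (\<Sum>i\<in>I. adj (x i))"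
  by (induction I rule: infinite_finite_induct) simp_all

lemma norm_adj_le: "norm (adj x) \<le> norm x"
proof (rule norm_cop_bound)
  fix \<xi>
  have "(norm (adj x \<rhd> \<xi>))\<^sup>2 = cmod (cinner (adj x \<rhd> \<xi>) (adj x \<rhd> \<xi>))"
    by (simp add: cinner_self norm_power)
  also have "\<dots> \<le> norm \<xi> * norm (x \<rhd> (adj x \<rhd> \<xi>))"
    unfolding cinner_adj_left by (rule cauchy_schwarz)
  also have "\<dots> \<le> norm \<xi> * (norm x * norm (adj x \<rhd> \<xi>))"
    by (intro mult_left_mono norm_app) simp
  finally have "norm (adj x \<rhd> \<xi>) * norm (adj x \<rhd> \<xi>) \<le> (norm x * norm \<xi>) * norm (adj x \<rhd> \<xi>)"
    by (simp add: power2_eq_square mult_ac)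
  then show "norm (adj x \<rhd> \<xi>) \<le> norm x * norm \<xi>"
    by (cases "adj x \<rhd> \<xi> = 0") simp_all
qed simp

lemma tendsto_adj:
  assumes "(f \<longlongrightarrow> x) F" shows "((\<lambda>i. adj (f i)) \<longlongrightarrow> adj x) F"
proof (rule LIM_zero_cancel, rule tendsto_norm_zero_cancel, rule tendsto_sandwich [where f = "\<lambda>_. 0"])
  show "((\<lambda>i. norm (f i - x)) \<longlongrightarrow> 0) F"
    using assms by (simp add: LIM_zero tendsto_norm_zero)
  show "\<forall>\<^sub>F i in F. norm (adj (f i) - adj x) \<le> norm (f i - x)"
    using norm_adj_le [of "f _ - x"] by (intro always_eventually) (simp add: adj_diff [symmetric] del: adj_diff)
  show "\<forall>\<^sub>F i in F. 0 \<le> norm (adj (f i) - adj x)" "((\<lambda>_. 0::real) \<longlongrightarrow> 0) F"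
    by simp_all
qed

subsection \<open>Positive operators and projections\<close>

definition pos :: "'h::chilbert_space cop \<Rightarrow> bool"
  where "pos x \<longleftrightarrow> (\<forall>\<xi>. cinner \<xi> (x \<rhd> \<xi>) \<in> \<real>\<^sub>\<ge>\<^sub>0)"

lemma pos_iff: "pos x \<longleftrightarrow> (\<forall>\<xi>. Re (cinner \<xi> (x \<rhd> \<xi>)) \<ge> 0 \<and> Im (cinner \<xi> (x \<rhd> \<xi>)) = 0)"
  by (simp add: pos_def complex_nonneg_Reals_iff)

lemma pos_adj_mult: "pos (adj x * x)"
  unfolding pos_def by (simp add: app_mult cinner_adj_right cinner_self)

lemma pos_add: "pos x \<Longrightarrow> pos y \<Longrightarrow> pos (x + y)"
  by (simp add: pos_iff app_add_left cinner_add_right)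

lemma pos_scaleR: "pos x \<Longrightarrow> 0 \<le> r \<Longrightarrow> pos (r *\<^sub>R x)"
  by (simp add: pos_iff app_scaleR_left) (simp add: scaleR_scaleC cinner_scaleC_right)

lemma pos_zero [simp]: "pos 0"
  by (simp add: pos_iff)

lemma pos_sum: "(\<And>i. i \<in> I \<Longrightarrow> pos (x i)) \<Longrightarrow> pos (\<Sum>i\<in>I. x i)"
  by (induction I rule: infinite_finite_induct) (simp_all add: pos_add)

lemma pos_conj: "pos x \<Longrightarrow> pos (adj y * x * y)"
  unfolding pos_def by (simp add: app_mult cinner_adj_right)

text \<open>Polarization: testing \<open>\<xi> + \<eta>\<close> and
  \<open>\<xi> + \<i> *\<^sub>C \<eta>\<close> gives the sum and the difference of the two mixed
  terms, so complex scalars are essential here.\<close>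

lemma quadratic_form_zero:
  assumes "\<And>\<xi>. cinner \<xi> (x \<rhd> \<xi>) = 0" shows "x = 0"
proof (rule cop_eqI, rule cinner_ext)
  fix \<xi> \<eta>
  have "cinner \<xi> (x \<rhd> \<eta>) + cinner \<eta> (x \<rhd> \<xi>) = 0"
    using assms [of "\<xi> + \<eta>"]
    by (simp add: app_add_right cinner_add_left cinner_add_right assms add.commute)
  moreover have "cinner \<xi> (x \<rhd> \<eta>) - cinner \<eta> (x \<rhd> \<xi>) = 0"
    using assms [of "\<xi> + \<i> *\<^sub>C \<eta>"]
    by (simp add: app_add_right cinner_add_left cinner_add_right assms app_scaleC_right
        cinner_scaleC_left cinner_scaleC_right)
  ultimately show "cinner \<xi> (x \<rhd> \<eta>) = cinner \<xi> (0 \<rhd> \<eta>)"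
    by simp
qed

lemma cinner_hermitian_real: "adj x = x \<Longrightarrow> Im (cinner \<xi> (x \<rhd> \<xi>)) = 0"
  by (metis cinner_adj_left cinner_commute complex_cnj_cancel_iff cnj.simps(2) equation_minus_iff
      neg_equal_zero)

lemma pos_hermitian: assumes "pos x" shows "adj x = x"
proof -
  have "x - adj x = 0"
  proof (rule quadratic_form_zero)
    fix \<xi>
    have "cinner \<xi> (x \<rhd> \<xi>) = cnj (cinner \<xi> (x \<rhd> \<xi>))"
      using assms by (simp add: pos_iff complex_eq_iff)
    also have "\<dots> = cinner \<xi> (adj x \<rhd> \<xi>)"
      by (simp add: cinner_adj_right cinner_commute [of "x \<rhd> \<xi>"])
    finally show "cinner \<xi> ((x - adj x) \<rhd> \<xi>) = 0"
      by (simp add: app_diff_left cinner_diff_right)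
  qed
  then show ?thesis by simp
qed

lemma pos_hermitianI: "adj x = x \<Longrightarrow> (\<And>\<xi>. 0 \<le> Re (cinner \<xi> (x \<rhd> \<xi>))) \<Longrightarrow> pos x"
  by (simp add: pos_iff cinner_hermitian_real)

lemma pos_antisym: "pos x \<Longrightarrow> pos (- x) \<Longrightarrow> x = 0"
  by (rule quadratic_form_zero)
    (force simp: pos_iff app_minus_left complex_eq_iff intro: antisym)

text \<open>Polarization balanced by the parallelogram law. It turns order estimates for hermitian
  operators into norm estimates without spectral theory.\<close>

lemma norm_hermitian_bound:
  assumes h: "adj h = h" and c: "0 \<le> c" and le: "\<And>\<xi>. \<bar>Re (cinner \<xi> (h \<rhd> \<xi>))\<bar> \<le> c * (norm \<xi>)\<^sup>2"
  shows "norm h \<le> c"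
proof (rule norm_cop_bound [OF c])
  fix \<xi>
  show "norm (h \<rhd> \<xi>) \<le> c * norm \<xi>"
  proof (cases "h \<rhd> \<xi> = 0 \<or> \<xi> = 0")
    case True
    then show ?thesis using c by auto
  next
    case False
    \<comment> \<open>Rescaled to the length of \<open>\<xi>\<close>, so that the parallelogram law
      yields \<open>4 * c * (norm \<xi>)\<^sup>2\<close> without loss.\<close>
    define \<eta> where "\<eta> = (norm \<xi> / norm (h \<rhd> \<xi>)) *\<^sub>R (h \<rhd> \<xi>)"
    have n: "norm \<eta> = norm \<xi>"
      using False by (simp add: \<eta>_def)
    have "cinner \<xi> (h \<rhd> \<eta>) = cinner (h \<rhd> \<xi>) \<eta>"
      by (metis h cinner_adj_left)
    then have re: "Re (cinner \<xi> (h \<rhd> \<eta>)) = Re (cinner (h \<rhd> \<xi>) \<eta>)" "Re (cinner \<eta> (h \<rhd> \<xi>)) = Re (cinner (h \<rhd> \<xi>) \<eta>)"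
      by (simp_all add: Re_cinner_commute)
    have "Re (cinner (h \<rhd> \<xi>) \<eta>) = norm \<xi> * norm (h \<rhd> \<xi>)"
      using False by (simp add: \<eta>_def scaleR_scaleC cinner_scaleC_right cinner_self power2_eq_square)
    then have "4 * (norm \<xi> * norm (h \<rhd> \<xi>)) =
        Re (cinner (\<xi> + \<eta>) (h \<rhd> (\<xi> + \<eta>))) - Re (cinner (\<xi> - \<eta>) (h \<rhd> (\<xi> - \<eta>)))"
      by (simp add: app_add_right app_diff_right cinner_add_left cinner_add_right cinner_diff_left
          cinner_diff_right re)
    also have "\<dots> \<le> c * (norm (\<xi> + \<eta>))\<^sup>2 + c * (norm (\<xi> - \<eta>))\<^sup>2"
      using le [of "\<xi> + \<eta>"] le [of "\<xi> - \<eta>"] by linarith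
    also have "\<dots> = 4 * (norm \<xi> * (c * norm \<xi>))"
      using parallelogram [of \<xi> \<eta>]
      by (simp only: distrib_left [symmetric] n) (simp add: power2_eq_square)
    finally show ?thesis
      using False by simp
  qed
qed

section \<open>Orthogonal projections\<close>

definition is_proj :: "'h::chilbert_space cop \<Rightarrow> bool"
  where "is_proj p \<longleftrightarrow> adj p = p \<and> p * p = p"

lemma is_projD: "is_proj p \<Longrightarrow> adj p = p" "is_proj p \<Longrightarrow> p * p = p"
  by (simp_all add: is_proj_def)

lemma proj_absorb: "is_proj p \<Longrightarrow> p * (p * x) = p * x"
  by (simp add: is_proj_def mult.assoc [symmetric])

lemma is_proj_zero [simp]: "is_proj 0" and is_proj_one [simp]: "is_proj 1"
  by (simp_all add: is_proj_def)

lemma is_proj_compl: "is_proj p \<Longrightarrow> is_proj (1 - p)"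
  by (simp add: is_proj_def algebra_simps)

lemma pos_proj: "is_proj p \<Longrightarrow> pos p"
  using pos_adj_mult [of p] by (simp add: is_proj_def)

lemma cinner_proj: "is_proj p \<Longrightarrow> cinner \<xi> (p \<rhd> \<xi>) = complex_of_real ((norm (p \<rhd> \<xi>))\<^sup>2)"
  by (metis cinner_adj_left is_projD app_mult cinner_self)

lemma proj_pythagoras:
  assumes "is_proj p"
  shows "(norm \<xi>)\<^sup>2 = (norm (p \<rhd> \<xi>))\<^sup>2 + (norm ((1 - p) \<rhd> \<xi>))\<^sup>2"
proof -
  have "cinner (p \<rhd> \<xi>) ((1 - p) \<rhd> \<xi>) = cinner \<xi> ((p * (1 - p)) \<rhd> \<xi>)"
    by (metis assms cinner_adj_left is_projD(1) app_mult)
  then have "cinner (p \<rhd> \<xi>) ((1 - p) \<rhd> \<xi>) = 0"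
    using assms by (simp add: is_projD algebra_simps)
  from norm_add_sq_orth [OF this] show ?thesis
    by (simp add: app_diff_left)
qed

lemma norm_proj_app:
  assumes "is_proj p" shows "norm (p \<rhd> \<xi>) \<le> norm \<xi>"
proof (rule power2_le_imp_le)
  show "(norm (p \<rhd> \<xi>))\<^sup>2 \<le> (norm \<xi>)\<^sup>2"
    unfolding proj_pythagoras [OF assms, of \<xi>] by (rule le_add_same_cancel1 [THEN iffD2]) simp
qed simp

lemma proj_sub_iff: "is_proj p \<Longrightarrow> is_proj q \<Longrightarrow> p * q = p \<longleftrightarrow> q * p = p"
  by (metis adj_mult is_projD(1))

lemma orth_commute: "is_proj p \<Longrightarrow> is_proj q \<Longrightarrow> p * q = 0 \<Longrightarrow> q * p = 0"
  by (metis adj_mult adj_zero is_projD(1))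

lemma is_proj_add: "is_proj p \<Longrightarrow> is_proj q \<Longrightarrow> p * q = 0 \<Longrightarrow> is_proj (p + q)"
  using orth_commute [of p q] by (simp add: is_proj_def distrib_left distrib_right)

lemma is_proj_diff: "is_proj p \<Longrightarrow> is_proj q \<Longrightarrow> q * p = q \<Longrightarrow> is_proj (p - q)"
  by (simp add: is_proj_def algebra_simps) (metis adj_mult diff_self)

lemma is_proj_sum:
  assumes "finite I" "\<And>i. i \<in> I \<Longrightarrow> is_proj (p i)"
    and "\<And>i j. i \<in> I \<Longrightarrow> j \<in> I \<Longrightarrow> i \<noteq> j \<Longrightarrow> p i * p j = 0"
  shows "is_proj (\<Sum>i\<in>I. p i)"
  using assms
proof (induction I rule: finite_induct)
  case (insert i I)
  then have "p i * (\<Sum>i\<in>I. p i) = 0"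
    by (auto simp: sum_distrib_left intro!: sum.neutral)
  with insert show ?case
    by (auto intro!: is_proj_add)
qed simp

lemma pos_proj_diff: "is_proj p \<Longrightarrow> is_proj q \<Longrightarrow> p * q = p \<Longrightarrow> pos (q - p)"
  by (simp add: pos_proj is_proj_diff)

text \<open>Uniqueness of the orthogonal decomposition makes the chosen nearest points depend
  linearly on the vector; Pythagoras makes the map a contraction.\<close>

lemma projection_onto:
  assumes V: "closed_csubspace V"
  obtains p where "is_proj p" "\<And>\<xi>. p \<rhd> \<xi> \<in> V" "\<And>\<xi>. \<xi> \<in> V \<Longrightarrow> p \<rhd> \<xi> = \<xi>"
    "\<And>\<xi> \<eta>. \<eta> \<in> V \<Longrightarrow> cinner \<eta> (\<xi> - p \<rhd> \<xi>) = 0"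
proof -
  have "\<exists>y. y \<in> V \<and> (\<forall>v\<in>V. cinner v (x - y) = 0)" for x
    using orthogonal_decomposition [OF V, of x] by metis
  then obtain f where fV: "\<And>x. f x \<in> V" and fo: "\<And>x v. v \<in> V \<Longrightarrow> cinner v (x - f x) = 0"
    by metis
  have uniq: "f x = y" if "y \<in> V" "\<And>v. v \<in> V \<Longrightarrow> cinner v (x - y) = 0" for x y
    using orthogonal_decomposition_unique [OF V fV fo that] by blast
  have 1: "f x = x" if "x \<in> V" for x
    using that by (intro uniq) auto
  obtain p where p: "\<And>\<xi>. p \<rhd> \<xi> = f \<xi>"
  proof (rule cop_of_function)
    show "f (\<xi> + \<eta>) = f \<xi> + f \<eta>" for \<xi> \<eta>
    proof (rule uniq)
      show "f \<xi> + f \<eta> \<in> V"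
        using V fV by (auto simp: closed_csubspace_def)
      show "cinner v (\<xi> + \<eta> - (f \<xi> + f \<eta>)) = 0" if "v \<in> V" for v
        using fo [OF that, of \<xi>] fo [OF that, of \<eta>] by (simp add: cinner_diff_right cinner_add_right)
    qed
    show "f (c *\<^sub>C \<xi>) = c *\<^sub>C f \<xi>" for c \<xi>
    proof (rule uniq)
      show "c *\<^sub>C f \<xi> \<in> V"
        using V fV by (auto simp: closed_csubspace_def)
      show "cinner v (c *\<^sub>C \<xi> - c *\<^sub>C f \<xi>) = 0" if "v \<in> V" for v
        using fo [OF that, of \<xi>] by (simp add: scaleC_diff_right [symmetric] cinner_scaleC_right)
    qed
    show "norm (f \<xi>) \<le> 1 * norm \<xi>" for \<xi>
    proof (rule power2_le_imp_le)
      have "(norm \<xi>)\<^sup>2 = (norm (f \<xi>))\<^sup>2 + (norm (\<xi> - f \<xi>))\<^sup>2"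
        using norm_add_sq_orth [OF fo [OF fV], of \<xi> \<xi>] by simp
      then show "(norm (f \<xi>))\<^sup>2 \<le> (1 * norm \<xi>)\<^sup>2"
        by (metis le_add_same_cancel1 mult_1 zero_le_power2)
    qed simp
  qed blast
  have "cinner (f \<xi>) (\<eta> - f \<eta>) = 0" "cinner (\<xi> - f \<xi>) (f \<eta>) = 0" for \<xi> \<eta>
    using fo [OF fV] by (simp_all add: cinner_eq_zero_commute [of "\<xi> - f \<xi>"])
  then have "cinner \<xi> (f \<eta>) = cinner (f \<xi>) \<eta>" for \<xi> \<eta>
    by (metis (no_types) cinner_diff_left cinner_diff_right eq_iff_diff_eq_0)
  then have "is_proj p"
    unfolding is_proj_def
    by (auto intro!: adj_eqI [of p p] cop_eqI [of "p * p"] simp: p app_mult 1 fV)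
  then show ?thesis
    using that [of p] p 1 fV fo by simp
qed

text \<open>The hypotheses say that the range of \<open>p\<close> is invariant under
  \<open>t\<close> and \<open>adj t\<close>; the adjoint of the second identity is the missing half
  of the commutation.\<close>

lemma commute_projection:
  assumes p: "is_proj p" and inv: "p * t * p = t * p" "p * adj t * p = adj t * p"
  shows "t * p = p * t"
  using arg_cong [OF inv(2), of adj] inv(1) by (simp add: is_projD [OF p] mult.assoc)


section \<open>Square roots and spectral projections\<close>

lemma adj_mult_self_zero: "adj x * x = 0 \<Longrightarrow> x = 0"
proof (rule cop_eqI)
  fix \<xi> assume "adj x * x = 0"
  then have "cinner \<xi> ((adj x * x) \<rhd> \<xi>) = 0"
    by simp
  then show "x \<rhd> \<xi> = 0 \<rhd> \<xi>"
    by (simp add: app_mult cinner_adj_right)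
qed

lemma cinner_adj_mult_self: "cinner \<xi> ((adj x * x) \<rhd> \<xi>) = complex_of_real ((norm (x \<rhd> \<xi>))\<^sup>2)"
  by (simp add: app_mult cinner_adj_right cinner_self)

lemma Re_cinner_bound: "\<bar>Re (cinner \<xi> (x \<rhd> \<xi>))\<bar> \<le> norm x * (norm \<xi>)\<^sup>2"
proof -
  have "\<bar>Re (cinner \<xi> (x \<rhd> \<xi>))\<bar> \<le> norm \<xi> * norm (x \<rhd> \<xi>)"
    using abs_Re_le_cmod cauchy_schwarz order_trans by blast
  also have "\<dots> \<le> norm \<xi> * (norm x * norm \<xi>)"
    by (intro mult_left_mono norm_app) simp
  finally show ?thesis
    by (simp add: power2_eq_square mult_ac)
qed

text \<open>A fixed point \<open>u\<close> of this iteration satisfies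
  \<open>(1 - u) * (1 - u) = 1 - z\<close>. The type is generic so that the real iterates at 1 can
  majorize the operator iterates.\<close>

primrec sqrt_iter :: "'a::real_normed_algebra \<Rightarrow> nat \<Rightarrow> 'a"
  where "sqrt_iter z 0 = 0"
  | "sqrt_iter z (Suc n) = (1/2) *\<^sub>R (z + sqrt_iter z n * sqrt_iter z n)"

lemma sqrt_iter_commute: "t * z = z * t \<Longrightarrow> t * sqrt_iter z n = sqrt_iter z n * t"
proof (induction n)
  case (Suc n)
  then have "t * (sqrt_iter z n * sqrt_iter z n) = sqrt_iter z n * sqrt_iter z n * t"
    by (metis mult.assoc)
  with Suc.prems show ?case
    by (simp add: distrib_left distrib_right)
qed simp

lemma sqrt_iter_real: "0 \<le> sqrt_iter (1::real) n \<and> sqrt_iter (1::real) n \<le> 1"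
proof (induction n)
  case (Suc n)
  then have "sqrt_iter (1::real) n * sqrt_iter 1 n \<le> 1 * 1"
    by (intro mult_mono) auto
  with Suc show ?case
    by simp
qed simp

text \<open>The iterates are polynomials with nonnegative coefficients in \<open>z\<close>, hence so are their increments.\<close>

lemma sqrt_iter_majorant:
  fixes z :: "'h::chilbert_space cop"
  assumes z: "norm z \<le> 1"
  shows "norm (sqrt_iter z n) \<le> sqrt_iter 1 n \<and>
    norm (sqrt_iter z (Suc n) - sqrt_iter z n) \<le> sqrt_iter 1 (Suc n) - sqrt_iter 1 n"
proof (induction n)
  case 0
  then show ?case using z by simp
next
  case (Suc n)
  let ?u = "sqrt_iter z" and ?t = "sqrt_iter (1::real)"
  have 1: "norm (?u (Suc n)) \<le> ?t (Suc n)"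
    using norm_triangle_sub [of "?u (Suc n)" "?u n"] Suc by linarith
  have com: "?u n * ?u (Suc n) = ?u (Suc n) * ?u n"
    by (metis sqrt_iter_commute)
  have "?u (Suc (Suc n)) - ?u (Suc n) = (1/2) *\<^sub>R ((?u (Suc n) - ?u n) * (?u (Suc n) + ?u n))"
    unfolding sqrt_iter.simps(2) [of z "Suc n"] by (subst (3) sqrt_iter.simps(2))
      (simp del: sqrt_iter.simps(2) add: algebra_simps com)
  then have "norm (?u (Suc (Suc n)) - ?u (Suc n)) \<le> (1/2) * (norm (?u (Suc n) - ?u n) * norm (?u (Suc n) + ?u n))"
    by (simp del: sqrt_iter.simps(2) add: norm_mult_ineq)
  also have "\<dots> \<le> (1/2) * ((?t (Suc n) - ?t n) * (?t (Suc n) + ?t n))"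
  proof -
    have "norm (?u (Suc n) + ?u n) \<le> ?t (Suc n) + ?t n"
      using norm_triangle_ineq [of "?u (Suc n)" "?u n"] 1 Suc by linarith
    moreover have "norm (?u (Suc n) - ?u n) \<le> ?t (Suc n) - ?t n"
      using Suc by blast
    moreover from this have "0 \<le> ?t (Suc n) - ?t n"
      using norm_ge_zero order_trans by blast
    ultimately show ?thesis
      by (intro mult_left_mono mult_mono) (simp_all del: sqrt_iter.simps)
  qed
  also have "\<dots> = ?t (Suc (Suc n)) - ?t (Suc n)"
    unfolding sqrt_iter.simps(2) [of "1::real" "Suc n"] by (subst (4) sqrt_iter.simps(2))
      (simp del: sqrt_iter.simps(2) add: algebra_simps)
  finally show ?case
    using 1 by blast
qed

text \<open>Increments are dominated by those of the real iterates at 1, which increase and stay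
  below 1; telescoping makes the operator iterates Cauchy.\<close>

lemma sqrt_iter_limit:
  fixes z :: "'h::chilbert_space cop"
  assumes z: "norm z \<le> 1"
  obtains u where "sqrt_iter z \<longlonglongrightarrow> u"
proof -
  let ?t = "sqrt_iter (1::real)"
  have diff: "norm (sqrt_iter z (n + k) - sqrt_iter z n) \<le> ?t (n + k) - ?t n" for n k
  proof (induction k)
    case (Suc k)
    have "norm (sqrt_iter z (n + Suc k) - sqrt_iter z n)
      \<le> norm (sqrt_iter z (Suc (n + k)) - sqrt_iter z (n + k)) + norm (sqrt_iter z (n + k) - sqrt_iter z n)"
      using norm_triangle_ineq [of "sqrt_iter z (Suc (n + k)) - sqrt_iter z (n + k)" "sqrt_iter z (n + k) - sqrt_iter z n"]
      by (simp del: sqrt_iter.simps)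
    with Suc sqrt_iter_majorant [OF z, of "n + k"] show ?case
      by (simp del: sqrt_iter.simps)
  qed simp
  have inc: "incseq ?t"
  proof (rule incseq_SucI)
    show "?t n \<le> ?t (Suc n)" for n
      using sqrt_iter_majorant [OF z, of n] norm_ge_zero [of "sqrt_iter z (Suc n) - sqrt_iter z n"]
      by linarith
  qed
  have "Cauchy (sqrt_iter z)"
  proof (rule metric_CauchyI)
    fix e :: real assume e: "e > 0"
    have "convergent ?t"
      by (rule Bseq_monoseq_convergent [OF BseqI' [of _ 1]])
        (use inc sqrt_iter_real in \<open>auto simp: incseq_imp_monoseq\<close>)
    then have "Cauchy ?t"
      by (rule convergent_Cauchy)
    then obtain M where M: "\<And>m n. m \<ge> M \<Longrightarrow> n \<ge> M \<Longrightarrow> dist (?t m) (?t n) < e"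
      using e metric_CauchyD by blast
    have "dist (sqrt_iter z m) (sqrt_iter z n) < e" if "m \<ge> n" "n \<ge> M" for m n
      using diff [of n "m - n"] M [of m n] that by (simp add: dist_norm)
    then show "\<exists>M. \<forall>m\<ge>M. \<forall>n\<ge>M. dist (sqrt_iter z m) (sqrt_iter z n) < e"
      by (metis dist_commute nle_le)
  qed
  then show ?thesis
    using that Cauchy_convergent_iff convergent_def by blast
qed

text \<open>After scaling, the root is \<open>r *\<^sub>R (1 - u)\<close> with \<open>u\<close> a
  norm limit of polynomials in \<open>adj y * y\<close>, so it commutes with whatever commutes with
  \<open>adj y * y\<close>.\<close>

lemma sqrt_exists:
  fixes y :: "'h::chilbert_space cop"
  obtains b where "pos b" "b * b = adj y * y"
    "\<And>t. t * (adj y * y) = (adj y * y) * t \<Longrightarrow> t * b = b * t"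
proof -
  \<comment> \<open>The added 1 keeps the divisor positive for \<open>y = 0\<close>. As
    \<open>r\<close> is at least \<open>norm y\<close>, the operator \<open>z\<close> below lies
    between 0 and 1.\<close>
  define r where "r = norm y + 1"
  have r: "r > 0" by (simp add: r_def add_nonneg_pos)
  define z where "z = 1 - (1 / r\<^sup>2) *\<^sub>R (adj y * y)"
  have zadj: "adj z = z"
    by (simp add: z_def)
  have nz: "norm z \<le> 1"
  proof (rule norm_hermitian_bound [OF zadj])
    fix \<xi>
    have "norm (y \<rhd> \<xi>) \<le> r * norm \<xi>"
      using norm_app [of y \<xi>] by (simp add: r_def distrib_right add_increasing2)
    then have "(norm (y \<rhd> \<xi>))\<^sup>2 \<le> r\<^sup>2 * (norm \<xi>)\<^sup>2"
      using power_mono [of "norm (y \<rhd> \<xi>)" "r * norm \<xi>" 2] by (simp add: power_mult_distrib)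
    moreover have "Re (cinner \<xi> (z \<rhd> \<xi>)) = (norm \<xi>)\<^sup>2 - (norm (y \<rhd> \<xi>))\<^sup>2 / r\<^sup>2"
      by (simp add: z_def app_diff_left app_scaleR_left cinner_diff_right cinner_scaleR_right cinner_adj_mult_self cinner_self del: of_real_power)
    ultimately show "\<bar>Re (cinner \<xi> (z \<rhd> \<xi>))\<bar> \<le> 1 * (norm \<xi>)\<^sup>2"
      using r by (simp add: divide_le_eq mult.commute)
  qed simp
  obtain u where u: "sqrt_iter z \<longlonglongrightarrow> u"
    using sqrt_iter_limit [OF nz] by blast
  have "(\<lambda>n. sqrt_iter z (Suc n)) \<longlonglongrightarrow> (1/2) *\<^sub>R (z + u * u)"
    unfolding sqrt_iter.simps by (intro tendsto_intros u)
  moreover have "(\<lambda>n. sqrt_iter z (Suc n)) \<longlonglongrightarrow> u"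
    using u LIMSEQ_Suc by blast
  ultimately have "u = (1/2) *\<^sub>R (z + u * u)"
    using LIMSEQ_unique by blast
  then have "2 *\<^sub>R u = z + u * u"
    by (metis (no_types) scaleR_one scaleR_scaleR divide_self_if mult.commute times_divide_eq_left
        mult_1 zero_neq_numeral)
  then have fixpoint: "u * u = u + u - z"
    by (simp add: scaleR_2)
  have nu: "norm u \<le> 1"
    by (rule LIMSEQ_le_const2 [OF tendsto_norm [OF u]])
      (use sqrt_iter_majorant [OF nz] sqrt_iter_real order_trans in blast)
  have "adj (sqrt_iter z n) = sqrt_iter z n" for n
    by (induction n) (simp_all add: zadj)
  then have uadj: "adj u = u"
    using tendsto_adj [OF u] u LIMSEQ_unique by (metis (no_types, lifting) ext)
  have com: "t * u = u * t" if "t * (adj y * y) = (adj y * y) * t" for t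
  proof -
    have "t * z = z * t"
      using that by (simp add: z_def algebra_simps)
    then have "(\<lambda>n. t * sqrt_iter z n) = (\<lambda>n. sqrt_iter z n * t)"
      by (simp add: sqrt_iter_commute)
    moreover have "(\<lambda>n. t * sqrt_iter z n) \<longlonglongrightarrow> t * u" "(\<lambda>n. sqrt_iter z n * t) \<longlonglongrightarrow> u * t"
      by (intro tendsto_intros u)+
    ultimately show ?thesis
      using LIMSEQ_unique by metis
  qed
  have "pos (1 - u)"
  proof (rule pos_hermitianI)
    fix \<xi> :: 'h
    have "norm u * (norm \<xi>)\<^sup>2 \<le> 1 * (norm \<xi>)\<^sup>2"
      using nu by (intro mult_right_mono) auto
    then show "0 \<le> Re (cinner \<xi> ((1 - u) \<rhd> \<xi>))"
      using Re_cinner_bound [of \<xi> u] by (simp add: app_diff_left cinner_diff_right cinner_self)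
  qed (simp add: uadj)
  then have "pos (r *\<^sub>R (1 - u))"
    using r by (intro pos_scaleR) auto
  moreover have "(r *\<^sub>R (1 - u)) * (r *\<^sub>R (1 - u)) = adj y * y"
  proof -
    have "(1 - u) * (1 - u) = 1 - z"
      by (simp add: algebra_simps fixpoint)
    then show ?thesis
      using r by (simp add: z_def power2_eq_square)
  qed
  moreover have "t * (r *\<^sub>R (1 - u)) = (r *\<^sub>R (1 - u)) * t" if "t * (adj y * y) = (adj y * y) * t" for t
    using com [OF that] by (simp add: algebra_simps)
  ultimately show ?thesis
    by (rule that)
qed

text \<open>With \<open>b\<close> the modulus of \<open>a\<close>, let \<open>e\<close> project onto
  the kernel of \<open>b - a\<close>, where \<open>a = b\<close> is positive. Since
  \<open>(b - a) * (b + a)\<close> vanishes, the range of \<open>b + a\<close> lies in that kernel,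
  so \<open>- a = b\<close> on its complement.\<close>

lemma spectral_projection:
  fixes a :: "'h::chilbert_space cop"
  assumes a: "adj a = a"
  obtains e where "is_proj e" "\<And>t. t * a = a * t \<Longrightarrow> t * e = e * t"
    "pos (e * a)" "pos (- ((1 - e) * a))"
proof -
  obtain b where b: "pos b" "b * b = adj a * a"
    and bcom: "\<And>t. t * (adj a * a) = (adj a * a) * t \<Longrightarrow> t * b = b * t"
    using sqrt_exists [of a] by blast
  have com: "t * b = b * t" if "t * a = a * t" for t
    by (rule bcom) (metis a mult.assoc that)
  define V where "V = {\<xi>. (b - a) \<rhd> \<xi> = 0}"
  have V: "closed_csubspace V"
    unfolding closed_csubspace_def V_def
    by (auto simp: app_add_right app_scaleC_right
        intro!: closed_Collect_eq linear_continuous_on bounded_linear_app)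
  obtain e where e: "is_proj e" and eV: "\<And>\<xi>. e \<rhd> \<xi> \<in> V" and eid: "\<And>\<xi>. \<xi> \<in> V \<Longrightarrow> e \<rhd> \<xi> = \<xi>"
    by (rule projection_onto [OF V]) blast
  have inv: "e * t * e = t * e" if "t * a = a * t" for t
  proof (rule cop_eqI)
    fix \<xi>
    have "(b - a) * t = t * (b - a)"
      by (simp add: algebra_simps com that)
    then have "(b - a) \<rhd> (t \<rhd> (e \<rhd> \<xi>)) = t \<rhd> ((b - a) \<rhd> (e \<rhd> \<xi>))"
      by (metis app_mult)
    also have "\<dots> = 0"
      using eV by (simp add: V_def)
    finally show "(e * t * e) \<rhd> \<xi> = (t * e) \<rhd> \<xi>"
      using eid by (simp add: V_def app_mult)
  qed
  have ecom: "t * e = e * t" if "t * a = a * t" for t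
  proof (rule commute_projection [OF e])
    show "e * t * e = t * e"
      by (rule inv) (rule that)
    show "e * adj t * e = adj t * e"
      using arg_cong [OF that, of adj] by (intro inv) (simp add: a)
  qed
  have ea: "a * e = e * a"
    by (rule ecom) simp
  have eb: "b * e = e * b"
    by (rule ecom) (rule com [symmetric], simp)
  have ba: "b * e = a * e"
    by (rule cop_eqI) (use eV in \<open>simp add: V_def app_mult app_diff_left\<close>)
  have sum0: "e * (b + a) = b + a"
  proof (rule cop_eqI)
    fix \<xi>
    have "(b - a) * (b + a) = 0"
      using com [of a] b(2) by (simp add: algebra_simps a)
    then have "(b - a) \<rhd> ((b + a) \<rhd> \<xi>) = 0"
      by (metis app_mult app_zero_left)
    then show "(e * (b + a)) \<rhd> \<xi> = (b + a) \<rhd> \<xi>"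
      using eid by (simp add: V_def app_mult)
  qed
  have "e * a = adj e * b * e"
    using ba ea eb by (metis e is_projD mult.assoc)
  then have "pos (e * a)"
    using pos_conj [OF b(1)] by simp
  moreover have "- ((1 - e) * a) = adj (1 - e) * b * (1 - e)"
  proof -
    have "(1 - e) * (b + a) = 0"
      using sum0 by (simp add: algebra_simps)
    then have "- ((1 - e) * a) = (1 - e) * b"
      by (simp add: distrib_left neg_eq_iff_add_eq_0 add.commute)
    also have "\<dots> = (1 - e) * (1 - e) * b"
      using is_projD(2) [OF is_proj_compl [OF e]] by simp
    also have "\<dots> = (1 - e) * b * (1 - e)"
      using eb by (simp add: algebra_simps)
    finally show ?thesis
      by (simp add: is_projD [OF e])
  qed
  then have "pos (- ((1 - e) * a))"
    using pos_conj [OF b(1)] by metis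
  ultimately show ?thesis
    using that e ecom by blast
qed

text \<open>A surrogate for the polar decomposition: cut \<open>y\<close> to a spectral subspace of its modulus on which
  the modulus is bounded below, and divide by the modulus there.\<close>

lemma partial_isometry_from_operator:
  fixes y :: "'h::chilbert_space cop"
  assumes "y \<noteq> 0"
  obtains g where "is_proj (adj (y * g) * (y * g))" "y * g \<noteq> 0"
    "\<And>t. t * (adj y * y) = (adj y * y) * t \<Longrightarrow> t * g = g * t"
proof -
  obtain b where b: "pos b" "b * b = adj y * y"
    and bcom: "\<And>t. t * (adj y * y) = (adj y * y) * t \<Longrightarrow> t * b = b * t"
    using sqrt_exists [of y] by blast
  have b0: "b \<noteq> 0"
    using b(2) assms adj_mult_self_zero by force
  have badj: "adj b = b"
    by (rule pos_hermitian [OF b(1)])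
  obtain \<delta> e where \<delta>: "\<delta> > 0" and e: "is_proj e" "e \<noteq> 0"
    and ecom: "\<And>t. t * b = b * t \<Longrightarrow> t * e = e * t" and epos: "pos (e * (b - \<delta> *\<^sub>R 1))"
  proof -
    \<comment> \<open>If the spectral projections of \<open>b\<close> above all positive levels
      vanished, \<open>b\<close> would lie below every positive multiple of 1 and hence be
      zero.\<close>
    have "\<exists>\<delta>>0. \<exists>e. is_proj e \<and> e \<noteq> 0 \<and> (\<forall>t. t * b = b * t \<longrightarrow> t * e = e * t) \<and> pos (e * (b - \<delta> *\<^sub>R 1))"
    proof (rule ccontr)
      assume neg: "\<not> ?thesis"
      have small: "pos (\<delta> *\<^sub>R 1 - b)" if d: "\<delta> > 0" for \<delta>
      proof -
        have "adj (b - \<delta> *\<^sub>R 1) = b - \<delta> *\<^sub>R 1"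
          by (simp add: badj)
        then obtain e where e: "is_proj e" "\<And>t. t * (b - \<delta> *\<^sub>R 1) = (b - \<delta> *\<^sub>R 1) * t \<Longrightarrow> t * e = e * t"
          "pos (e * (b - \<delta> *\<^sub>R 1))" "pos (- ((1 - e) * (b - \<delta> *\<^sub>R 1)))"
          using spectral_projection by blast
        moreover have "t * (b - \<delta> *\<^sub>R 1) = (b - \<delta> *\<^sub>R 1) * t" if "t * b = b * t" for t
          using that by (simp add: algebra_simps)
        ultimately have "e = 0"
          using neg d by blast
        then show ?thesis
          using e(4) by simp
      qed
      have "Re (cinner \<xi> (b \<rhd> \<xi>)) \<le> 0" for \<xi>
      proof (rule field_le_epsilon)
        fix c :: real assume c: "c > 0"
        have p: "(norm \<xi>)\<^sup>2 + 1 > 0"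
          by (simp add: add_nonneg_pos)
        have "Re (cinner \<xi> (b \<rhd> \<xi>)) \<le> c / ((norm \<xi>)\<^sup>2 + 1) * (norm \<xi>)\<^sup>2"
          using small [of "c / ((norm \<xi>)\<^sup>2 + 1)"] c p
          by (simp add: pos_iff app_diff_left app_scaleR_left cinner_diff_right cinner_scaleR_right cinner_self del: of_real_divide)
        also have "\<dots> \<le> c"
          using c p by (simp add: divide_le_eq mult.commute)
        finally show "Re (cinner \<xi> (b \<rhd> \<xi>)) \<le> 0 + c"
          by simp
      qed
      then have "pos (- b)"
        by (intro pos_hermitianI) (simp_all add: badj app_minus_left)
      then show False
        using pos_antisym b(1) b0 by blast
    qed
    then show ?thesis
      using that by blast
  qed
  have eb: "b * e = e * b"
    by (rule ecom) simp
  define K where "K = norm b + \<delta>"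
  have K: "K > 0" "norm b \<le> K" "\<delta> \<le> K"
    using \<delta> by (auto simp: K_def add_nonneg_pos)
  \<comment> \<open>On the range of \<open>e\<close> the modulus lies between
    \<open>\<delta>\<close> and \<open>K\<close>, so \<open>h\<close> has norm at most
    \<open>1 - \<delta> / K\<close>.\<close>
  define h where "h = e * (1 - (1 / K) *\<^sub>R b)"
  have eh: "e * h = h"
    by (simp add: h_def mult.assoc [symmetric] is_projD [OF e(1)])
  have hadj: "adj h = h"
    by (simp add: h_def badj is_projD [OF e(1)] algebra_simps eb)
  have nh: "norm h \<le> 1 - \<delta> / K"
  proof (rule norm_hermitian_bound [OF hadj])
    show "0 \<le> 1 - \<delta> / K"
      using K by (simp add: divide_le_eq)
    fix \<xi>
    have ee: "e * b = adj e * b * e"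
      using eb is_projD [OF e(1)] by (metis mult.assoc)
    have eq: "Re (cinner \<xi> (h \<rhd> \<xi>)) = (norm (e \<rhd> \<xi>))\<^sup>2 - Re (cinner \<xi> ((e * b) \<rhd> \<xi>)) / K"
      by (simp add: h_def right_diff_distrib app_diff_left app_scaleR_left cinner_diff_right cinner_scaleR_right cinner_proj [OF e(1)] del: of_real_power of_real_divide)
    have "\<delta> * (norm (e \<rhd> \<xi>))\<^sup>2 \<le> Re (cinner \<xi> ((e * b) \<rhd> \<xi>))"
      using epos by (simp add: pos_iff right_diff_distrib app_diff_left app_scaleR_left cinner_diff_right cinner_scaleR_right cinner_proj [OF e(1)] del: of_real_power)
    then have l: "(norm (e \<rhd> \<xi>))\<^sup>2 * (\<delta> / K) \<le> Re (cinner \<xi> ((e * b) \<rhd> \<xi>)) / K"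
      using K(1) by (simp add: divide_right_mono mult.commute)
    have "Re (cinner \<xi> ((e * b) \<rhd> \<xi>)) \<le> K * (norm (e \<rhd> \<xi>))\<^sup>2"
    proof -
      have "Re (cinner \<xi> ((e * b) \<rhd> \<xi>)) = Re (cinner (e \<rhd> \<xi>) (b \<rhd> (e \<rhd> \<xi>)))"
        by (simp only: ee app_mult cinner_adj_right)
      also have "\<dots> \<le> norm b * (norm (e \<rhd> \<xi>))\<^sup>2"
        using Re_cinner_bound [of "e \<rhd> \<xi>" b] by linarith
      also have "\<dots> \<le> K * (norm (e \<rhd> \<xi>))\<^sup>2"
        using K by (intro mult_right_mono) auto
      finally show ?thesis .
    qed
    then have u: "Re (cinner \<xi> ((e * b) \<rhd> \<xi>)) / K \<le> (norm (e \<rhd> \<xi>))\<^sup>2"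
      using K(1) by (simp add: divide_le_eq mult.commute)
    have "(1 - \<delta> / K) * (norm (e \<rhd> \<xi>))\<^sup>2 \<le> (1 - \<delta> / K) * (norm \<xi>)\<^sup>2"
      using K norm_proj_app [OF e(1), of \<xi>] by (intro mult_left_mono power_mono) (auto simp: divide_le_eq)
    then show "\<bar>Re (cinner \<xi> (h \<rhd> \<xi>))\<bar> \<le> (1 - \<delta> / K) * (norm \<xi>)\<^sup>2"
      using l u unfolding eq by (simp add: left_diff_distrib mult.commute)
  qed
  have c1: "norm h < 1"
    using nh \<delta> K(1) by (smt (verit) divide_pos_pos)
  \<comment> \<open>The fixed point is the sum of a Neumann series, obtained without summing: it
    inverts \<open>(1 / K) *\<^sub>R b\<close> on the range of \<open>e\<close>.\<close>
  have "\<exists>!g. e + h * g = g"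
  proof (rule banach_fix_type [OF norm_ge_zero c1])
    show "\<forall>x y. dist (e + h * x) (e + h * y) \<le> norm h * dist x y"
      by (simp add: dist_norm right_diff_distrib [symmetric] norm_mult_ineq)
  qed
  then obtain g where g: "e + h * g = g"
    by auto
  have eg: "e * g = g"
  proof -
    have "e * (e + h * g) = e + h * g"
      by (simp add: distrib_left mult.assoc [symmetric] eh is_projD [OF e(1)])
    then show ?thesis
      by (simp add: g)
  qed
  have "h * g = g - (1 / K) *\<^sub>R (b * g)"
  proof -
    have "h = (1 - (1 / K) *\<^sub>R b) * e"
      by (simp add: h_def algebra_simps eb)
    then show ?thesis
      by (simp add: mult.assoc eg left_diff_distrib)
  qed
  then have bg: "b * ((1 / K) *\<^sub>R g) = e"
    using g by (metis (no_types, lifting) add_diff_cancel_left' add_diff_cancel_right'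
        diff_add_cancel mult_scaleR_right)
  define G where "G = (1 / K) *\<^sub>R g"
  have bG: "b * G = e"
    using bg by (simp add: G_def)
  have "adj (y * G) * (y * G) = adj G * (adj y * y) * G"
    by (simp add: mult.assoc)
  also have "\<dots> = adj (b * G) * (b * G)"
    by (simp add: b(2) [symmetric] badj mult.assoc)
  finally have v: "adj (y * G) * (y * G) = e"
    unfolding bG by (simp only: is_projD [OF e(1)])
  have "t * G = G * t" if t: "t * (adj y * y) = (adj y * y) * t" for t
  proof -
    have tb: "t * b = b * t" and te: "t * e = e * t"
      using bcom [OF t] ecom by auto
    have th: "t * h = h * t"
    proof -
      have "t * h = (t * e) * (1 - (1 / K) *\<^sub>R b)"
        by (simp add: h_def mult.assoc)
      also have "\<dots> = e * (t * (1 - (1 / K) *\<^sub>R b))"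
        by (simp add: te mult.assoc)
      also have "t * (1 - (1 / K) *\<^sub>R b) = (1 - (1 / K) *\<^sub>R b) * t"
        by (simp add: tb left_diff_distrib right_diff_distrib)
      finally show ?thesis
        by (simp add: h_def mult.assoc)
    qed
    \<comment> \<open>The commutator of \<open>t\<close> and \<open>g\<close> is fixed by left
      multiplication with the strict contraction \<open>h\<close>, so it is zero.\<close>
    have "t * g - g * t = t * (e + h * g) - (e + h * g) * t"
      by (simp only: g)
    also have "\<dots> = (t * e + t * h * g) - (e * t + h * g * t)"
      by (simp only: distrib_left distrib_right mult.assoc)
    also have "\<dots> = h * (t * g - g * t)"
      by (simp add: te th right_diff_distrib mult.assoc)
    finally have "norm (t * g - g * t) \<le> norm h * norm (t * g - g * t)"
      using norm_mult_ineq [of h "t * g - g * t"] by simp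
    moreover have "norm h * norm (t * g - g * t) < 1 * norm (t * g - g * t)" if "t * g - g * t \<noteq> 0"
      using c1 that by (intro mult_strict_right_mono) auto
    ultimately have "t * g - g * t = 0"
      by (metis mult_1 not_le)
    then show ?thesis
      by (simp add: G_def)
  qed
  moreover have "y * G \<noteq> 0"
    using v e(2) by auto
  ultimately show ?thesis
    using that [of G] v e(1) by simp
qed


section \<open>Strong limits\<close>

text \<open>Strong operator convergence, for sequences: all infinite sums below are
  countable.\<close>

definition slim :: "(nat \<Rightarrow> 'h::chilbert_space cop) \<Rightarrow> 'h cop \<Rightarrow> bool"
  where "slim x l \<longleftrightarrow> (\<forall>\<xi>. (\<lambda>n. x n \<rhd> \<xi>) \<longlonglongrightarrow> l \<rhd> \<xi>)"

lemma slim_unique: "slim x l \<Longrightarrow> slim x l' \<Longrightarrow> l = l'"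
  unfolding slim_def by (rule cop_eqI) (use LIMSEQ_unique in blast)

lemma slim_mult_left: "slim x l \<Longrightarrow> slim (\<lambda>n. a * x n) (a * l)"
  unfolding slim_def by (auto simp: app_mult intro: bounded_linear.tendsto [OF bounded_linear_app])

lemma slim_mult_right: "slim x l \<Longrightarrow> slim (\<lambda>n. x n * a) (l * a)"
  unfolding slim_def by (simp add: app_mult)

lemma slim_const: "slim (\<lambda>n. c) c"
  by (simp add: slim_def)

lemma slim_eventually_const: "(\<And>n. N \<le> n \<Longrightarrow> x n = l) \<Longrightarrow> slim x l"
  unfolding slim_def
  by (intro allI tendsto_eventually) (auto simp: eventually_sequentially)

lemma slim_diff: "slim x l \<Longrightarrow> slim y k \<Longrightarrow> slim (\<lambda>n. x n - y n) (l - k)"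
  unfolding slim_def by (auto simp: app_diff_left intro: tendsto_diff)

lemma slim_cinner: "slim x l \<Longrightarrow> (\<lambda>n. cinner \<xi> (x n \<rhd> \<eta>)) \<longlonglongrightarrow> cinner \<xi> (l \<rhd> \<eta>)"
  unfolding slim_def by (auto intro: tendsto_cinner)

lemma slim_pos:
  assumes "slim x l" "\<And>n. pos (x n)" shows "pos l"
  unfolding pos_def
proof
  fix \<xi>
  show "cinner \<xi> (l \<rhd> \<xi>) \<in> \<real>\<^sub>\<ge>\<^sub>0"
    by (rule closed_sequentially [OF closed_nonneg_Reals_complex _ slim_cinner [OF assms(1)]])
      (use assms(2) in \<open>simp add: pos_def\<close>)
qed

lemma strong_limit_exists:
  assumes "\<And>\<xi>. Cauchy (\<lambda>n. x n \<rhd> (\<xi>::'h::chilbert_space))" and "\<And>n. norm (x n) \<le> K"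
  obtains l where "slim x l"
proof -
  obtain f where f: "\<And>\<xi>. (\<lambda>n. x n \<rhd> \<xi>) \<longlonglongrightarrow> f \<xi>"
    using assms(1) unfolding Cauchy_convergent_iff convergent_def by metis
  obtain l where "\<And>\<xi>. l \<rhd> \<xi> = f \<xi>"
  proof (rule cop_of_function)
    show "f (\<xi> + \<eta>) = f \<xi> + f \<eta>" for \<xi> \<eta>
      using LIMSEQ_unique [OF f] tendsto_add [OF f [of \<xi>] f [of \<eta>]] by (simp add: app_add_right)
    show "f (c *\<^sub>C \<xi>) = c *\<^sub>C f \<xi>" for c \<xi>
      using LIMSEQ_unique [OF f] bounded_linear.tendsto [OF bounded_linear_scaleC f [of \<xi>], of c]
      by (simp add: app_scaleC_right)
    show "norm (f \<xi>) \<le> K * norm \<xi>" for \<xi>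
    proof (rule LIMSEQ_le_const2 [OF tendsto_norm [OF f]])
      have "norm (x n \<rhd> \<xi>) \<le> K * norm \<xi>" for n
        using norm_app mult_right_mono [OF assms(2) norm_ge_zero] order_trans by blast
      then show "\<exists>N. \<forall>n\<ge>N. norm (x n \<rhd> \<xi>) \<le> K * norm \<xi>"
        by blast
    qed
  qed blast
  then show ?thesis
    using that [of l] f by (simp add: slim_def)
qed

section \<open>Partial isometries and their orthogonal sums\<close>

lemma partial_isometry_initial:
  assumes "is_proj (adj v * v)"
  shows "v * (adj v * v) = v"
proof -
  let ?e = "adj v * v" and ?w = "v * (1 - adj v * v)"
  have "adj ?w * ?w = (1 - ?e) * (?e * (1 - ?e))"
    by (simp add: mult.assoc)
  also have "?e * (1 - ?e) = 0"
    using is_projD(2) [OF assms] by (simp add: algebra_simps)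
  finally have "adj ?w * ?w = 0"
    by simp
  then have "?w = 0"
    by (rule adj_mult_self_zero)
  then show ?thesis
    by (simp add: algebra_simps)
qed

lemma partial_isometry_final:
  assumes "is_proj (adj v * v)" shows "is_proj (v * adj v)"
proof -
  have "v * adj v * (v * adj v) = v * (adj v * v) * adj v"
    by (simp only: mult.assoc)
  also have "\<dots> = v * adj v"
    by (simp only: partial_isometry_initial [OF assms])
  finally show ?thesis
    by (simp add: is_proj_def)
qed

lemma partial_isometry_adj_initial:
  "is_proj (adj v * v) \<Longrightarrow> (adj v * v) * adj v = adj v"
  using arg_cong [OF partial_isometry_initial, of v adj] by (simp add: mult.assoc)

lemma adj_sum_mult_sum_orth:
  fixes v :: "nat \<Rightarrow> 'h::chilbert_space cop"
  assumes orth: "\<And>i j. i \<noteq> j \<Longrightarrow> adj (v i) * v j = 0"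
  shows "adj (\<Sum>i\<in>I. v i) * (\<Sum>i\<in>I. v i) = (\<Sum>i\<in>I. adj (v i) * v i)"
proof (cases "finite I")
  case True
  have "(\<Sum>i\<in>I. \<Sum>j\<in>I. adj (v i) * v j) = (\<Sum>i\<in>I. \<Sum>j\<in>I. if i = j then adj (v i) * v i else 0)"
    by (intro sum.cong refl) (auto simp: orth)
  then show ?thesis
    using True by (simp add: adj_sum sum_product)
qed simp

text \<open>On every vector a block of the sum has the same length as the corresponding block of
  initial projections, and the partial sums of the latter have bounded increasing quadratic
  forms.\<close>

lemma orth_sum_Cauchy:
  fixes v :: "nat \<Rightarrow> 'h::chilbert_space cop"
  assumes p: "\<And>n. is_proj (adj (v n) * v n)"
    and orth: "\<And>i j. i \<noteq> j \<Longrightarrow> adj (v i) * v j = 0"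
    and orth': "\<And>i j. i \<noteq> j \<Longrightarrow> v i * adj (v j) = 0"
  shows "Cauchy (\<lambda>n. (\<Sum>i<n. v i) \<rhd> \<xi>)" "norm (\<Sum>i<n. v i) \<le> 1"
proof -
  define e where "e = (\<lambda>i. adj (v i) * v i)"
  have eo: "e i * e j = 0" if "i \<noteq> j" for i j
    by (simp add: e_def mult.assoc) (metis orth' that mult.assoc mult_zero_left mult_zero_right)
  have E: "is_proj (\<Sum>i\<in>I. e i)" if "finite I" for I
    using that by (rule is_proj_sum) (auto simp: e_def p eo [unfolded e_def])
  have norm_sum: "(norm ((\<Sum>i\<in>I. v i) \<rhd> \<xi>))\<^sup>2 = (norm ((\<Sum>i\<in>I. e i) \<rhd> \<xi>))\<^sup>2" if "finite I" for I \<xi>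
  proof -
    have "cinner \<xi> ((adj (\<Sum>i\<in>I. v i) * (\<Sum>i\<in>I. v i)) \<rhd> \<xi>) = cinner \<xi> ((\<Sum>i\<in>I. e i) \<rhd> \<xi>)"
      by (simp add: adj_sum_mult_sum_orth orth e_def)
    then show ?thesis
      unfolding cinner_adj_mult_self cinner_proj [OF E [OF that]] of_real_eq_iff .
  qed
  show "norm (\<Sum>i<n. v i) \<le> 1"
  proof (rule norm_cop_bound)
    show "norm ((\<Sum>i<n. v i) \<rhd> \<xi>) \<le> 1 * norm \<xi>" for \<xi>
    proof (rule power2_le_imp_le)
      show "(norm ((\<Sum>i<n. v i) \<rhd> \<xi>))\<^sup>2 \<le> (1 * norm \<xi>)\<^sup>2"
        unfolding norm_sum [OF finite_lessThan] using norm_proj_app [OF E [OF finite_lessThan]]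
        by (simp add: power_mono)
    qed simp
  qed simp
  define a where "a = (\<lambda>n. Re (cinner \<xi> ((\<Sum>i<n. e i) \<rhd> \<xi>)))"
  have a: "a n = (norm ((\<Sum>i<n. e i) \<rhd> \<xi>))\<^sup>2" for n
    by (simp add: a_def cinner_proj [OF E [OF finite_lessThan]] del: of_real_power)
  have split: "{..<n} = {..<m} \<union> {m..<n}" "{..<m} \<inter> {m..<n} = {}" if "m \<le> n" for m n :: nat
    using that by auto
  have diff: "(norm ((\<Sum>i<n. v i) \<rhd> \<xi> - (\<Sum>i<m. v i) \<rhd> \<xi>))\<^sup>2 = a n - a m" if "m \<le> n" for m n
  proof -
    have "(\<Sum>i<n. v i) \<rhd> \<xi> - (\<Sum>i<m. v i) \<rhd> \<xi> = (\<Sum>i\<in>{m..<n}. v i) \<rhd> \<xi>"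
      using sum.union_disjoint [of "{..<m}" "{m..<n}" v] split [OF that]
      by (simp add: app_add_left)
    moreover have "a n = a m + Re (cinner \<xi> ((\<Sum>i\<in>{m..<n}. e i) \<rhd> \<xi>))"
      using sum.union_disjoint [of "{..<m}" "{m..<n}" e] split [OF that]
      by (simp add: a_def app_add_left cinner_add_right)
    ultimately show ?thesis
      using norm_sum [of "{m..<n}" \<xi>]
      by (simp add: cinner_proj [OF E] del: of_real_power)
  qed
  have "incseq a"
    by (rule incseq_SucI) (use diff in \<open>metis diff_ge_0_iff_ge le_SucI order_refl zero_le_power2\<close>)
  moreover have "a n \<le> (norm \<xi>)\<^sup>2" for n
    unfolding a by (intro power_mono norm_proj_app E) auto
  ultimately have "convergent a"
    by (meson incseq_convergent convergentI)
  then have ca: "Cauchy a"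
    by (rule convergent_Cauchy)
  show "Cauchy (\<lambda>n. (\<Sum>i<n. v i) \<rhd> \<xi>)"
  proof (rule metric_CauchyI)
    fix \<epsilon> :: real assume \<epsilon>: "\<epsilon> > 0"
    then obtain M where M: "\<And>m n. m \<ge> M \<Longrightarrow> n \<ge> M \<Longrightarrow> dist (a m) (a n) < \<epsilon>\<^sup>2"
      using metric_CauchyD [OF ca, of "\<epsilon>\<^sup>2"] by auto
    have "dist ((\<Sum>i<n. v i) \<rhd> \<xi>) ((\<Sum>i<m. v i) \<rhd> \<xi>) < \<epsilon>" if "M \<le> m" "m \<le> n" for m n
    proof -
      have "(norm ((\<Sum>i<n. v i) \<rhd> \<xi> - (\<Sum>i<m. v i) \<rhd> \<xi>))\<^sup>2 < \<epsilon>\<^sup>2"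
        using diff [OF that(2)] M [of n m] that by (simp add: dist_norm)
      then show ?thesis
        using \<epsilon> by (simp add: dist_norm power_less_imp_less_base)
    qed
    then show "\<exists>M. \<forall>m\<ge>M. \<forall>n\<ge>M. dist ((\<Sum>i<m. v i) \<rhd> \<xi>) ((\<Sum>i<n. v i) \<rhd> \<xi>) < \<epsilon>"
      by (metis dist_commute nle_le)
  qed
qed

text \<open>Taking adjoints is not strongly continuous. The adjoint partial sums therefore converge
  by a separate application of \<open>orth_sum_Cauchy\<close>, whose hypotheses are symmetric, and
  the limits are identified through inner products.\<close>

lemma orth_sum:
  fixes v :: "nat \<Rightarrow> 'h::chilbert_space cop"
  assumes p: "\<And>n. is_proj (adj (v n) * v n)"
    and orth: "\<And>i j. i \<noteq> j \<Longrightarrow> adj (v i) * v j = 0"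
    and orth': "\<And>i j. i \<noteq> j \<Longrightarrow> v i * adj (v j) = 0"
  obtains s where "slim (\<lambda>n. \<Sum>i<n. v i) s"
    "slim (\<lambda>n. \<Sum>i<n. adj (v i) * v i) (adj s * s)"
    "slim (\<lambda>n. \<Sum>i<n. v i * adj (v i)) (s * adj s)"
proof -
  \<comment> \<open>Stated for an arbitrary family because it is applied both to \<open>v\<close>
    and to the family of adjoints.\<close>
  have key: "slim (\<lambda>n. \<Sum>i<n. adj (w i) * w i) (adj t * t)"
    if t: "slim (\<lambda>n. \<Sum>i<n. w i) t" and p: "\<And>n. is_proj (adj (w n) * w n)"
    and orth: "\<And>i j. i \<noteq> j \<Longrightarrow> adj (w i) * w j = 0"
    and orth': "\<And>i j. i \<noteq> j \<Longrightarrow> w i * adj (w j) = 0" for w :: "nat \<Rightarrow> 'h cop" and t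
  proof -
    let ?e = "\<lambda>i. adj (w i) * w i"
    have ee: "?e i * ?e j = 0" if "i \<noteq> j" for i j
      by (simp add: mult.assoc) (metis orth' that mult.assoc mult_zero_left mult_zero_right)
    have pe: "adj (?e n) * ?e n = ?e n" for n
      using p by (simp add: is_proj_def)
    obtain l where l: "slim (\<lambda>n. \<Sum>i<n. ?e i) l"
      by (rule strong_limit_exists [OF orth_sum_Cauchy [of ?e]])
        (use ee pe p in \<open>auto simp: is_projD [OF p]\<close>)
    have "adj t * t = l"
    proof (rule cop_eqI, rule cinner_ext)
      fix \<xi> \<eta>
      have "(\<lambda>n. cinner ((\<Sum>i<n. w i) \<rhd> \<xi>) ((\<Sum>i<n. w i) \<rhd> \<eta>)) \<longlonglongrightarrow> cinner (t \<rhd> \<xi>) (t \<rhd> \<eta>)"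
        using t unfolding slim_def by (intro tendsto_cinner) auto
      moreover have "cinner ((\<Sum>i<n. w i) \<rhd> \<xi>) ((\<Sum>i<n. w i) \<rhd> \<eta>) = cinner \<xi> ((\<Sum>i<n. ?e i) \<rhd> \<eta>)" for n
        by (simp add: adj_sum_mult_sum_orth [OF orth, symmetric] app_mult cinner_adj_right)
      ultimately have "(\<lambda>n. cinner \<xi> ((\<Sum>i<n. ?e i) \<rhd> \<eta>)) \<longlonglongrightarrow> cinner \<xi> ((adj t * t) \<rhd> \<eta>)"
        by (simp add: app_mult cinner_adj_right)
      then show "cinner \<xi> ((adj t * t) \<rhd> \<eta>) = cinner \<xi> (l \<rhd> \<eta>)"
        using slim_cinner [OF l] LIMSEQ_unique by blast
    qed
    then show ?thesis
      using l by simp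
  qed
  have p': "is_proj (v n * adj (v n))" for n
    by (rule partial_isometry_final [OF p])
  obtain s where s: "slim (\<lambda>n. \<Sum>i<n. v i) s"
    by (rule strong_limit_exists [OF orth_sum_Cauchy [of v, OF p orth orth']]) auto
  obtain t where t: "slim (\<lambda>n. \<Sum>i<n. adj (v i)) t"
    by (rule strong_limit_exists [OF orth_sum_Cauchy [of "\<lambda>n. adj (v n)"]]) (auto simp: p' orth orth')
  have ts: "adj s = t"
  proof (rule adj_eqI)
    fix \<xi> \<eta>
    have "(\<lambda>n. cinner ((\<Sum>i<n. v i) \<rhd> \<xi>) \<eta>) \<longlonglongrightarrow> cinner (s \<rhd> \<xi>) \<eta>"
      using s unfolding slim_def by (intro tendsto_cinner) auto
    moreover have "cinner ((\<Sum>i<n. v i) \<rhd> \<xi>) \<eta> = cinner \<xi> ((\<Sum>i<n. adj (v i)) \<rhd> \<eta>)" for n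
      by (simp add: adj_sum [symmetric] cinner_adj_right)
    ultimately have "(\<lambda>n. cinner \<xi> ((\<Sum>i<n. adj (v i)) \<rhd> \<eta>)) \<longlonglongrightarrow> cinner (s \<rhd> \<xi>) \<eta>"
      by simp
    then show "cinner \<xi> (t \<rhd> \<eta>) = cinner (s \<rhd> \<xi>) \<eta>"
      by (rule LIMSEQ_unique [OF slim_cinner [OF t]])
  qed
  show ?thesis
  proof (rule that)
    show "slim (\<lambda>n. \<Sum>i<n. adj (v i) * v i) (adj s * s)"
      by (rule key [OF s p orth orth'])
    show "slim (\<lambda>n. \<Sum>i<n. v i * adj (v i)) (s * adj s)"
      using key [OF t] by (simp add: p' orth orth' ts [symmetric])
  qed (rule s)
qed

lemma orth_proj_sum:
  fixes p :: "nat \<Rightarrow> 'h::chilbert_space cop"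
  assumes p: "\<And>n. is_proj (p n)" and orth: "\<And>i j. i \<noteq> j \<Longrightarrow> p i * p j = 0"
  obtains s where "is_proj s" "slim (\<lambda>n. \<Sum>i<n. p i) s"
proof -
  obtain s where s: "slim (\<lambda>n. \<Sum>i<n. p i) s" "slim (\<lambda>n. \<Sum>i<n. adj (p i) * p i) (adj s * s)"
    by (rule orth_sum [of p]) (auto simp: is_projD [OF p] p orth)
  then have "adj s * s = s"
    by (simp add: is_projD [OF p] slim_unique)
  then have "is_proj s"
    unfolding is_proj_def by (metis adj_adj adj_mult)
  then show ?thesis
    using that s by blast
qed

lemma slim_sum_orth_zero:
  assumes s: "slim (\<lambda>n. \<Sum>i<n. p i) s" and "\<And>i. a * p i = 0" shows "a * s = 0"
proof -
  have "slim (\<lambda>n. 0) (a * s)"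
    using slim_mult_left [OF s, of a] by (simp add: sum_distrib_left assms(2))
  then show ?thesis
    by (rule slim_unique) (rule slim_const)
qed

lemma slim_sum_orth_zero':
  assumes s: "slim (\<lambda>n. \<Sum>i<n. p i) s" and "\<And>i. p i * a = 0" shows "s * a = 0"
proof -
  have "slim (\<lambda>n. 0) (s * a)"
    using slim_mult_right [OF s, of a] by (simp add: sum_distrib_right assms(2))
  then show ?thesis
    by (rule slim_unique) (rule slim_const)
qed

text \<open>After multiplication by \<open>a\<close> the partial sums are eventually constant. This
  is how infinite sums become computable below.\<close>

lemma slim_sum_finite:
  assumes s: "slim (\<lambda>n. \<Sum>i<n. p i) s" and F: "finite F" and z: "\<And>i. i \<notin> F \<Longrightarrow> a * p i = 0"
  shows "a * s = (\<Sum>i\<in>F. a * p i)"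
proof -
  obtain N where N: "F \<subseteq> {..<N}"
    using F finite_nat_iff_bounded by blast
  have "a * (\<Sum>i<n. p i) = (\<Sum>i\<in>F. a * p i)" if "N \<le> n" for n
    unfolding sum_distrib_left
    by (rule sum.mono_neutral_right) (use N z that in auto)
  then have "slim (\<lambda>n. a * (\<Sum>i<n. p i)) (\<Sum>i\<in>F. a * p i)"
    by (rule slim_eventually_const)
  then show ?thesis
    using slim_mult_left [OF s] slim_unique by blast
qed

section \<open>A greedy exhaustion principle\<close>

text \<open>Read \<open>C l a\<close> as: \<open>a\<close> may follow the history \<open>l\<close>.
  Each choice takes at least half of the largest weight available, so a candidate of positive weight
  that stays admissible forever would keep the chosen weights away from zero, against the bound
  \<open>B\<close>. The resulting sequence does the work of a maximal family.\<close>

lemma greedy_sequence: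
  fixes w :: "'a \<Rightarrow> real" and C :: "'a list \<Rightarrow> 'a \<Rightarrow> bool"
  assumes ex: "\<And>l. (\<forall>k<length l. C (take k l) (l ! k)) \<Longrightarrow> \<exists>a. C l a"
    and w: "\<And>l a. C l a \<Longrightarrow> 0 \<le> w a"
    and B: "\<And>l. (\<forall>k<length l. C (take k l) (l ! k)) \<Longrightarrow> (\<Sum>k<length l. w (l ! k)) \<le> B"
  obtains f where "\<And>n. C (map f [0..<n]) (f n)"
    "\<And>b. (\<And>n. C (map f [0..<n]) b) \<Longrightarrow> w b \<le> 0"
proof -
  define legal where "legal = (\<lambda>l. \<forall>k<length l. C (take k l) (l ! k))"
  have legal_snoc: "legal (l @ [a])" if "legal l" "C l a" for l a
    using that by (auto simp: legal_def nth_append less_Suc_eq)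
  have single: "w a \<le> B" if "legal l" "C l a" for l a
  proof -
    have "(\<Sum>k<length (l @ [a]). w ((l @ [a]) ! k)) \<le> B"
      using legal_snoc [OF that] by (intro B) (simp only: legal_def)
    moreover have "0 \<le> (\<Sum>k<length l. w (l ! k))"
      using that(1) w by (intro sum_nonneg) (auto simp: legal_def)
    ultimately show ?thesis
      by (simp add: nth_append)
  qed
  have "\<exists>a. C l a \<and> (\<forall>b. C l b \<longrightarrow> w b \<le> 2 * w a)" if l: "legal l" for l
  proof -
    obtain a0 where a0: "C l a0"
      using ex l by (auto simp: legal_def)
    define S where "S = (SUP b\<in>{b. C l b}. w b)"
    have bdd: "bdd_above (w ` {b. C l b})"
      using single [OF l] by (auto simp: bdd_above_def)
    have up: "w b \<le> S" if "C l b" for b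
      unfolding S_def by (rule cSUP_upper) (use that bdd in auto)
    show ?thesis
    \<comment> \<open>Half of a positive supremum is exceeded by some candidate; otherwise all
      weights are at most zero and any candidate will do.\<close>
    proof (cases "S > 0")
      case True
      then have "S / 2 < (SUP b\<in>{b. C l b}. w b)"
        by (simp add: S_def)
      then obtain a where "C l a" "S / 2 < w a"
        using less_cSUP_iff [OF _ bdd, of "S / 2"] a0 by blast
      then show ?thesis
        using up by (intro exI [of _ a]) (force intro: order_trans)
    next
      case False
      then show ?thesis
        using up w a0 by (intro exI [of _ a0]) (smt (verit))
    qed
  qed
  then obtain g where g: "\<And>l. legal l \<Longrightarrow> C l (g l)" "\<And>l b. legal l \<Longrightarrow> C l b \<Longrightarrow> w b \<le> 2 * w (g l)"
    by metis
  \<comment> \<open>Recursion runs over whole histories, since admissibility of the next element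
    depends on all earlier ones.\<close>
  define L where "L = rec_nat [] (\<lambda>_ l. l @ [g l])"
  have L0: "L 0 = []" and LS: "L (Suc n) = L n @ [g (L n)]" for n
    by (simp_all add: L_def)
  define f where "f n = g (L n)" for n
  have Lf: "L n = map f [0..<n]" for n
    by (induction n) (simp_all add: L0 LS f_def)
  have legal: "legal (L n)" for n
    by (induction n) (simp_all add: L0 LS legal_snoc g(1), simp add: legal_def)
  have "w b \<le> 0" if b: "\<And>n. C (map f [0..<n]) b" for b
  proof (rule ccontr)
    assume "\<not> w b \<le> 0"
    then have wb: "w b > 0" by simp
    obtain n where n: "2 * B / w b < real n"
      using reals_Archimedean2 by blast
    have "w b / 2 \<le> w (f k)" for k
    proof -
      have "C (L k) b"
        using b [of k] by (simp only: Lf)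
      then have "w b \<le> 2 * w (g (L k))"
        by (rule g(2) [OF legal])
      then show ?thesis
        by (simp add: f_def)
    qed
    then have "(\<Sum>k<n. w b / 2) \<le> (\<Sum>k<n. w (f k))"
      by (intro sum_mono)
    also have "\<dots> \<le> B"
      using B [of "L n"] legal [of n] by (simp add: legal_def Lf)
    finally show False
      using n wb by (simp add: divide_less_eq mult.commute)
  qed
  moreover have "C (map f [0..<n]) (f n)" for n
    using g(1) [OF legal [of n]] by (simp only: Lf [symmetric] f_def [of n])
  ultimately show ?thesis
    using that by blast
qed


section \<open>Von Neumann algebras and comparison of projections\<close>

definition comm :: "'h::chilbert_space cop set \<Rightarrow> 'h cop set"
  where "comm X = {t. \<forall>s\<in>X. t * s = s * t}"

locale von_neumann =
  fixes N :: "'h::chilbert_space cop set"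
  assumes N_adj: "x \<in> N \<Longrightarrow> adj x \<in> N"
    and bicommutant: "comm (comm N) = N"
begin

lemma commD: "t \<in> comm N \<Longrightarrow> x \<in> N \<Longrightarrow> t * x = x * t"
  by (simp add: comm_def)

lemma memI: "(\<And>t. t \<in> comm N \<Longrightarrow> x * t = t * x) \<Longrightarrow> x \<in> N"
  using bicommutant unfolding comm_def [of "comm N"] by blast

lemma comm_adj: "t \<in> comm N \<Longrightarrow> adj t \<in> comm N"
  unfolding comm_def by (auto dest: N_adj) (metis N_adj adj_adj adj_mult)

lemma N_one [simp]: "1 \<in> N" and N_zero [simp]: "0 \<in> N"
  by (rule memI, simp)+

lemma N_add: "x \<in> N \<Longrightarrow> y \<in> N \<Longrightarrow> x + y \<in> N"
  by (rule memI) (simp add: distrib_left distrib_right commD commD [symmetric])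

lemma N_diff: "x \<in> N \<Longrightarrow> y \<in> N \<Longrightarrow> x - y \<in> N"
  by (rule memI) (simp add: left_diff_distrib right_diff_distrib commD commD [symmetric])

lemma N_minus: "x \<in> N \<Longrightarrow> - x \<in> N"
  using N_diff [of 0 x] by simp

lemma N_mult: "x \<in> N \<Longrightarrow> y \<in> N \<Longrightarrow> x * y \<in> N"
proof (rule memI)
  fix t assume xy: "x \<in> N" "y \<in> N" and t: "t \<in> comm N"
  have "x * y * t = x * (t * y)"
    using commD [OF t xy(2)] by (simp add: mult.assoc)
  also have "\<dots> = t * (x * y)"
    using commD [OF t xy(1)] by (simp add: mult.assoc [symmetric])
  finally show "x * y * t = t * (x * y)" .
qed

lemma N_scaleC: "x \<in> N \<Longrightarrow> c *\<^sub>C x \<in> N"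
  by (rule memI) (simp add: scaleC_mult commD commD [symmetric])

lemma N_scaleR: "x \<in> N \<Longrightarrow> r *\<^sub>R x \<in> N"
  by (simp add: scaleR_scaleC N_scaleC)

lemma N_sum: "(\<And>i. i \<in> I \<Longrightarrow> x i \<in> N) \<Longrightarrow> (\<Sum>i\<in>I. x i) \<in> N"
  by (induction I rule: infinite_finite_induct) (simp_all add: N_add)

lemmas N_intros = N_add N_diff N_minus N_mult N_scaleC N_scaleR N_sum N_adj

text \<open>Commutation with a fixed operator passes to strong limits, and the double commutant
  describes \<open>N\<close> by such commutations.\<close>

lemma N_slim: "slim x l \<Longrightarrow> (\<And>n. x n \<in> N) \<Longrightarrow> l \<in> N"
proof (rule memI)
  fix t assume l: "slim x l" and x: "\<And>n. x n \<in> N" and t: "t \<in> comm N"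
  have "slim (\<lambda>n. x n * t) (l * t)" "slim (\<lambda>n. x n * t) (t * l)"
    using slim_mult_right [OF l, of t] slim_mult_left [OF l, of t] commD [OF t x] by simp_all
  then show "l * t = t * l"
    by (rule slim_unique)
qed

text \<open>The entry to \<open>N\<close> for the output of the square root and spectral
  constructions, which is only known to commute with certain operators.\<close>

lemma N_commuting:
  assumes "y \<in> N" "\<And>t. t * y = y * t \<Longrightarrow> t * g = g * t" shows "g \<in> N"
  by (rule memI) (metis assms commD)

end

text \<open>Normality is recorded for increasing sequences with strong limit \<open>s\<close>, the
  form in which countable exhaustion uses it.\<close>

locale tracial_factor = von_neumann N for N :: "'h::chilbert_space cop set" +
  fixes \<tau> :: "'h cop \<Rightarrow> complex"
  assumes factor: "x \<in> N \<Longrightarrow> x \<in> comm N \<Longrightarrow> \<exists>c. x = c *\<^sub>C 1"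
    and no_abelian: "p \<in> N \<Longrightarrow> is_proj p \<Longrightarrow>
      (\<And>x y. x \<in> N \<Longrightarrow> y \<in> N \<Longrightarrow> (p * x * p) * (p * y * p) = (p * y * p) * (p * x * p)) \<Longrightarrow> p = 0"
    and trace_add: "x \<in> N \<Longrightarrow> y \<in> N \<Longrightarrow> \<tau> (x + y) = \<tau> x + \<tau> y"
    and trace_scaleC: "x \<in> N \<Longrightarrow> \<tau> (c *\<^sub>C x) = c * \<tau> x"
    and trace_one: "\<tau> 1 = 1"
    and trace_pos: "x \<in> N \<Longrightarrow> pos x \<Longrightarrow> \<tau> x \<in> \<real>\<^sub>\<ge>\<^sub>0"
    and trace_comm: "x \<in> N \<Longrightarrow> y \<in> N \<Longrightarrow> \<tau> (x * y) = \<tau> (y * x)"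
    and trace_faithful: "x \<in> N \<Longrightarrow> pos x \<Longrightarrow> \<tau> x = 0 \<Longrightarrow> x = 0"
    and trace_normal: "\<lbrakk>\<And>n. X n \<in> N; \<And>n. adj (X n) = X n; \<And>m n. m \<le> n \<Longrightarrow> pos (X n - X m); slim X s;
      \<And>n. Re (\<tau> (X n)) \<le> r\<rbrakk> \<Longrightarrow> Re (\<tau> s) \<le> r"
begin

definition tr :: "'h cop \<Rightarrow> real" where "tr x = Re (\<tau> x)"

lemma trace_zero [simp]: "\<tau> 0 = 0"
  using trace_scaleC [of 0 0] by simp

lemma trace_minus: "x \<in> N \<Longrightarrow> \<tau> (- x) = - \<tau> x"
  using trace_scaleC [of x "-1"] by simp

lemma trace_diff: "x \<in> N \<Longrightarrow> y \<in> N \<Longrightarrow> \<tau> (x - y) = \<tau> x - \<tau> y"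
  using trace_add [of x "- y"] by (simp add: trace_minus N_minus)

lemma trace_sum: "(\<And>i. i \<in> I \<Longrightarrow> x i \<in> N) \<Longrightarrow> \<tau> (\<Sum>i\<in>I. x i) = (\<Sum>i\<in>I. \<tau> (x i))"
  by (induction I rule: infinite_finite_induct) (simp_all add: trace_add N_sum)

lemma tr_simps:
  "x \<in> N \<Longrightarrow> y \<in> N \<Longrightarrow> tr (x + y) = tr x + tr y"
  "x \<in> N \<Longrightarrow> y \<in> N \<Longrightarrow> tr (x - y) = tr x - tr y"
  "x \<in> N \<Longrightarrow> tr (r *\<^sub>R x) = r * tr x"
  "tr 0 = 0"
  by (simp_all add: tr_def trace_add trace_diff trace_scaleC scaleR_scaleC)

lemma tr_sum: "(\<And>i. i \<in> I \<Longrightarrow> x i \<in> N) \<Longrightarrow> tr (\<Sum>i\<in>I. x i) = (\<Sum>i\<in>I. tr (x i))"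
  by (simp add: tr_def trace_sum)

lemma trace_tr: "x \<in> N \<Longrightarrow> pos x \<Longrightarrow> \<tau> x = complex_of_real (tr x)"
  using trace_pos [of x] by (simp add: tr_def complex_eq_iff complex_nonneg_Reals_iff)

lemma tr_nonneg: "x \<in> N \<Longrightarrow> pos x \<Longrightarrow> 0 \<le> tr x"
  using trace_pos [of x] by (simp add: tr_def complex_nonneg_Reals_iff)

lemma tr_eq_zero: "x \<in> N \<Longrightarrow> pos x \<Longrightarrow> tr x = 0 \<Longrightarrow> x = 0"
  using trace_faithful trace_tr by simp

lemma tr_pos: "x \<in> N \<Longrightarrow> pos x \<Longrightarrow> x \<noteq> 0 \<Longrightarrow> 0 < tr x"
  using tr_nonneg tr_eq_zero by (metis less_eq_real_def)

lemma tr_mono_proj: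
  assumes "p \<in> N" "q \<in> N" "is_proj p" "is_proj q" "p * q = p" shows "tr p \<le> tr q"
  using tr_nonneg [of "q - p"] assms by (simp add: tr_simps N_diff pos_proj_diff)

lemma tr_comm: "x \<in> N \<Longrightarrow> y \<in> N \<Longrightarrow> tr (x * y) = tr (y * x)"
  by (simp add: tr_def trace_comm)

text \<open>If nothing connects \<open>p\<close> to \<open>q\<close>, the vectors killed by all
  \<open>q * x\<close> form a subspace invariant under \<open>N\<close> and under its commutant. The
  projection onto it is central, hence scalar; it dominates \<open>p\<close>, so it is 1, and then
  \<open>q = 0\<close>.\<close>

lemma factor_connecting:
  assumes p: "p \<in> N" "is_proj p" "p \<noteq> 0" and q: "q \<in> N" "is_proj q" "q \<noteq> 0"
  obtains x where "x \<in> N" "q * x * p \<noteq> 0"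
proof (rule ccontr)
  assume "\<not> thesis"
  then have z: "q * x * p = 0" if "x \<in> N" for x
    using that \<open>\<And>x. x \<in> N \<Longrightarrow> q * x * p \<noteq> 0 \<Longrightarrow> thesis\<close> by blast
  define V where "V = (\<Inter>x\<in>N. {\<eta>. (q * x) \<rhd> \<eta> = 0})"
  have "closed V"
    unfolding V_def
    by (intro closed_INT ballI closed_Collect_eq linear_continuous_on bounded_linear_app continuous_on_const)
  then have V: "closed_csubspace V"
    by (auto simp: closed_csubspace_def V_def app_add_right app_scaleC_right)
  obtain e where e: "is_proj e" and eV: "\<And>\<xi>. e \<rhd> \<xi> \<in> V" and eid: "\<And>\<xi>. \<xi> \<in> V \<Longrightarrow> e \<rhd> \<xi> = \<xi>"
    by (rule projection_onto [OF V]) blast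
  have inv: "t * e = e * t" if inv: "\<And>\<eta>. \<eta> \<in> V \<Longrightarrow> t \<rhd> \<eta> \<in> V" "\<And>\<eta>. \<eta> \<in> V \<Longrightarrow> adj t \<rhd> \<eta> \<in> V" for t
    by (rule commute_projection [OF e]) (rule cop_eqI, simp add: app_mult eid inv eV)+
  have VN: "y \<rhd> \<eta> \<in> V" if "\<eta> \<in> V" "y \<in> N" for y \<eta>
    using that unfolding V_def by (auto simp: app_mult [symmetric] mult.assoc N_mult)
  have VC: "t \<rhd> \<eta> \<in> V" if "\<eta> \<in> V" "t \<in> comm N" for t \<eta>
  proof -
    have "(q * x) \<rhd> (t \<rhd> \<eta>) = t \<rhd> ((q * x) \<rhd> \<eta>)" if "x \<in> N" for x
      using commD [OF \<open>t \<in> comm N\<close>, of "q * x"] that q by (simp add: app_mult [symmetric] N_mult)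
    then show ?thesis
      using that(1) by (auto simp: V_def)
  qed
  have "e \<in> N"
    by (rule memI) (metis inv VC comm_adj)
  moreover have "e \<in> comm N"
    unfolding comm_def using inv VN N_adj by force
  ultimately obtain c where c: "e = c *\<^sub>C 1"
    using factor by blast
  have ep: "e * p = p"
  proof (rule cop_eqI)
    fix \<xi>
    have "(q * x) \<rhd> (p \<rhd> \<xi>) = 0" if "x \<in> N" for x
      using z [OF that] by (simp only: app_mult [symmetric] app_zero_left)
    then have "p \<rhd> \<xi> \<in> V"
      by (simp add: V_def)
    then show "(e * p) \<rhd> \<xi> = p \<rhd> \<xi>"
      by (simp add: app_mult eid)
  qed
  have "c *\<^sub>C e = e"
    using is_projD(2) [OF e] by (metis c scaleC_mult_left mult_1)
  then have "c *\<^sub>C e = 1 *\<^sub>C e"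
    by simp
  then have "(c - 1) *\<^sub>C e = 0"
    by (simp add: scaleC_diff_left)
  then have "c = 1 \<or> e = 0"
    using scaleC_cancel [of "c - 1" e 0] by auto
  then have "e = 1"
    using c ep p by auto
  then have "\<xi> \<in> V" for \<xi>
    using eV [of \<xi>] by simp
  then have "(q * 1) \<rhd> \<xi> = 0" for \<xi>
    unfolding V_def using N_one by blast
  then have "q = 0"
    by (intro cop_eqI) simp
  then show False
    using q by simp
qed

text \<open>The partial isometry is the cut \<open>y * g\<close> of \<open>y = q * x * p\<close>.
  Whatever commutes with \<open>adj y * y\<close> commutes with \<open>g\<close>; this puts
  \<open>g\<close> into \<open>N\<close> and lets \<open>p\<close> pass through it.\<close>

lemma comparison_nonzero:
  assumes p: "p \<in> N" "is_proj p" "p \<noteq> 0" and q: "q \<in> N" "is_proj q" "q \<noteq> 0"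
  obtains v where "v \<in> N" "v \<noteq> 0" "is_proj (adj v * v)" "v * p = v" "q * v = v"
proof -
  obtain x where x: "x \<in> N" "q * x * p \<noteq> 0"
    by (rule factor_connecting [OF p q])
  define y where "y = q * x * p"
  have y: "y \<in> N" "y * p = y" "q * y = y"
    using x p q by (simp_all add: y_def N_mult is_projD mult.assoc proj_absorb)
  have py: "p * adj y = adj y"
    using arg_cong [OF y(2), of adj] p by (simp add: is_projD)
  obtain g where g: "is_proj (adj (y * g) * (y * g))" "y * g \<noteq> 0"
    "\<And>t. t * (adj y * y) = (adj y * y) * t \<Longrightarrow> t * g = g * t"
    by (rule partial_isometry_from_operator [of y]) (use x in \<open>auto simp: y_def\<close>)
  have gN: "g \<in> N"
    by (rule N_commuting [of "adj y * y"]) (simp_all add: N_intros y g)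
  have "p * (adj y * y) = (adj y * y) * p"
    by (simp add: mult.assoc y(2)) (simp add: mult.assoc [symmetric] py)
  then have "p * g = g * p"
    by (rule g)
  then have "y * g * p = y * p * g"
    by (simp add: mult.assoc)
  then have "y * g * p = y * g"
    by (simp add: y)
  moreover have "q * (y * g) = y * g"
    by (simp add: mult.assoc [symmetric] y)
  ultimately show ?thesis
    using that [of "y * g"] g gN y by (simp add: N_mult)
qed

text \<open>Greedy exhaustion by partial isometries from below \<open>p\<close> to below
  \<open>q\<close>. Equal traces leave defects of equal trace on both sides, so a nonzero defect
  would admit one more partial isometry.\<close>

theorem comparison:
  assumes p: "p \<in> N" "is_proj p" and q: "q \<in> N" "is_proj q" and pq: "tr p = tr q"
  obtains v where "v \<in> N" "adj v * v = p" "v * adj v = q"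
proof -
  \<comment> \<open>\<open>adj u * v = 0\<close> makes the final spaces orthogonal and
    \<open>u * adj v = 0\<close> the initial spaces; with both, the sum is again a partial
    isometry.\<close>
  define C where "C = (\<lambda>l v. v \<in> N \<and> is_proj (adj v * v) \<and> v * p = v \<and> q * v = v \<and>
    (\<forall>u\<in>set l. adj u * v = 0 \<and> u * adj v = 0))"
  have sym: "adj v * u = 0 \<and> v * adj u = 0" if "adj u * v = 0 \<and> u * adj v = 0" for u v :: "'h cop"
    using that by (metis adj_adj adj_mult adj_zero)
  obtain f where f: "\<And>n. C (map f [0..<n]) (f n)"
    and max: "\<And>b. (\<And>n. C (map f [0..<n]) b) \<Longrightarrow> tr (adj b * b) \<le> 0"
  proof (rule greedy_sequence [of C "\<lambda>v. tr (adj v * v)" "tr p"])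
    show "\<exists>a. C l a" for l
      by (rule exI [of _ 0]) (simp add: C_def)
    show "0 \<le> tr (adj a * a)" if "C l a" for l a
      using that by (intro tr_nonneg) (auto simp: C_def N_intros pos_adj_mult)
    show "(\<Sum>k<length l. tr (adj (l ! k) * (l ! k))) \<le> tr p"
      if l: "\<forall>k<length l. C (take k l) (l ! k)" for l
    proof -
      let ?e = "\<lambda>k. adj (l ! k) * (l ! k)"
      have o: "adj (l ! i) * (l ! j) = 0 \<and> (l ! i) * adj (l ! j) = 0" if "i < j" "j < length l" for i j
      proof -
        have "l ! i \<in> set (take j l)"
          using that by (auto simp: in_set_conv_nth intro!: exI [of _ i])
        then show ?thesis
          using l that by (auto simp: C_def)
      qed
      have o2: "(l ! i) * adj (l ! j) = 0" if "i \<noteq> j" "j < length l" "i < length l" for i j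
        using o [of i j] o [of j i] that sym by (metis linorder_neqE_nat)
      have "is_proj (\<Sum>k<length l. ?e k)"
      proof (rule is_proj_sum)
        show "?e i * ?e j = 0" if "i \<in> {..<length l}" "j \<in> {..<length l}" "i \<noteq> j" for i j
        proof -
          have "?e i * ?e j = adj (l ! i) * ((l ! i) * adj (l ! j)) * (l ! j)"
            by (simp only: mult.assoc)
          then show ?thesis
            using o2 [of i j] that by simp
        qed
      qed (use l in \<open>auto simp: C_def\<close>)
      moreover have "(\<Sum>k<length l. ?e k) * p = (\<Sum>k<length l. ?e k)"
        unfolding sum_distrib_right by (rule sum.cong) (use l in \<open>auto simp: C_def mult.assoc\<close>)
      moreover have N: "?e k \<in> N" if "k < length l" for k
        using l that by (auto simp: C_def N_intros)
      ultimately have "tr (\<Sum>k<length l. ?e k) \<le> tr p"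
        using p by (intro tr_mono_proj) (auto intro: N_sum)
      then show ?thesis
        using N by (subst (asm) tr_sum) auto
    qed
  qed blast
  have fN: "f n \<in> N" and fp: "is_proj (adj (f n) * f n)" "f n * p = f n" "q * f n = f n" for n
    using f [of n] by (auto simp: C_def)
  have "adj (f i) * f j = 0 \<and> f i * adj (f j) = 0" if "i < j" for i j
    using f [of j] that by (auto simp: C_def)
  then have orth: "adj (f i) * f j = 0 \<and> f i * adj (f j) = 0" if "i \<noteq> j" for i j
    using that sym by (metis linorder_neqE_nat)
  obtain s where s: "slim (\<lambda>n. \<Sum>i<n. f i) s"
    and e: "slim (\<lambda>n. \<Sum>i<n. adj (f i) * f i) (adj s * s)"
    and r: "slim (\<lambda>n. \<Sum>i<n. f i * adj (f i)) (s * adj s)"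
    by (rule orth_sum [of f]) (use fp orth in auto)
  have sN: "s \<in> N"
    by (rule N_slim [OF s]) (simp add: N_sum fN)
  have fe: "f n * (adj s * s) = f n" for n
  proof -
    have "f n * (adj s * s) = (\<Sum>i\<in>{n}. f n * (adj (f i) * f i))"
    proof (rule slim_sum_finite [OF e])
      fix i assume "i \<notin> {n}"
      then show "f n * (adj (f i) * f i) = 0"
        using orth [of n i] by (simp add: mult.assoc [symmetric])
    qed simp
    then show ?thesis
      by (simp add: partial_isometry_initial [OF fp(1)])
  qed
  have rf: "adj (f n) * (s * adj s) = adj (f n)" for n
  proof -
    have "adj (f n) * (s * adj s) = (\<Sum>i\<in>{n}. adj (f n) * (f i * adj (f i)))"
    proof (rule slim_sum_finite [OF r])
      fix i assume "i \<notin> {n}"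
      then show "adj (f n) * (f i * adj (f i)) = 0"
        using orth [of n i] by (simp add: mult.assoc [symmetric])
    qed simp
    then show ?thesis
      using partial_isometry_adj_initial [OF fp(1)] by (simp add: mult.assoc)
  qed
  have "s * (adj s * s) = s"
    by (rule slim_unique [OF _ s])
      (use slim_mult_right [OF s, of "adj s * s"] in \<open>simp only: sum_distrib_right fe\<close>)
  then have pe: "is_proj (adj s * s)"
    unfolding is_proj_def by (simp add: mult.assoc)
  then have pr: "is_proj (s * adj s)"
    by (rule partial_isometry_final)
  have sp: "s * p = s" "q * s = s"
    by (rule slim_unique [OF _ s], use slim_mult_right [OF s, of p] in \<open>simp only: sum_distrib_right fp\<close>)
      (rule slim_unique [OF _ s], use slim_mult_left [OF s, of q] in \<open>simp only: sum_distrib_left fp\<close>)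
  have ep: "(adj s * s) * p = adj s * s" and qr: "(s * adj s) * q = s * adj s"
    using sp(1) arg_cong [OF sp(2), of adj] q by (simp_all add: mult.assoc is_projD)
  have pd: "is_proj (p - adj s * s)" "is_proj (q - s * adj s)"
    using p q pe pr ep qr by (auto intro: is_proj_diff)
  \<comment> \<open>The initial and final projections of \<open>s\<close> have the same trace, so
    either both defects vanish or neither does.\<close>
  have teq: "tr (p - adj s * s) = tr (q - s * adj s)"
    using p q sN by (simp add: tr_simps N_intros pq tr_comm)
  have pN: "p - adj s * s \<in> N" "q - s * adj s \<in> N"
    using p q sN by (simp_all add: N_intros)
  have "p - adj s * s = 0"
  proof (rule ccontr)
    assume ne: "p - adj s * s \<noteq> 0"
    then have "tr (q - s * adj s) \<noteq> 0"
      using tr_pos [OF pN(1) pos_proj [OF pd(1)]] teq by simp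
    then have "q - s * adj s \<noteq> 0"
      by (metis tr_simps(4))
    then obtain v where v: "v \<in> N" "v \<noteq> 0" "is_proj (adj v * v)"
      "v * (p - adj s * s) = v" "(q - s * adj s) * v = v"
      using comparison_nonzero [OF pN(1) pd(1) ne pN(2) pd(2)] by metis
    have "adj (f n) * (q - s * adj s) = 0" for n
      using rf [of n] arg_cong [OF fp(3) [of n], of adj] q by (simp add: right_diff_distrib is_projD)
    then have 1: "adj (f n) * v = 0" for n
      by (metis v(5) mult.assoc mult_zero_left)
    have "f n * (p - adj s * s) = 0" for n
      using fe [of n] fp(2) [of n] by (simp add: right_diff_distrib)
    then have "f n * adj (v * (p - adj s * s)) = 0" for n
      by (simp add: is_projD [OF pd(1)] mult.assoc [symmetric] del: adj_diff)
    then have 2: "f n * adj v = 0" for n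
      by (simp only: v(4))
    have vp: "v * p = v"
    proof -
      have "(p - adj s * s) * p = p - adj s * s"
        using ep p by (simp add: left_diff_distrib is_projD)
      then show ?thesis
        by (metis v(4) mult.assoc)
    qed
    have qv: "q * v = v"
    proof -
      have "q * (q - s * adj s) = q - s * adj s"
        using sp q by (simp add: right_diff_distrib is_projD mult.assoc [symmetric])
      then show ?thesis
        by (metis v(5) mult.assoc)
    qed
    have "tr (adj v * v) \<le> 0"
      by (rule max) (auto simp: C_def v 1 2 vp qv)
    moreover have "adj v * v \<noteq> 0"
      using v(2) adj_mult_self_zero by blast
    ultimately show False
      using tr_pos [of "adj v * v"] v by (simp add: N_intros pos_adj_mult)
  qed
  moreover from this have "q - s * adj s = 0"
    using tr_eq_zero [OF pN(2) pos_proj [OF pd(2)]] teq by (simp add: tr_simps)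
  ultimately show ?thesis
    using that [of s] sN by simp
qed

end


section \<open>Maximal abelian subalgebras\<close>

text \<open>Maximality is recorded as \<open>A\<close> being its own relative commutant in
  \<open>N\<close>; the unit, the algebra operations and closedness under strong limits are read off
  from this.\<close>

locale masa_expectation = tracial_factor N \<tau> for N :: "'h::chilbert_space cop set" and \<tau> +
  fixes A :: "'h cop set" and E :: "'h cop \<Rightarrow> 'h cop"
  assumes A_iff: "x \<in> A \<longleftrightarrow> x \<in> N \<and> (\<forall>a\<in>A. x * a = a * x)"
    and A_adj: "x \<in> A \<Longrightarrow> adj x \<in> A"
    and E_in_A: "x \<in> N \<Longrightarrow> E x \<in> A"
    and E_add: "x \<in> N \<Longrightarrow> y \<in> N \<Longrightarrow> E (x + y) = E x + E y"
    and E_scaleC: "x \<in> N \<Longrightarrow> E (c *\<^sub>C x) = c *\<^sub>C E x"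
    and E_fixes_A: "a \<in> A \<Longrightarrow> E a = a"
    and E_bimodule: "a \<in> A \<Longrightarrow> x \<in> N \<Longrightarrow> b \<in> A \<Longrightarrow> E (a * x * b) = a * E x * b"
    and trace_E: "x \<in> N \<Longrightarrow> \<tau> (E x) = \<tau> x"
begin

lemma A_sub_N: "a \<in> A \<Longrightarrow> a \<in> N"
  using A_iff by blast

lemma A_commute: "a \<in> A \<Longrightarrow> b \<in> A \<Longrightarrow> a * b = b * a"
  using A_iff by blast

lemma A_I: "x \<in> N \<Longrightarrow> (\<And>a. a \<in> A \<Longrightarrow> x * a = a * x) \<Longrightarrow> x \<in> A"
  using A_iff by blast

lemma A_one [simp]: "1 \<in> A" and A_zero [simp]: "0 \<in> A"
  by (rule A_I; simp)+

lemma A_add: "x \<in> A \<Longrightarrow> y \<in> A \<Longrightarrow> x + y \<in> A"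
  by (rule A_I) (simp_all add: A_sub_N N_add distrib_left distrib_right A_commute)

lemma A_diff: "x \<in> A \<Longrightarrow> y \<in> A \<Longrightarrow> x - y \<in> A"
  by (rule A_I) (simp_all add: A_sub_N N_diff left_diff_distrib right_diff_distrib A_commute)

lemma A_mult: "x \<in> A \<Longrightarrow> y \<in> A \<Longrightarrow> x * y \<in> A"
proof (rule A_I)
  fix a assume "x \<in> A" "y \<in> A" "a \<in> A"
  then show "x * y * a = a * (x * y)"
    using A_commute [of x a] A_commute [of y a] by (metis mult.assoc)
qed (simp add: A_sub_N N_mult)

lemma A_scaleC: "x \<in> A \<Longrightarrow> c *\<^sub>C x \<in> A"
  using A_mult [of "c *\<^sub>C 1" x] by (rule_tac A_I) (simp_all add: A_sub_N N_scaleC scaleC_mult A_commute)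

lemma A_scaleR: "x \<in> A \<Longrightarrow> r *\<^sub>R x \<in> A"
  by (simp add: scaleR_scaleC A_scaleC)

lemma A_sum: "(\<And>i. i \<in> I \<Longrightarrow> x i \<in> A) \<Longrightarrow> (\<Sum>i\<in>I. x i) \<in> A"
  by (induction I rule: infinite_finite_induct) (simp_all add: A_add)

lemma A_slim:
  assumes l: "slim x l" and x: "\<And>n. x n \<in> A" shows "l \<in> A"
proof (rule A_I)
  show "l \<in> N"
    using N_slim [OF l] x A_sub_N by blast
  fix a assume a: "a \<in> A"
  have "slim (\<lambda>n. x n * a) (l * a)" "slim (\<lambda>n. x n * a) (a * l)"
    using slim_mult_right [OF l, of a] slim_mult_left [OF l, of a] A_commute [OF x a] by simp_all
  then show "l * a = a * l"
    by (rule slim_unique)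
qed

text \<open>If \<open>P\<close> were minimal in \<open>A\<close>, every element of \<open>A\<close>
  would be scalar on \<open>P\<close>. Then \<open>P * x * P\<close> commutes with \<open>A\<close>
  and so lies in the abelian \<open>A\<close>, which makes \<open>P\<close> an abelian
  projection.\<close>

lemma no_minimal_projection:
  assumes P: "P \<in> A" "is_proj P" "P \<noteq> 0"
  obtains Q where "Q \<in> A" "is_proj Q" "Q * P = Q" "Q \<noteq> 0" "Q \<noteq> P"
proof (rule ccontr)
  assume "\<not> thesis"
  then have min: "Q = 0 \<or> Q = P" if "Q \<in> A" "is_proj Q" "Q * P = Q" for Q
    using that \<open>\<And>Q. Q \<in> A \<Longrightarrow> is_proj Q \<Longrightarrow> Q * P = Q \<Longrightarrow> Q \<noteq> 0 \<Longrightarrow> Q \<noteq> P \<Longrightarrow> thesis\<close> by blast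
  have PN: "P \<in> N"
    by (rule A_sub_N [OF P(1)])
  have trP: "tr P > 0"
    by (rule tr_pos [OF PN pos_proj [OF P(2)] P(3)])
  have herm: "\<exists>c. a * P = c *\<^sub>C P" if a: "a \<in> A" "adj a = a" for a
  proof -
    \<comment> \<open>The mean of \<open>a\<close> over \<open>P\<close>: with it
      \<open>P * d\<close> has trace zero, while minimality forces it to have one sign.\<close>
    define c where "c = tr (P * a) / tr P"
    define d where "d = a - c *\<^sub>R 1"
    have dA: "d \<in> A"
      by (simp add: d_def a A_diff A_scaleR)
    have Pa: "P * a = a * P" and Pd: "P * d = d * P"
      using A_commute P(1) a(1) dA by auto
    have "adj d = d"
      by (simp add: d_def a)
    then obtain e where e: "is_proj e" "\<And>t. t * d = d * t \<Longrightarrow> t * e = e * t"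
      "pos (e * d)" "pos (- ((1 - e) * d))"
      using spectral_projection by blast
    have eA: "e \<in> A"
    proof (rule A_I)
      show "e \<in> N"
        by (rule N_commuting [OF A_sub_N [OF dA] e(2)])
      show "e * b = b * e" if "b \<in> A" for b
        by (rule e(2) [symmetric]) (rule A_commute [OF that dA])
    qed
    have eP: "e * P = P * e"
      by (rule A_commute [OF eA P(1)])
    have "(e * P) * (e * P) = e * (P * e) * P"
      by (simp add: mult.assoc)
    also have "\<dots> = e * P"
      by (simp add: eP [symmetric] mult.assoc is_projD [OF P(2)]) (simp add: is_projD [OF e(1)] mult.assoc [symmetric])
    finally have "is_proj (e * P)"
      using eP by (simp add: is_proj_def is_projD [OF e(1)] is_projD [OF P(2)])
    then have "e * P = 0 \<or> e * P = P"
      using min [of "e * P"] eA P by (simp add: A_mult mult.assoc is_projD)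
    then have "pos (P * d) \<or> pos (- (P * d))"
    proof
      assume z: "e * P = 0"
      have "adj P * (- ((1 - e) * d)) * P = - (P * (1 - e) * (d * P))"
        by (simp add: is_projD [OF P(2)] mult.assoc)
      also have "P * (1 - e) = P"
        using z eP by (simp add: right_diff_distrib)
      also have "P * (d * P) = P * d"
        using Pd by (metis is_projD(2) [OF P(2)] mult.assoc)
      finally show ?thesis
        using pos_conj [OF e(4), of P] by simp
    next
      assume z: "e * P = P"
      have "adj P * (e * d) * P = P * e * (d * P)"
        by (simp add: is_projD [OF P(2)] mult.assoc)
      also have "P * e = P"
        using z eP by simp
      also have "P * (d * P) = P * d"
        using Pd by (metis is_projD(2) [OF P(2)] mult.assoc)
      finally show ?thesis
        using pos_conj [OF e(3), of P] by simp
    qed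
    moreover have "tr (P * d) = 0"
      using trP PN a(1) by (simp add: d_def right_diff_distrib tr_simps N_mult N_scaleR A_sub_N c_def)
    moreover have "tr (- (P * d)) = 0"
      using \<open>tr (P * d) = 0\<close> tr_simps(2) [of 0 "P * d"] PN dA by (simp add: N_mult A_sub_N tr_simps)
    ultimately have "P * d = 0"
      using tr_eq_zero [of "P * d"] tr_eq_zero [of "- (P * d)"] PN dA
      by (auto simp: N_mult N_minus A_sub_N)
    then have "a * P = complex_of_real c *\<^sub>C P"
      using Pa by (simp add: d_def right_diff_distrib scaleR_scaleC scaleC_mult)
    then show ?thesis
      by blast
  qed
  have scalar: "\<exists>c. a * P = c *\<^sub>C P" if a: "a \<in> A" for a
  proof -
    obtain c where c: "(a + adj a) * P = c *\<^sub>C P"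
      using herm [of "a + adj a"] a A_adj by (auto simp: A_add add.commute)
    obtain d where d: "(\<i> *\<^sub>C (a - adj a)) * P = d *\<^sub>C P"
      using herm [of "\<i> *\<^sub>C (a - adj a)"] a A_adj
      by (auto simp: A_diff A_scaleC scaleC_diff_right)
    have 2: "a = (1/2) *\<^sub>C ((a + adj a) - \<i> *\<^sub>C (\<i> *\<^sub>C (a - adj a)))"
      using scaleC_add_left [of "1/2" "1/2" a]
      by (simp add: scaleC_scaleC scaleC_add_right scaleC_diff_right)
    have "a * P = (1/2) *\<^sub>C ((a + adj a) * P - \<i> *\<^sub>C ((\<i> *\<^sub>C (a - adj a)) * P))"
      by (subst 2) (simp only: scaleC_mult_left left_diff_distrib)
    also have "\<dots> = ((1/2) * (c - \<i> * d)) *\<^sub>C P"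
      unfolding c d
      by (simp only: scaleC_scaleC scaleC_diff_right scaleC_diff_left right_diff_distrib mult.assoc)
    finally show ?thesis
      by blast
  qed
  have corner: "P * x * P \<in> A" if x: "x \<in> N" for x
  proof (rule A_I)
    show "P * x * P \<in> N"
      using PN x by (simp add: N_mult)
    fix a assume a: "a \<in> A"
    obtain c where c: "a * P = c *\<^sub>C P"
      using scalar [OF a] by blast
    then have c': "P * a = c *\<^sub>C P"
      using A_commute [OF a P(1)] by simp
    show "P * x * P * a = a * (P * x * P)"
      by (simp add: mult.assoc c' scaleC_mult) (simp add: mult.assoc [symmetric] c scaleC_mult)
  qed
  have "P = 0"
    by (rule no_abelian [OF PN P(2)]) (rule A_commute; rule corner)
  then show False
    using P(3) by simp
qed

text \<open>Of a proper subprojection \<open>Q\<close> and its complement \<open>R - Q\<close>, one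
  has at most half of the trace of \<open>R\<close>; iterate.\<close>

lemma small_projection:
  assumes P: "P \<in> A" "is_proj P" "P \<noteq> 0" and \<epsilon>: "0 < \<epsilon>"
  obtains Q where "Q \<in> A" "is_proj Q" "Q * P = Q" "0 < tr Q" "tr Q \<le> \<epsilon>"
proof -
  have half: "\<exists>Q. Q \<in> A \<and> is_proj Q \<and> Q * R = Q \<and> Q \<noteq> 0 \<and> tr Q \<le> tr R / 2"
    if R: "R \<in> A" "is_proj R" "R \<noteq> 0" for R
  proof -
    obtain Q where Q: "Q \<in> A" "is_proj Q" "Q * R = Q" "Q \<noteq> 0" "Q \<noteq> R"
      using no_minimal_projection [OF R] by blast
    show ?thesis
    proof (cases "tr Q \<le> tr R / 2")
      case True
      then show ?thesis using Q by blast
    next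
      case False
      have "tr (R - Q) = tr R - tr Q"
        using Q R by (simp add: tr_simps A_sub_N)
      moreover have "(R - Q) * R = R - Q"
        using Q R by (simp add: left_diff_distrib is_projD)
      ultimately show ?thesis
        using False Q R by (intro exI [of _ "R - Q"]) (auto simp: A_diff is_proj_diff)
    qed
  qed
  have "\<exists>Q. Q \<in> A \<and> is_proj Q \<and> Q * P = Q \<and> Q \<noteq> 0 \<and> tr Q \<le> tr P / 2 ^ n" for n
  proof (induction n)
    case 0
    then show ?case using P by (auto simp: is_projD)
  next
    case (Suc n)
    then obtain Q where Q: "Q \<in> A" "is_proj Q" "Q * P = Q" "Q \<noteq> 0" "tr Q \<le> tr P / 2 ^ n"
      by blast
    obtain R where R: "R \<in> A" "is_proj R" "R * Q = R" "R \<noteq> 0" "tr R \<le> tr Q / 2"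
      using half [OF Q(1,2,4)] by blast
    have "R * P = R"
      using Q(3) R(3) by (metis mult.assoc)
    moreover have "tr R \<le> tr P / 2 ^ Suc n"
      using Q(5) R(5) by simp
    ultimately show ?case
      using R by blast
  qed
  moreover obtain n where "tr P / 2 ^ n \<le> \<epsilon>"
  proof -
    obtain n where "(1/2) ^ n < \<epsilon> / (\<bar>tr P\<bar> + 1)"
      using real_arch_pow_inv [of "\<epsilon> / (\<bar>tr P\<bar> + 1)" "1/2"] \<epsilon> by (auto simp: divide_pos_pos add_nonneg_pos)
    then have "(1/2) ^ n * (\<bar>tr P\<bar> + 1) < \<epsilon>"
      by (simp add: pos_less_divide_eq add_nonneg_pos)
    moreover have "tr P / 2 ^ n \<le> (1/2) ^ n * (\<bar>tr P\<bar> + 1)"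
      by (simp add: power_one_over field_simps)
    ultimately show ?thesis
      using that by (meson less_eq_real_def order_trans)
  qed
  ultimately obtain Q where "Q \<in> A" "is_proj Q" "Q * P = Q" "Q \<noteq> 0" "tr Q \<le> \<epsilon>"
    by (meson order_trans)
  then show ?thesis
    using that [of Q] tr_pos [of Q] by (simp add: A_sub_N pos_proj)
qed

text \<open>Greedy exhaustion within the budget \<open>t\<close>. Normality keeps the infinite sum
  within the budget, and a remaining gap would leave room for a small projection that was admissible
  all along.\<close>

lemma projection_with_trace:
  assumes P: "P \<in> A" "is_proj P" and t: "0 \<le> t" "t \<le> tr P"
  obtains Q where "Q \<in> A" "is_proj Q" "Q * P = Q" "tr Q = t"
proof -
  define C where "C = (\<lambda>l q. q \<in> A \<and> is_proj q \<and> q * P = q \<and> (\<forall>u\<in>set l. u * q = 0) \<and>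
    (\<Sum>k<length l. tr (l ! k)) + tr q \<le> t)"
  \<comment> \<open>The weight of the history is part of \<open>C\<close>, so the condition on the
    last element alone bounds the total.\<close>
  have last_bound: "(\<Sum>k<length l. tr (l ! k)) \<le> t" if l: "\<forall>k<length l. C (take k l) (l ! k)" for l
  proof (cases "length l")
    case (Suc m)
    then have "C (take m l) (l ! m)"
      using l by simp
    then show ?thesis
      using Suc by (simp add: C_def)
  qed (use t in simp)
  obtain f where f: "\<And>n. C (map f [0..<n]) (f n)"
    and max: "\<And>b. (\<And>n. C (map f [0..<n]) b) \<Longrightarrow> tr b \<le> 0"
  proof (rule greedy_sequence [of C tr t])
    show "\<exists>a. C l a" if "\<forall>k<length l. C (take k l) (l ! k)" for l
      using last_bound [OF that] by (intro exI [of _ 0]) (simp add: C_def tr_simps)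
    show "0 \<le> tr a" if "C l a" for l a
      using that by (intro tr_nonneg) (auto simp: C_def A_sub_N pos_proj)
  qed (use last_bound in blast)+
  have fA: "f n \<in> A" and fp: "is_proj (f n)" and fP: "f n * P = f n" for n
    using f [of n] by (auto simp: C_def)
  have "f i * f j = 0" if "i < j" for i j
    using f [of j] that by (auto simp: C_def)
  then have orth: "f i * f j = 0" if "i \<noteq> j" for i j
    using that A_commute fA by (metis linorder_neqE_nat)
  obtain s where s: "is_proj s" "slim (\<lambda>n. \<Sum>i<n. f i) s"
    by (rule orth_proj_sum [of f, OF fp orth])
  have sA: "s \<in> A"
    by (rule A_slim [OF s(2)]) (simp add: A_sum fA)
  have partial: "tr (\<Sum>i<n. f i) \<le> t" for n
  proof -
    have "0 \<le> tr (f n)"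
      by (intro tr_nonneg A_sub_N fA pos_proj fp)
    then show ?thesis
      using f [of n] by (simp add: C_def tr_sum A_sub_N fA)
  qed
  have "tr s \<le> t"
    unfolding tr_def
  proof (rule trace_normal [OF _ _ _ s(2)])
    show "(\<Sum>i<n. f i) \<in> N" "adj (\<Sum>i<n. f i) = (\<Sum>i<n. f i)" for n
      by (auto simp: adj_sum is_projD [OF fp] intro: N_sum A_sub_N fA)
    show "pos ((\<Sum>i<n. f i) - (\<Sum>i<m. f i))" if "m \<le> n" for m n
    proof -
      have "(\<Sum>i<n. f i) - (\<Sum>i<m. f i) = (\<Sum>i\<in>{m..<n}. f i)"
        using sum.atLeastLessThan_concat [of 0 m n f] that by (simp add: lessThan_atLeast0 diff_eq_eq add.commute)
      then show ?thesis
        by (simp add: pos_sum pos_proj fp)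
    qed
    show "Re (\<tau> (\<Sum>i<n. f i)) \<le> t" for n
      using partial [of n] by (simp add: tr_def)
  qed
  have sP: "s * P = s"
    by (rule slim_unique [OF _ s(2)])
      (use slim_mult_right [OF s(2), of P] in \<open>simp only: sum_distrib_right fP\<close>)
  have fs: "f n * s = f n" for n
  proof -
    have "f n * s = (\<Sum>i\<in>{n}. f n * f i)"
      by (rule slim_sum_finite [OF s(2)]) (auto simp: orth)
    then show ?thesis
      by (simp add: is_projD [OF fp])
  qed
  have "tr s = t"
  proof (rule ccontr)
    assume "tr s \<noteq> t"
    with \<open>tr s \<le> t\<close> have lt: "tr s < t"
      by simp
    have Ps: "P - s \<in> A" "is_proj (P - s)" "P - s \<noteq> 0"
      using lt t P s sA sP by (auto simp: A_diff is_proj_diff)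
    obtain Q where Q: "Q \<in> A" "is_proj Q" "Q * (P - s) = Q" "0 < tr Q" "tr Q \<le> t - tr s"
      using small_projection [OF Ps, of "t - tr s"] lt by auto
    have "C (map f [0..<n]) Q" for n
    proof -
      have "Q * P = Q"
      proof -
        have "(P - s) * P = P - s"
          using sP P by (simp add: left_diff_distrib is_projD)
        then show ?thesis
          using Q(3) by (metis mult.assoc)
      qed
      moreover have "f i * Q = 0" for i
      proof -
        have "f i * (P - s) = 0"
          by (simp add: right_diff_distrib fP fs)
        moreover have "Q = (P - s) * Q"
          using Q(3) A_commute [OF Q(1) Ps(1)] by simp
        ultimately show ?thesis
          by (metis mult.assoc mult_zero_left)
      qed
      moreover have "tr (\<Sum>i<n. f i) \<le> tr s"
      proof (rule tr_mono_proj)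
        show "(\<Sum>i<n. f i) * s = (\<Sum>i<n. f i)"
          by (simp add: sum_distrib_right fs)
        show "is_proj (\<Sum>i<n. f i)"
          by (rule is_proj_sum) (auto simp: fp orth)
      qed (auto simp: s sA A_sub_N fA intro: N_sum)
      ultimately show ?thesis
        using Q by (auto simp: C_def tr_sum A_sub_N fA)
    qed
    then show False
      using max Q(4) by force
  qed
  then show ?thesis
    using that sA s(1) sP by blast
qed

end


section \<open>Projections with scalar expectation\<close>

text \<open>The discrete Fourier matrix: a unitary whose entries all have the same modulus, which is
  what spreads a projection evenly over a partition.\<close>

lemma fourier_matrix:
  assumes "0 < (n::nat)"
  obtains u :: "nat \<Rightarrow> nat \<Rightarrow> complex" where
    "\<And>s t. s < n \<Longrightarrow> t < n \<Longrightarrow> (\<Sum>j<n. cnj (u s j) * u t j) = (if s = t then 1 else 0)"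
    "\<And>j k. j < n \<Longrightarrow> k < n \<Longrightarrow> (\<Sum>s<n. u s j * cnj (u s k)) = (if j = k then 1 else 0)"
    "\<And>s j. u s j * cnj (u s j) = 1 / of_nat n"
proof -
  define w where "w = exp (2 * of_real pi * \<i> / of_nat n)"
  have wk: "w ^ k = exp (2 * of_real pi * \<i> * of_nat k / of_nat n)" for k
    by (simp add: w_def exp_of_nat_mult [symmetric] mult_ac)
  have ww: "cnj w * w = 1"
    by (simp add: w_def exp_cnj exp_add [symmetric])
  then have wwk: "cnj w ^ k * w ^ k = 1" for k
    by (metis power_mult_distrib power_one)
  have wn: "w ^ n = 1"
    using assms by (simp add: wk exp_two_pi_i')
  define c where "c s j = w ^ (s * j)" for s j
  have sum: "(\<Sum>j<n. cnj (c s j) * c t j) = (if s = t then of_nat n else 0)" if "s < n" "t < n" for s t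
  proof (cases "s = t")
    case True
    then show ?thesis
      by (simp add: c_def wwk)
  next
    case False
    define z where "z = cnj w ^ s * w ^ t"
    have "z \<noteq> 1"
    proof
      assume "z = 1"
      then have "w ^ s * (cnj w ^ s * w ^ t) = w ^ s"
        by (simp add: z_def)
      then have "w ^ t = w ^ s"
        using wwk [of s] by (metis mult.assoc mult.commute mult_1)
      then have "t mod n = s mod n"
        using complex_root_unity_eq [of n t s] assms by (simp add: wk)
      then show False
        using that False by simp
    qed
    moreover have "z ^ n = 1"
      by (simp add: z_def power_mult_distrib power_mult [symmetric] mult.commute [of _ n])
        (simp add: power_mult wn flip: complex_cnj_power)
    ultimately have "(\<Sum>j<n. z ^ j) = 0"
      using sum_gp_strict [of z n] by simp
    moreover have "cnj (c s j) * c t j = z ^ j" for j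
      by (simp add: c_def z_def power_mult_distrib power_mult)
    ultimately show ?thesis
      using False by simp
  qed
  define u where "u s j = c s j / complex_of_real (sqrt (real n))" for s j
  have sq: "complex_of_real (sqrt (real n)) * complex_of_real (sqrt (real n)) = of_nat n"
    by (simp flip: of_real_mult)
  have uu: "cnj (u s j) * u t k = cnj (c s j) * c t k / of_nat n" for s t j k
    by (simp add: u_def sq)
  have 1: "(\<Sum>j<n. cnj (u s j) * u t j) = (if s = t then 1 else 0)" if "s < n" "t < n" for s t
    using sum [OF that] assms by (simp add: uu sum_divide_distrib [symmetric])
  \<comment> \<open>The matrix is symmetric, so this relation is the previous one with the indices
    exchanged.\<close>
  moreover have "(\<Sum>s<n. u s j * cnj (u s k)) = (if j = k then 1 else 0)" if "j < n" "k < n" for j k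
    using 1 [OF that(2,1)] by (simp add: u_def c_def mult.commute)
  moreover have "u s j * cnj (u s j) = 1 / of_nat n" for s j
    using uu [of s j s j] by (simp add: c_def wwk mult.commute [of "u s j"])
  ultimately show ?thesis
    by (rule that)
qed

section \<open>Flat partitions, rotations, and prescribed real weights\<close>

context masa_expectation
begin

lemma E_zero [simp]: "E 0 = 0"
  by (rule E_fixes_A) simp

lemma E_scaleR: "x \<in> N \<Longrightarrow> E (r *\<^sub>R x) = r *\<^sub>R E x"
  by (simp add: scaleR_scaleC E_scaleC)

lemma E_sum: "(\<And>i. i \<in> I \<Longrightarrow> x i \<in> N) \<Longrightarrow> E (\<Sum>i\<in>I. x i) = (\<Sum>i\<in>I. E (x i))"
  by (induction I rule: infinite_finite_induct) (simp_all add: E_add N_sum)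

lemma E_mult_left: "a \<in> A \<Longrightarrow> x \<in> N \<Longrightarrow> E (a * x) = a * E x"
  using E_bimodule [of a x 1] by simp

lemma tr_E: "x \<in> N \<Longrightarrow> tr (E x) = tr x"
  by (simp add: tr_def trace_E)

text \<open>\<open>E\<close> is a bimodule map into the abelian \<open>A\<close>, so
  \<open>q\<close> can be moved past \<open>E x\<close> until it meets \<open>p\<close>.\<close>

lemma E_offdiagonal:
  assumes p: "p \<in> A" and q: "q \<in> A" and pq: "p * q = 0" and x: "x \<in> N" "p * x * q = x"
  shows "E x = 0"
proof -
  have "E x = p * E x * q"
    using E_bimodule [OF p x(1) q] x(2) by simp
  also have "\<dots> = p * (q * E x)"
    using A_commute [OF E_in_A [OF x(1)] q] by (simp add: mult.assoc)
  finally show ?thesis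
    by (simp add: mult.assoc [symmetric] pq)
qed

lemma equal_partition:
  assumes "P \<in> A" "is_proj P" "tr P = real n * t" "0 \<le> t"
  shows "\<exists>Q. (\<forall>j<n. Q j \<in> A \<and> is_proj (Q j) \<and> tr (Q j) = t) \<and>
    (\<forall>i<n. \<forall>j<n. i \<noteq> j \<longrightarrow> Q i * Q j = 0) \<and> (\<Sum>j<n. Q j) = P"
  using assms
proof (induction n arbitrary: P)
  case 0
  then have "P = 0"
    using tr_eq_zero [of P] by (simp add: A_sub_N pos_proj)
  then show ?case by simp
next
  case (Suc n)
  obtain R where R: "R \<in> A" "is_proj R" "R * P = R" "tr R = t"
    by (rule projection_with_trace [of P t]) (use Suc.prems in \<open>auto simp: distrib_right\<close>)
  have "tr (P - R) = real n * t"
    using Suc.prems R by (simp add: tr_simps A_sub_N distrib_right)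
  then obtain Q where Q: "\<forall>j<n. Q j \<in> A \<and> is_proj (Q j) \<and> tr (Q j) = t"
    "\<forall>i<n. \<forall>j<n. i \<noteq> j \<longrightarrow> Q i * Q j = 0" "(\<Sum>j<n. Q j) = P - R"
    using Suc.IH [of "P - R"] Suc.prems R by (auto simp: A_diff is_proj_diff)
  have QR: "Q j * R = 0" if "j < n" for j
  proof -
    have "Q j * (\<Sum>i<n. Q i) = (\<Sum>i<n. if i = j then Q j else 0)"
      unfolding sum_distrib_left by (rule sum.cong) (use Q that in \<open>auto simp: is_projD\<close>)
    then have "Q j * (P - R) = Q j"
      using that by (simp add: Q(3))
    moreover have "(P - R) * R = 0"
      using R Suc.prems proj_sub_iff [of R P] by (simp add: left_diff_distrib is_projD)
    ultimately show ?thesis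
      by (metis mult.assoc mult_zero_right)
  qed
  have RQ: "R * Q j = 0" if "j < n" for j
    using QR [OF that] Q that R A_commute by metis
  have eq: "(\<Sum>j<n. if j < n then Q j else R) = P - R"
    using Q(3) by simp
  show ?case
    by (rule exI [of _ "\<lambda>j. if j < n then Q j else R"]) (use Q R QR RQ eq in auto)
qed

text \<open>The \<open>v j\<close> carry \<open>Q 0\<close> onto the pieces \<open>Q j\<close>, and
  their Fourier combinations \<open>f s\<close> are again partial isometries with initial projection
  \<open>Q 0\<close>. Under \<open>E\<close> only the diagonal terms of
  \<open>f s * adj (f s)\<close> survive, each \<open>Q j\<close> with coefficient
  \<open>1 / n\<close>.\<close>

lemma flat_partition:
  assumes P: "P \<in> A" "is_proj P" and n: "0 < n"
  obtains r where "\<And>s. s < n \<Longrightarrow> r s \<in> N" "\<And>s. s < n \<Longrightarrow> is_proj (r s)"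
    "\<And>s t. s < n \<Longrightarrow> t < n \<Longrightarrow> s \<noteq> t \<Longrightarrow> r s * r t = 0" "(\<Sum>s<n. r s) = P"
    "\<And>s. s < n \<Longrightarrow> E (r s) = (1 / real n) *\<^sub>R P"
proof -
  obtain Q where Q: "\<And>j. j < n \<Longrightarrow> Q j \<in> A" "\<And>j. j < n \<Longrightarrow> is_proj (Q j)"
    "\<And>j. j < n \<Longrightarrow> tr (Q j) = tr P / real n"
    "\<And>i j. i < n \<Longrightarrow> j < n \<Longrightarrow> i \<noteq> j \<Longrightarrow> Q i * Q j = 0" "(\<Sum>j<n. Q j) = P"
    using equal_partition [OF P, of n "tr P / real n"] n tr_nonneg [OF A_sub_N [OF P(1)] pos_proj [OF P(2)]]
    by auto
  have "\<exists>v. v \<in> N \<and> adj v * v = Q 0 \<and> v * adj v = Q j" if "j < n" for j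
    using comparison [of "Q 0" "Q j"] Q that n by (metis A_sub_N)
  then obtain v where v: "\<And>j. j < n \<Longrightarrow> v j \<in> N" "\<And>j. j < n \<Longrightarrow> adj (v j) * v j = Q 0"
    "\<And>j. j < n \<Longrightarrow> v j * adj (v j) = Q j"
    by metis
  have Qv: "Q j * v j = v j" if "j < n" for j
  proof -
    have "v j * (adj (v j) * v j) = v j"
      by (rule partial_isometry_initial) (use v Q that n in simp)
    then show ?thesis
      using v(3) [OF that] by (simp add: mult.assoc [symmetric])
  qed
  have vQ: "adj (v j) * Q j = adj (v j)" if "j < n" for j
    using arg_cong [OF Qv [OF that], of adj] Q(2) [OF that] by (simp add: is_projD)
  have vv: "adj (v j) * v k = (if j = k then Q 0 else 0)" if "j < n" "k < n" for j k
  proof -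
    have "adj (v j) * v k = adj (v j) * (Q j * Q k) * v k"
      using vQ [OF that(1)] Qv [OF that(2)] by (metis mult.assoc)
    then show ?thesis
      using Q(4) [OF that] v(2) that by auto
  qed
  have Evv: "E (v j * adj (v k)) = (if j = k then Q j else 0)" if jk: "j < n" "k < n" for j k
  proof (cases "j = k")
    case True
    then show ?thesis
      using v(3) Q(1) jk by (simp add: E_fixes_A)
  next
    case False
    have "Q j * (v j * adj (v k)) * Q k = (Q j * v j) * (adj (v k) * Q k)"
      by (simp add: mult.assoc)
    then have "Q j * (v j * adj (v k)) * Q k = v j * adj (v k)"
      using Qv vQ jk by simp
    then show ?thesis
      using False Q jk v by (intro trans [OF E_offdiagonal]) (auto simp: N_intros)
  qed
  obtain u :: "nat \<Rightarrow> nat \<Rightarrow> complex" where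
    u: "\<And>s t. s < n \<Longrightarrow> t < n \<Longrightarrow> (\<Sum>j<n. cnj (u s j) * u t j) = (if s = t then 1 else 0)"
    "\<And>j k. j < n \<Longrightarrow> k < n \<Longrightarrow> (\<Sum>s<n. u s j * cnj (u s k)) = (if j = k then 1 else 0)"
    "\<And>s j. u s j * cnj (u s j) = 1 / of_nat n"
    using fourier_matrix [OF n] by blast
  define f where "f s = (\<Sum>j<n. u s j *\<^sub>C v j)" for s
  have fN: "f s \<in> N" for s
    unfolding f_def by (intro N_sum N_scaleC) (simp add: v)
  have ff: "adj (f s) * f t = (if s = t then Q 0 else 0)" if "s < n" "t < n" for s t
  proof -
    have "adj (f s) * f t = (\<Sum>j<n. \<Sum>k<n. (cnj (u s j) * u t k) *\<^sub>C (adj (v j) * v k))"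
      by (simp add: f_def adj_sum sum_product scaleC_mult scaleC_scaleC mult.commute)
    also have "\<dots> = (\<Sum>j<n. \<Sum>k<n. if j = k then (cnj (u s j) * u t k) *\<^sub>C Q 0 else 0)"
      by (intro sum.cong refl) (simp add: vv)
    also have "\<dots> = (\<Sum>j<n. cnj (u s j) * u t j) *\<^sub>C Q 0"
      by (simp add: scaleC_sum_left)
    finally show ?thesis
      using u(1) [OF that] by simp
  qed
  define r where "r s = f s * adj (f s)" for s
  have rsum: "r s = (\<Sum>j<n. \<Sum>k<n. (u s j * cnj (u s k)) *\<^sub>C (v j * adj (v k)))" for s
    by (simp add: r_def f_def adj_sum sum_product scaleC_mult scaleC_scaleC mult.commute)
  show ?thesis
  proof (rule that)
    show "r s \<in> N" for s
      by (simp add: r_def N_intros fN)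
    show "is_proj (r s)" if "s < n" for s
      unfolding r_def by (rule partial_isometry_final) (simp add: ff that Q n)
    show "r s * r t = 0" if "s < n" "t < n" "s \<noteq> t" for s t
    proof -
      have "r s * r t = f s * (adj (f s) * f t) * adj (f t)"
        by (simp add: r_def mult.assoc)
      then show ?thesis
        using ff that by simp
    qed
    show "(\<Sum>s<n. r s) = P"
    proof -
      have "(\<Sum>s<n. r s) = (\<Sum>j<n. \<Sum>k<n. (\<Sum>s<n. u s j * cnj (u s k)) *\<^sub>C (v j * adj (v k)))"
        unfolding rsum scaleC_sum_left
        by (subst sum.swap, rule sum.cong [OF refl], rule sum.swap)
      also have "\<dots> = (\<Sum>j<n. \<Sum>k<n. if j = k then Q j else 0)"
        by (intro sum.cong refl) (auto simp: u v)
      finally show ?thesis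
        using Q(5) by simp
    qed
    show "E (r s) = (1 / real n) *\<^sub>R P" if "s < n" for s
    proof -
      have "E (r s) = (\<Sum>j<n. \<Sum>k<n. (u s j * cnj (u s k)) *\<^sub>C E (v j * adj (v k)))"
      proof -
        have N: "v j * adj (v k) \<in> N" if "j \<in> {..<n}" "k \<in> {..<n}" for j k
          using that by (simp add: N_intros v)
        have "E (r s) = (\<Sum>j<n. E (\<Sum>k<n. (u s j * cnj (u s k)) *\<^sub>C (v j * adj (v k))))"
          unfolding rsum by (rule E_sum) (intro N_sum N_scaleC N)
        also have "\<dots> = (\<Sum>j<n. \<Sum>k<n. E ((u s j * cnj (u s k)) *\<^sub>C (v j * adj (v k))))"
          by (intro sum.cong refl E_sum N_scaleC N)
        finally show ?thesis
          by (simp add: E_scaleC N)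
      qed
      also have "\<dots> = (\<Sum>j<n. \<Sum>k<n. if j = k then (1 / of_nat n) *\<^sub>C Q j else 0)"
        by (intro sum.cong refl) (auto simp: Evv u)
      also have "\<dots> = (1 / of_nat n) *\<^sub>C P"
        using Q(5) by (simp add: scaleC_sum_right [symmetric])
      finally show ?thesis
        by (simp add: scaleR_scaleC)
    qed
  qed
qed

lemma flat_weighted:
  assumes P: "P \<in> A" "is_proj P" and n: "0 < n" and T: "finite T" "(\<Sum>t\<in>T. k t) = n"
  obtains r where "\<And>t. t \<in> T \<Longrightarrow> r t \<in> N" "\<And>t. t \<in> T \<Longrightarrow> is_proj (r t)"
    "\<And>s t. s \<in> T \<Longrightarrow> t \<in> T \<Longrightarrow> s \<noteq> t \<Longrightarrow> r s * r t = 0"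
    "\<And>t. t \<in> T \<Longrightarrow> r t * P = r t"
    "\<And>t. t \<in> T \<Longrightarrow> E (r t) = (real (k t) / real n) *\<^sub>R P"
proof -
  obtain q where q: "\<And>s. s < n \<Longrightarrow> q s \<in> N" "\<And>s. s < n \<Longrightarrow> is_proj (q s)"
    "\<And>s t. s < n \<Longrightarrow> t < n \<Longrightarrow> s \<noteq> t \<Longrightarrow> q s * q t = 0" "(\<Sum>s<n. q s) = P"
    "\<And>s. s < n \<Longrightarrow> E (q s) = (1 / real n) *\<^sub>R P"
    using flat_partition [OF P n] by metis
  \<comment> \<open>The slots to be filled: a bijection onto the \<open>n\<close> flat pieces gives
    the label \<open>t\<close> exactly \<open>k t\<close> of them.\<close>
  define I where "I = Sigma T (\<lambda>t. {..<k t})"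
  have "finite I" "card I = n"
    using T by (simp_all add: I_def)
  then obtain h where h: "bij_betw h I {..<n}"
    using ex_bij_betw_finite_nat [of I] by (auto simp: lessThan_atLeast0)
  have hI: "h (t, i) < n" if "t \<in> T" "i < k t" for t i
    using bij_betwE [OF h] that by (auto simp: I_def)
  have hinj: "h (t, i) \<noteq> h (s, j)" if "t \<in> T" "i < k t" "s \<in> T" "j < k s" "(t, i) \<noteq> (s, j)" for t i s j
    using inj_onD [OF bij_betw_imp_inj_on [OF h]] that by (auto simp: I_def)
  have qP: "q s * P = q s" if "s < n" for s
  proof -
    have "q s * P = (\<Sum>t<n. if t = s then q s else 0)"
      unfolding q(4) [symmetric] sum_distrib_left
      by (rule sum.cong) (use q that in \<open>auto simp: is_projD\<close>)
    then show ?thesis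
      using that by simp
  qed
  define r where "r t = (\<Sum>i<k t. q (h (t, i)))" for t
  show ?thesis
  proof (rule that)
    show "r t \<in> N" if "t \<in> T" for t
      unfolding r_def by (rule N_sum) (simp add: q hI that)
    show "is_proj (r t)" if "t \<in> T" for t
      unfolding r_def by (rule is_proj_sum) (auto simp: q hI hinj that)
    show "r s * r t = 0" if "s \<in> T" "t \<in> T" "s \<noteq> t" for s t
      unfolding r_def sum_product by (intro sum.neutral ballI) (simp add: q hI hinj that)
    show "r t * P = r t" if "t \<in> T" for t
      unfolding r_def sum_distrib_right by (rule sum.cong) (simp_all add: qP hI that)
    show "E (r t) = (real (k t) / real n) *\<^sub>R P" if "t \<in> T" for t
    proof -
      have "E (r t) = (\<Sum>i<k t. E (q (h (t, i))))"
        unfolding r_def by (rule E_sum) (simp add: q hI that)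
      also have "\<dots> = (\<Sum>i<k t. (1 / real n) *\<^sub>R P)"
        by (rule sum.cong) (simp_all add: q hI that)
      finally show ?thesis
        by (simp add: sum_constant_scaleR)
    qed
  qed
qed

text \<open>In the two by two matrix units given by \<open>w\<close> from \<open>x\<close> to
  \<open>y\<close>, this is the rank one projection with diagonal entries \<open>s\<close> and
  \<open>1 - s\<close>. Its off-diagonal entries lie between \<open>p\<close> and \<open>q\<close>,
  where \<open>E\<close> vanishes.\<close>

lemma rotation:
  assumes p: "p \<in> A" "is_proj p" and q: "q \<in> A" "is_proj q" and pq: "p * q = 0"
    and x: "x \<in> N" "is_proj x" "x * p = x" and y: "y \<in> N" "is_proj y" "y * q = y"
    and t: "tr x = tr y" and s: "0 \<le> s" "s \<le> 1"
  obtains z where "z \<in> N" "is_proj z" "z * (x + y) = z" "E z = s *\<^sub>R E x + (1 - s) *\<^sub>R E y"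
proof -
  obtain w where w: "w \<in> N" "adj w * w = x" "w * adj w = y"
    using comparison [OF x(1,2) y(1,2) t] by blast
  have qp: "q * p = 0"
    by (rule orth_commute [OF p(2) q(2) pq])
  have px: "p * x = x" and qy: "q * y = y"
    using x y p q proj_sub_iff by metis+
  have "y * x = y * (q * p) * x"
    using y(3) px by (metis mult.assoc)
  then have yx: "y * x = 0"
    by (simp add: qp)
  then have xy: "x * y = 0"
    by (rule orth_commute [OF y(2) x(2)])
  have wx: "w * x = w"
    using partial_isometry_initial [of w] w x by simp
  have yw: "y * w = w"
    using wx w by (metis mult.assoc)
  have xw': "x * adj w = adj w" and w'y: "adj w * y = adj w"
    using arg_cong [OF wx, of adj] arg_cong [OF yw, of adj] x y by (simp_all add: is_projD)
  have z1: "y * adj w = 0" "w * y = 0"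
    using yx xy wx xw' by (metis mult.assoc mult_zero_left mult_zero_right)+
  have Ew: "E w = 0"
  proof (rule E_offdiagonal [OF q(1) p(1) qp w(1)])
    show "q * w * p = w"
      using yw wx qy x(3) by (metis mult.assoc)
  qed
  have Ew': "E (adj w) = 0"
  proof (rule E_offdiagonal [OF p(1) q(1) pq N_adj [OF w(1)]])
    show "p * adj w * q = adj w"
      using xw' w'y px y(3) by (metis mult.assoc)
  qed
  \<comment> \<open>A partial isometry with initial projection \<open>y\<close>; the rotated
    projection is its final projection.\<close>
  define f where "f = sqrt (1 - s) *\<^sub>R y + sqrt s *\<^sub>R adj w"
  have rt: "sqrt (1 - s) * sqrt (1 - s) = 1 - s" "sqrt s * sqrt s = s"
    using s by simp_all
  have "adj f * f = (1 - s) *\<^sub>R y + s *\<^sub>R y"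
    using rt by (simp add: f_def distrib_left distrib_right is_projD [OF y(2)] z1 w)
  also have "\<dots> = y"
    by (simp add: scaleR_left_distrib [symmetric])
  finally have "is_proj (f * adj f)"
    by (intro partial_isometry_final) (simp add: y)
  moreover have "f * adj f = (1 - s) *\<^sub>R y + s *\<^sub>R x + (sqrt s * sqrt (1 - s)) *\<^sub>R (w + adj w)"
    using rt by (simp add: f_def distrib_left distrib_right is_projD [OF y(2)] yw w'y w
        scaleR_right_distrib mult.commute)
  then have "E (f * adj f) = (1 - s) *\<^sub>R E y + s *\<^sub>R E x"
    by (simp add: E_add E_scaleR N_intros x y w Ew Ew')
  moreover have "adj f * (x + y) = adj f"
    by (simp add: f_def distrib_left distrib_right is_projD [OF y(2)] yx wx z1)
  then have "f * adj f * (x + y) = f * adj f"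
    by (simp add: mult.assoc)
  moreover have "f * adj f \<in> N"
    by (simp add: f_def N_intros y w)
  ultimately show ?thesis
    using that by (simp add: add.commute)
qed

text \<open>Differences of a decreasing sequence whose traces halve. What the sum misses of
  \<open>P\<close> has trace at most \<open>tr P / 2 ^ n\<close> for every \<open>n\<close>, hence
  is zero because the trace is faithful.\<close>

lemma dyadic_partition:
  assumes P: "P \<in> A" "is_proj P"
  obtains p where "\<And>i. p i \<in> A" "\<And>i. is_proj (p i)" "\<And>i. p i * P = p i"
    "\<And>i j. i \<noteq> j \<Longrightarrow> p i * p j = 0" "\<And>i. tr (p i) = tr P / 2 ^ Suc i"
    "slim (\<lambda>n. \<Sum>i<n. p i) P"
proof -
  have ex: "\<exists>R. R \<in> A \<and> is_proj R \<and> R * Q = R \<and> tr R = tr Q / 2" if Q: "Q \<in> A" "is_proj Q" for Q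
  proof -
    have "0 \<le> tr Q"
      by (rule tr_nonneg [OF A_sub_N [OF Q(1)] pos_proj [OF Q(2)]])
    then show ?thesis
      using projection_with_trace [OF Q, of "tr Q / 2"] by auto
  qed
  then obtain F where F: "\<And>Q. Q \<in> A \<Longrightarrow> is_proj Q \<Longrightarrow> F Q \<in> A \<and> is_proj (F Q) \<and> F Q * Q = F Q \<and> tr (F Q) = tr Q / 2"
    by metis
  define Q where "Q n = (F ^^ n) P" for n
  have Q: "Q n \<in> A \<and> is_proj (Q n) \<and> tr (Q n) = tr P / 2 ^ n" for n
    by (induction n) (auto simp: Q_def P F)
  have QS: "Q (Suc n) * Q n = Q (Suc n)" for n
    using F Q [of n] by (simp add: Q_def)
  have mono: "Q (i + k) * Q i = Q (i + k)" for i k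
  proof (induction k)
    case (Suc k)
    then show ?case
      using QS [of "i + k"] by (metis add_Suc_right mult.assoc)
  qed (use Q in \<open>simp add: is_projD\<close>)
  define p where "p n = Q n - Q (Suc n)" for n
  have pA: "p n \<in> A" and pp: "is_proj (p n)" for n
    using Q QS by (simp_all add: p_def A_diff is_proj_diff)
  have pQ: "p j * Q i = p j" if "i \<le> j" for i j
  proof -
    have "Q j * Q i = Q j" "Q (Suc j) * Q i = Q (Suc j)"
      using mono [of i "j - i"] mono [of i "Suc j - i"] that by simp_all
    then show ?thesis
      by (simp add: p_def left_diff_distrib)
  qed
  have pQ0: "Q (Suc i) * p i = 0" for i
    using QS [of i] Q by (simp add: p_def right_diff_distrib is_projD)
  have "p j * p i = 0" if "i < j" for i j
    using pQ [of "Suc i" j] pQ0 [of i] that by (metis Suc_leI mult.assoc mult_zero_right)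
  then have orth: "p i * p j = 0" if "i \<noteq> j" for i j
    using that A_commute [OF pA pA] by (metis linorder_neqE_nat)
  have pP: "p i * P = p i" for i
    using pQ [of 0 i] by (simp add: Q_def)
  obtain s where s: "is_proj s" "slim (\<lambda>n. \<Sum>i<n. p i) s"
    using orth_proj_sum [of p] pp orth by metis
  have sA: "s \<in> A"
    by (rule A_slim [OF s(2)]) (simp add: A_sum pA)
  have sP: "s * P = s"
    by (rule slim_unique [OF _ s(2)])
      (use slim_mult_right [OF s(2), of P] in \<open>simp only: sum_distrib_right pP\<close>)
  have tele: "(\<Sum>i<n. p i) = P - Q n" for n
    by (induction n) (simp_all add: p_def, simp add: Q_def)
  have "tr P - tr s \<le> tr P / 2 ^ n" for n
  proof -
    have "(\<Sum>i<n. p i) * s = (\<Sum>i<n. p i)"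
    proof -
      have "p i * s = (\<Sum>j\<in>{i}. p i * p j)" for i
        by (rule slim_sum_finite [OF s(2)]) (auto simp: orth)
      then show ?thesis
        by (simp add: sum_distrib_right is_projD [OF pp])
    qed
    then have "tr (\<Sum>i<n. p i) \<le> tr s"
      by (intro tr_mono_proj) (auto simp: s sA pA A_sub_N A_sum is_proj_sum pp orth)
    then show ?thesis
      using Q [of n] P by (simp add: tele tr_simps A_sub_N)
  qed
  moreover have "(\<lambda>n. tr P / 2 ^ n) \<longlonglongrightarrow> 0"
    by (rule LIMSEQ_divide_realpow_zero) simp
  ultimately have "tr P - tr s \<le> 0"
    by (intro LIMSEQ_le_const [of "\<lambda>n. tr P / 2 ^ n" 0]) auto
  moreover have "tr s \<le> tr P"
    using tr_mono_proj [of s P] s sA sP P by (simp add: A_sub_N)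
  ultimately have "tr (P - s) = 0"
    using P sA by (simp add: tr_simps A_sub_N)
  then have "P - s = 0"
    using P s sA sP by (intro tr_eq_zero pos_proj is_proj_diff A_sub_N A_diff)
  then have "s = P"
    by simp
  moreover have "tr (p i) = tr P / 2 ^ Suc i" for i
    using Q [of i] Q [of "Suc i"] by (simp add: p_def tr_simps A_sub_N)
  ultimately show ?thesis
    using that [of p] pA pp pP orth s by blast
qed

text \<open>The core of the argument. Flat partitions only give rational expectations. To reach real
  weights \<open>c\<close>, cut \<open>P\<close> into \<open>p\<^sub>0, p\<^sub>1, \<dots> \<in> A\<close> with halving traces, colour flat pieces of each
  \<open>p\<^sub>i\<close>, and rotate a piece of \<open>p\<^sub>i\<close> not coloured \<open>l\<close>, of weight \<open>1/n\<close>, against a piece of \<open>p\<^sub>i\<^sub>+\<^sub>1\<close>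
  coloured \<open>l\<close>, of weight \<open>2/n\<close> and hence of the same trace. The error in \<open>p\<^sub>i\<close> is thereby passed
  on to \<open>p\<^sub>i\<^sub>+\<^sub>1\<close>. The sine squares \<open>\<sigma>\<^sub>i\<close> of the rotation angles and the number \<open>k\<^sub>i\<close> of further
  pieces coloured \<open>l\<close> solve \<open>n c = k\<^sub>i + 2 (1 - \<sigma>\<^sub>i) + \<sigma>\<^sub>i\<^sub>+\<^sub>1\<close>.\<close>

lemma carry_sequence:
  fixes x :: real
  assumes "3 \<le> x"
  obtains \<sigma> :: "nat \<Rightarrow> real" and k :: "nat \<Rightarrow> nat" where "\<sigma> 0 = 0" "\<And>i. 0 \<le> \<sigma> i" "\<And>i. \<sigma> i \<le> 1"
    "\<And>i. x = real (k i) + 2 * (1 - \<sigma> i) + \<sigma> (Suc i)" "\<And>i. real (k i) \<le> x"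
proof -
  \<comment> \<open>The required identity reads
    \<open>x + 2 * \<sigma> i = (k i + 2) + \<sigma> (Suc i)\<close>: the integer part yields
    \<open>k i\<close> and the fractional part the next \<open>\<sigma>\<close>. The bound
    \<open>3 \<le> x\<close> keeps \<open>k i\<close> nonnegative.\<close>
  define \<sigma> where "\<sigma> = rec_nat 0 (\<lambda>_ s. frac (x + 2 * s))"
  have S0: "\<sigma> 0 = 0" and SS: "\<sigma> (Suc i) = frac (x + 2 * \<sigma> i)" for i
    by (simp_all add: \<sigma>_def)
  have b: "0 \<le> \<sigma> i \<and> \<sigma> i < 1" for i
    by (cases i) (simp_all add: S0 SS frac_lt_1)
  define k where "k i = nat (\<lfloor>x + 2 * \<sigma> i\<rfloor> - 2)" for i
  have k: "real (k i) = of_int \<lfloor>x + 2 * \<sigma> i\<rfloor> - 2" for i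
  proof -
    have "3 \<le> \<lfloor>x + 2 * \<sigma> i\<rfloor>"
      using assms b [of i] by (simp add: le_floor_iff)
    then show ?thesis
      by (simp add: k_def)
  qed
  show ?thesis
  proof (rule that [of \<sigma> k])
    show "x = real (k i) + 2 * (1 - \<sigma> i) + \<sigma> (Suc i)" for i
      by (simp add: k SS frac_def)
    show "real (k i) \<le> x" for i
      using b [of i] of_int_floor_le [of "x + 2 * \<sigma> i"] unfolding k by linarith
  qed (use b S0 in \<open>auto intro: less_imp_le\<close>)
qed

text \<open>The strict inequality leaves slack: in each part a colour uses at most three pieces more
  than its share \<open>n * c l\<close>, and for large \<open>n\<close> these fit into
  \<open>n * (1 - (\<Sum>l\<in>L. c l))\<close>.\<close>

lemma scalar_expectation_projections:
  fixes c :: "'c \<Rightarrow> real"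
  assumes P: "P \<in> A" "is_proj P" and L: "finite L" "\<And>l. l \<in> L \<Longrightarrow> 0 < c l" "(\<Sum>l\<in>L. c l) < 1"
  obtains R where "\<And>l. l \<in> L \<Longrightarrow> R l \<in> N" "\<And>l. l \<in> L \<Longrightarrow> is_proj (R l)"
    "\<And>l. l \<in> L \<Longrightarrow> R l * P = R l"
    "\<And>l m. l \<in> L \<Longrightarrow> m \<in> L \<Longrightarrow> l \<noteq> m \<Longrightarrow> R l * R m = 0"
    "\<And>l. l \<in> L \<Longrightarrow> E (R l) = c l *\<^sub>R P"
proof -
  \<comment> \<open>The first bound is the hypothesis of \<open>carry_sequence\<close>, the second
    is the room for three extra pieces per colour.\<close>
  obtain n where n: "\<And>l. l \<in> L \<Longrightarrow> 3 \<le> real n * c l" "3 * real (card L) \<le> real n * (1 - (\<Sum>l\<in>L. c l))" "0 < n"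
  proof -
    define b where "b = (\<Sum>l\<in>L. 3 / c l) + 3 * real (card L) / (1 - (\<Sum>l\<in>L. c l)) + 1"
    obtain n where n: "b \<le> real n"
      using real_arch_simple by blast
    have nn: "0 \<le> (\<Sum>l\<in>L. 3 / c l)" "0 \<le> 3 * real (card L) / (1 - (\<Sum>l\<in>L. c l))"
      using L by (force intro: sum_nonneg less_imp_le) (use L in simp)
    have "3 \<le> real n * c l" if "l \<in> L" for l
    proof -
      have "3 / c l \<le> (\<Sum>l\<in>L. 3 / c l)"
        using L that by (intro member_le_sum) (auto intro: less_imp_le)
      then have "3 / c l \<le> real n"
        using n nn by (simp add: b_def)
      then show ?thesis
        using L(2) [OF that] by (simp add: divide_le_eq)
    qed
    moreover have "3 * real (card L) / (1 - (\<Sum>l\<in>L. c l)) \<le> real n"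
      using n nn by (simp add: b_def)
    then have "3 * real (card L) \<le> real n * (1 - (\<Sum>l\<in>L. c l))"
      using L(3) by (simp add: divide_le_eq)
    moreover have "0 < n"
    proof -
      have "1 \<le> b"
        using nn by (simp add: b_def)
      with n have "1 \<le> real n"
        by linarith
      then show ?thesis
        by simp
    qed
    ultimately show ?thesis
      using that by blast
  qed
  have "\<exists>\<sigma> k. \<sigma> 0 = (0::real) \<and> (\<forall>i::nat. 0 \<le> \<sigma> i \<and> \<sigma> i \<le> 1 \<and>
      real n * c l = real (k i) + 2 * (1 - \<sigma> i) + \<sigma> (Suc i) \<and> real (k i) \<le> real n * c l)" if "l \<in> L" for l
    using carry_sequence [OF n(1) [OF that]] by metis
  then obtain \<sigma> k where \<sigma>: "\<And>l. l \<in> L \<Longrightarrow> \<sigma> l 0 = (0::real)"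
    "\<And>l i. l \<in> L \<Longrightarrow> 0 \<le> \<sigma> l i" "\<And>l i. l \<in> L \<Longrightarrow> \<sigma> l i \<le> 1"
    and k: "\<And>l i. l \<in> L \<Longrightarrow> real n * c l = real (k l i) + 2 * (1 - \<sigma> l i) + \<sigma> l (Suc i)"
    "\<And>l i. l \<in> L \<Longrightarrow> real (k l i) \<le> real n * c l"
    by metis
  obtain p where p: "\<And>i. p i \<in> A" "\<And>i. is_proj (p i)" "\<And>i. p i * P = p i"
    "\<And>i j. i \<noteq> j \<Longrightarrow> p i * p j = 0" "\<And>i. tr (p i) = tr P / 2 ^ Suc i"
    "slim (\<lambda>n. \<Sum>i<n. p i) P"
    using dyadic_partition [OF P] by metis
  \<comment> \<open>Label \<open>(l, 0)\<close> is the single piece rotated against the next part,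
    \<open>(l, 1)\<close> the pair rotated against the previous part, and \<open>(l, 2)\<close>
    consists of the \<open>k l i\<close> pieces left alone.\<close>
  define K where "K i t = (if snd t = 2 then k (fst t) i else Suc (snd t))" for i and t :: "'c \<times> nat"
  have "\<exists>r. \<forall>t\<in>L \<times> {0,1,2::nat}. r t \<in> N \<and> is_proj (r t) \<and> r t * p i = r t \<and>
      E (r t) = (real (K i t) / real n) *\<^sub>R p i \<and>
      (\<forall>s\<in>L \<times> {0,1,2}. s \<noteq> t \<longrightarrow> r s * r t = 0)" for i
  proof -
    \<comment> \<open>\<open>None\<close> collects the pieces that no colour uses.\<close>
    define T where "T = insert None (Some ` (L \<times> {0,1,2::nat}))"
    define K' where "K' t = (case t of None \<Rightarrow> n - (\<Sum>t\<in>L \<times> {0,1,2}. K i t) | Some t \<Rightarrow> K i t)" for t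
    have "real (\<Sum>t\<in>L \<times> {0,1,2}. K i t) = (\<Sum>l\<in>L. 3 + real (k l i))"
    proof -
      have "(\<Sum>t\<in>L \<times> {0,1,2}. real (K i t)) = (\<Sum>l\<in>L. \<Sum>j\<in>{0,1,2}. real (K i (l, j)))"
        by (simp only: sum.cartesian_product split_def prod.collapse)
      then show ?thesis
        by (simp add: K_def)
    qed
    also have "\<dots> \<le> (\<Sum>l\<in>L. 3 + real n * c l)"
      using k(2) by (intro sum_mono) simp
    also have "\<dots> \<le> real n"
      using n(2) by (simp add: sum.distrib sum_distrib_left right_diff_distrib mult.commute)
    finally have le: "(\<Sum>t\<in>L \<times> {0,1,2}. K i t) \<le> n"
      by linarith
    have T: "finite T"
      using L by (simp add: T_def)
    have "(\<Sum>t\<in>T. K' t) = K' None + (\<Sum>t\<in>Some ` (L \<times> {0,1,2}). K' t)"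
      unfolding T_def using L by (subst sum.insert) auto
    also have "(\<Sum>t\<in>Some ` (L \<times> {0,1,2}). K' t) = (\<Sum>t\<in>L \<times> {0,1,2}. K i t)"
      by (subst sum.reindex) (auto simp: K'_def)
    finally have KT: "(\<Sum>t\<in>T. K' t) = n"
      using le by (simp add: K'_def)
    obtain r where "\<And>t. t \<in> T \<Longrightarrow> r t \<in> N" "\<And>t. t \<in> T \<Longrightarrow> is_proj (r t)"
      "\<And>s t. s \<in> T \<Longrightarrow> t \<in> T \<Longrightarrow> s \<noteq> t \<Longrightarrow> r s * r t = 0"
      "\<And>t. t \<in> T \<Longrightarrow> r t * p i = r t" "\<And>t. t \<in> T \<Longrightarrow> E (r t) = (real (K' t) / real n) *\<^sub>R p i"
      by (rule flat_weighted [OF p(1,2) n(3) T KT, of i]) blast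
    then show ?thesis
      by (intro exI [of _ "\<lambda>t. r (Some t)"]) (auto simp: T_def K'_def)
  qed
  then obtain r where r: "\<And>i. \<forall>t\<in>L \<times> {0,1,2::nat}. r i t \<in> N \<and> is_proj (r i t) \<and> r i t * p i = r i t \<and>
      E (r i t) = (real (K i t) / real n) *\<^sub>R p i \<and>
      (\<forall>s\<in>L \<times> {0,1,2}. s \<noteq> t \<longrightarrow> r i s * r i t = 0)"
    by metis
  have rN: "r i (l, t) \<in> N" and rp: "is_proj (r i (l, t))" and rpi: "r i (l, t) * p i = r i (l, t)"
    and rE: "E (r i (l, t)) = (real (K i (l, t)) / real n) *\<^sub>R p i"
    if "l \<in> L" "t \<in> {0,1,2}" for i l t
    using r [of i] that by auto
  have pir: "p j * r i (l, t) = (if i = j then r i (l, t) else 0)" if "l \<in> L" "t \<in> {0,1,2}" for i j l t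
  proof -
    have 1: "p i * r i (l, t) = r i (l, t)"
      using rpi [OF that] proj_sub_iff [OF rp [OF that] p(2)] by blast
    then have "p j * r i (l, t) = (p j * p i) * r i (l, t)"
      by (simp add: mult.assoc)
    then show ?thesis
      using 1 p(4) by auto
  qed
  have rr: "r i (l, t) * r j (m, s) = 0"
    if "l \<in> L" "t \<in> {0,1,2}" "m \<in> L" "s \<in> {0,1,2}" "i \<noteq> j \<or> l \<noteq> m \<or> t \<noteq> s" for i j l m t s
  proof (cases "i = j")
    case True
    then show ?thesis
      using r [of i] that by auto
  next
    case False
    have "r i (l, t) * r j (m, s) = r i (l, t) * (p i * r j (m, s))"
      using rpi [OF that(1,2)] by (simp add: mult.assoc [symmetric])
    then show ?thesis
      using False pir [OF that(3,4)] by simp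
  qed
  \<comment> \<open>One piece of \<open>p i\<close> against two of \<open>p (Suc i)\<close>: the
    traces agree because those of the parts halve.\<close>
  have rtr: "tr (r i (l, 0)) = tr (r (Suc i) (l, 1))" if "l \<in> L" for i l
  proof -
    have "tr (r i (l, t)) = real (K i (l, t)) / real n * (tr P / 2 ^ Suc i)" if "t \<in> {0,1,2}" for i t
      using tr_E [OF rN [OF \<open>l \<in> L\<close> that]] p by (simp add: rE [OF \<open>l \<in> L\<close> that] tr_simps A_sub_N)
    then show ?thesis
      by (simp add: K_def)
  qed
  have "\<exists>z. z \<in> N \<and> is_proj z \<and> z * (r i (l, 0) + r (Suc i) (l, 1)) = z \<and>
      E z = (\<sigma> l (Suc i) / real n) *\<^sub>R p i + ((1 - \<sigma> l (Suc i)) * 2 / real n) *\<^sub>R p (Suc i)"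
    if l: "l \<in> L" for i l
  proof -
    obtain z where "z \<in> N" "is_proj z" "z * (r i (l, 0) + r (Suc i) (l, 1)) = z"
      "E z = \<sigma> l (Suc i) *\<^sub>R E (r i (l, 0)) + (1 - \<sigma> l (Suc i)) *\<^sub>R E (r (Suc i) (l, 1))"
      by (rule rotation [of "p i" "p (Suc i)" "r i (l, 0)" "r (Suc i) (l, 1)" "\<sigma> l (Suc i)"])
        (use l p rN rp rpi rtr \<sigma> in auto)
    then show ?thesis
      using l by (auto simp: rE K_def)
  qed
  then obtain z where z: "\<And>l i. l \<in> L \<Longrightarrow> z l i \<in> N" "\<And>l i. l \<in> L \<Longrightarrow> is_proj (z l i)"
    "\<And>l i. l \<in> L \<Longrightarrow> z l i * (r i (l, 0) + r (Suc i) (l, 1)) = z l i"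
    "\<And>l i. l \<in> L \<Longrightarrow> E (z l i) = (\<sigma> l (Suc i) / real n) *\<^sub>R p i + ((1 - \<sigma> l (Suc i)) * 2 / real n) *\<^sub>R p (Suc i)"
    by metis
  \<comment> \<open>Index shift: \<open>u l (Suc j)\<close> is the rotation across
    \<open>p j\<close> and \<open>p (Suc j)\<close>. The first part has no predecessor, so its pair
    is kept whole, in accordance with \<open>\<sigma> l 0 = 0\<close>.\<close>
  define u where "u l i = (case i of 0 \<Rightarrow> r 0 (l, 1) | Suc j \<Rightarrow> z l j)" for l i
  \<comment> \<open>A projection above \<open>u l i\<close> composed of unrotated pieces, through
    which \<open>u\<close> inherits the orthogonality relations of \<open>r\<close>.\<close>
  define d where "d l i = (case i of 0 \<Rightarrow> r 0 (l, 1) | Suc j \<Rightarrow> r j (l, 0) + r (Suc j) (l, 1))" for l i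
  have uN: "u l i \<in> N" if "l \<in> L" for l i
    using z(1) [OF that] rN [OF that, of 1] by (cases i) (simp_all add: u_def)
  have up: "is_proj (u l i)" if "l \<in> L" for l i
    using z(2) [OF that] rp [OF that, of 1] by (cases i) (simp_all add: u_def)
  have ud: "u l i * d l i = u l i" if "l \<in> L" for l i
    using z(3) [OF that] is_projD(2) [OF rp [OF that, of 1]]
    by (cases i) (simp_all add: u_def d_def)
  have dp: "is_proj (d l i)" if "l \<in> L" for l i
    using that by (cases i) (auto simp: d_def rp rr intro!: is_proj_add)
  have du: "d l i * u l i = u l i" if "l \<in> L" for l i
    using ud [OF that] proj_sub_iff [OF up [OF that] dp [OF that]] by blast
  have rd: "r i (l, 2) * d m j = 0" "d m j * r i (l, 2) = 0" if "l \<in> L" "m \<in> L" for i j l m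
    using that by (cases j; simp add: d_def rr distrib_left distrib_right)+
  have dd: "d l i * d m j = 0" if "l \<in> L" "m \<in> L" "l \<noteq> m \<or> i \<noteq> j" for i j l m
    using that by (cases i; cases j) (auto simp: d_def rr distrib_left distrib_right)
  have ru1: "r i (l, 2) * u m j = 0" if "l \<in> L" "m \<in> L" for i j l m
  proof -
    have "r i (l, 2) * u m j = r i (l, 2) * d m j * u m j"
      by (simp only: mult.assoc du [OF that(2)])
    then show ?thesis
      by (simp add: rd(1) [OF that])
  qed
  have ru2: "u m j * r i (l, 2) = 0" if "l \<in> L" "m \<in> L" for i j l m
    by (rule orth_commute [OF rp up ru1]) (use that in simp_all)
  have uu: "u l i * u m j = 0" if "l \<in> L" "m \<in> L" "l \<noteq> m \<or> i \<noteq> j" for i j l m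
  proof -
    have "u l i * u m j = u l i * (d l i * d m j) * u m j"
      using ud [OF that(1), of i] du [OF that(2), of j] by (simp add: mult.assoc) (simp add: mult.assoc [symmetric])
    then show ?thesis
      by (simp add: dd [OF that])
  qed
  define g where "g l i = r i (l, 2) + u l i" for l i
  have gN: "g l i \<in> N" and gp: "is_proj (g l i)" if "l \<in> L" for l i
    using that by (auto simp: g_def N_add rN uN rp up ru1 intro!: is_proj_add)
  have gg: "g l i * g m j = 0" if "l \<in> L" "m \<in> L" "l \<noteq> m \<or> i \<noteq> j" for l m i j
    using that by (auto simp: g_def distrib_left distrib_right rr ru1 ru2 uu)
  have pz: "p j * g l i = 0" if "l \<in> L" "i \<notin> {j, Suc j}" for j l i
  proof -
    have "p j * d l i = 0"
      using that by (cases i) (auto simp: d_def pir distrib_left)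
    then have "p j * u l i = 0"
      using du [OF that(1), of i] by (metis mult.assoc mult_zero_left)
    then show ?thesis
      using that by (simp add: g_def distrib_left pir)
  qed
  have "\<exists>s. is_proj s \<and> slim (\<lambda>n. \<Sum>i<n. g l i) s" if "l \<in> L" for l
    using orth_proj_sum [of "g l"] gp [OF that] gg [OF that that] by metis
  then obtain R where R: "\<And>l. l \<in> L \<Longrightarrow> is_proj (R l)" "\<And>l. l \<in> L \<Longrightarrow> slim (\<lambda>n. \<Sum>i<n. g l i) (R l)"
    by metis
  have RN: "R l \<in> N" if "l \<in> L" for l
    by (rule N_slim [OF R(2) [OF that]]) (simp add: N_sum gN that)
  have rP: "r i (l, t) * P = r i (l, t)" if "l \<in> L" "t \<in> {0,1,2}" for i l t
    using rpi [OF that] p(3) by (metis mult.assoc)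
  have RP: "R l * P = R l" if l: "l \<in> L" for l
  proof (rule slim_unique [OF _ R(2) [OF l]])
    have "d l i * P = d l i" for i
      using l by (cases i) (simp_all add: d_def rP distrib_right)
    then have "u l i * P = u l i" for i
      using ud [OF l, of i] by (metis mult.assoc)
    then have "g l i * P = g l i" for i
      using l by (simp add: g_def rP distrib_right)
    then show "slim (\<lambda>n. \<Sum>i<n. g l i) (R l * P)"
      using slim_mult_right [OF R(2) [OF l], of P] by (simp add: sum_distrib_right)
  qed
  \<comment> \<open>Over \<open>p j\<close> only \<open>g l j\<close> and \<open>g l (Suc j)\<close>
    are visible. In units of \<open>1 / n\<close> they contribute the \<open>k l j\<close> untouched
    pieces, the remainder \<open>2 * (1 - \<sigma> l j)\<close> of the pair, and the share
    \<open>\<sigma> l (Suc j)\<close> of the rotation with the successor.\<close>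
  have Ep: "p j * E (R l) = c l *\<^sub>R p j" if l: "l \<in> L" for j l
  proof -
    have "p j * R l = (\<Sum>i\<in>{j, Suc j}. p j * g l i)"
      by (rule slim_sum_finite [OF R(2) [OF l]]) (use pz [OF l] in auto)
    then have "p j * E (R l) = E (p j * g l j + p j * g l (Suc j))"
      using E_mult_left [OF p(1) RN [OF l], of j] by simp
    then have 1: "p j * E (R l) = p j * E (g l j) + p j * E (g l (Suc j))"
      using l p by (simp add: E_add E_mult_left N_mult gN A_sub_N)
    have Eg: "E (g l i) = (real (k l i) / real n) *\<^sub>R p i + E (u l i)" for i
      using l by (simp add: g_def E_add rN uN rE K_def)
    have 2: "p j * E (u l j) = ((1 - \<sigma> l j) * 2 / real n) *\<^sub>R p j"
      using l p by (cases j) (simp_all add: u_def rE K_def z \<sigma> is_projD distrib_left)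
    have 3: "p j * E (u l (Suc j)) = (\<sigma> l (Suc j) / real n) *\<^sub>R p j"
      using l p by (simp add: u_def z is_projD distrib_left)
    have "p j * E (R l) = (real (k l j) / real n + (1 - \<sigma> l j) * 2 / real n + \<sigma> l (Suc j) / real n) *\<^sub>R p j"
      using p by (simp add: 1 Eg distrib_left 2 3 is_projD scaleR_left_distrib)
    also have "real (k l j) / real n + (1 - \<sigma> l j) * 2 / real n + \<sigma> l (Suc j) / real n = c l"
      using k(1) [OF l, of j] n(3) by (simp add: field_simps)
    finally show ?thesis .
  qed
  have ER: "E (R l) = c l *\<^sub>R P" if l: "l \<in> L" for l
  proof -
    \<comment> \<open>The parts sum strongly to \<open>P\<close>, so identities over the parts give
      the identity over \<open>P\<close>; the expectation itself is never taken through the infinite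
      sum.\<close>
    have "p j * (E (R l) - c l *\<^sub>R P) = 0" for j
      by (simp add: right_diff_distrib Ep [OF l] p)
    then have "P * (E (R l) - c l *\<^sub>R P) = 0"
      by (rule slim_sum_orth_zero' [OF p(6)])
    moreover have "P * E (R l) = E (R l)"
      using E_mult_left [OF P(1) RN [OF l]] RP [OF l] proj_sub_iff [OF R(1) [OF l] P(2)] by simp
    ultimately show ?thesis
      by (simp add: right_diff_distrib is_projD [OF P(2)])
  qed
  have RR: "R l * R m = 0" if "l \<in> L" "m \<in> L" "l \<noteq> m" for l m
  proof (rule slim_sum_orth_zero [OF R(2) [OF that(2)]])
    show "R l * g m i = 0" for i
      by (rule slim_sum_orth_zero' [OF R(2) [OF that(1)]]) (rule gg, use that in auto)
  qed
  show ?thesis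
    by (rule that [of R]) (simp_all add: RN R RP RR ER)
qed

text \<open>One colour of positive weight plays no role in the rotations: it receives what is left of \<open>P\<close>.\<close>

theorem scalar_expectation_partition:
  fixes c :: "'c \<Rightarrow> real"
  assumes P: "P \<in> A" "is_proj P" and L: "finite L" "\<And>l. l \<in> L \<Longrightarrow> 0 \<le> c l" "(\<Sum>l\<in>L. c l) = 1"
  obtains R where "\<And>l. l \<in> L \<Longrightarrow> R l \<in> N" "\<And>l. l \<in> L \<Longrightarrow> is_proj (R l)"
    "\<And>l. l \<in> L \<Longrightarrow> R l * P = R l"
    "\<And>l m. l \<in> L \<Longrightarrow> m \<in> L \<Longrightarrow> l \<noteq> m \<Longrightarrow> R l * R m = 0"
    "\<And>l. l \<in> L \<Longrightarrow> E (R l) = c l *\<^sub>R P" "(\<Sum>l\<in>L. R l) = P"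
proof -
  obtain h where h: "h \<in> L" "0 < c h"
    using L by (metis less_eq_real_def sum.neutral zero_neq_one)
  define L0 where "L0 = {l \<in> L. 0 < c l} - {h}"
  have L0: "finite L0" "h \<notin> L0" "L0 \<subseteq> L"
    using L by (auto simp: L0_def)
  have "(\<Sum>l\<in>L. c l) = (\<Sum>l\<in>insert h L0. c l)"
    by (rule sum.mono_neutral_right) (use L h in \<open>auto simp: L0_def less_eq_real_def\<close>)
  then have sum: "(\<Sum>l\<in>L0. c l) = 1 - c h"
    using L(3) L0 by simp
  obtain Q where Q: "\<And>l. l \<in> L0 \<Longrightarrow> Q l \<in> N" "\<And>l. l \<in> L0 \<Longrightarrow> is_proj (Q l)"
    "\<And>l. l \<in> L0 \<Longrightarrow> Q l * P = Q l"
    "\<And>l m. l \<in> L0 \<Longrightarrow> m \<in> L0 \<Longrightarrow> l \<noteq> m \<Longrightarrow> Q l * Q m = 0"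
    "\<And>l. l \<in> L0 \<Longrightarrow> E (Q l) = c l *\<^sub>R P"
    by (rule scalar_expectation_projections [OF P L0(1), of c])
      (use h sum in \<open>auto simp: L0_def\<close>)
  define S where "S = (\<Sum>l\<in>L0. Q l)"
  have S: "S \<in> N" "is_proj S" "S * P = S"
    using Q L0 by (auto simp: S_def sum_distrib_right intro!: N_sum is_proj_sum)
  have SQ: "S * Q l = Q l" if "l \<in> L0" for l
  proof -
    have "S * Q l = (\<Sum>m\<in>L0. if m = l then Q l else 0)"
      unfolding S_def sum_distrib_right by (rule sum.cong) (use Q that in \<open>auto simp: is_projD\<close>)
    then show ?thesis
      using that L0 by simp
  qed
  have PQ: "P * Q l = Q l" if "l \<in> L0" for l
    using proj_sub_iff [OF Q(2) [OF that] P(2)] Q(3) [OF that] by simp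
  have hQ: "(P - S) * Q l = 0" if "l \<in> L0" for l
    by (simp add: left_diff_distrib SQ PQ that)
  have PS: "is_proj (P - S)"
    by (rule is_proj_diff [OF P(2) S(2,3)])
  have Qh: "Q l * (P - S) = 0" if "l \<in> L0" for l
    by (rule orth_commute [OF PS Q(2) [OF that] hQ [OF that]])
  have ES: "E S = (1 - c h) *\<^sub>R P"
    by (simp add: S_def E_sum Q scaleR_left.sum [symmetric] sum)
  \<comment> \<open>Colours of weight zero receive the zero projection.\<close>
  define R where "R l = (if l = h then P - S else if l \<in> L0 then Q l else 0)" for l
  have c0: "c l = 0" if "l \<in> L" "l \<noteq> h" "l \<notin> L0" for l
    using that L(2) [OF that(1)] by (auto simp: L0_def)
  show ?thesis
  proof (rule that [of R])
    show "R l \<in> N" for l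
      using P S Q by (simp add: R_def N_diff A_sub_N)
    show "is_proj (R l)" for l
      using PS Q by (simp add: R_def)
    show "R l * P = R l" for l
      using P S Q by (simp add: R_def left_diff_distrib is_projD)
    show "R l * R m = 0" if "l \<noteq> m" for l m
      using that Q hQ Qh by (auto simp: R_def)
    show "E (R l) = c l *\<^sub>R P" if "l \<in> L" for l
    proof -
      have "E (P - S) = E P - E S"
        using E_add [of "P - S" S] P S by (simp add: N_diff A_sub_N)
      then show ?thesis
        using c0 [OF that] Q P by (simp add: R_def ES E_fixes_A scaleR_left_diff_distrib)
    qed
    have "(\<Sum>l\<in>L. R l) = (\<Sum>l\<in>insert h L0. R l)"
      by (rule sum.mono_neutral_right) (use L h L0 in \<open>auto simp: R_def\<close>)
    also have "\<dots> = P - S + (\<Sum>l\<in>L0. R l)"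
      using L0 by (simp add: R_def)
    also have "(\<Sum>l\<in>L0. R l) = S"
      unfolding S_def by (rule sum.cong) (use L0 in \<open>auto simp: R_def\<close>)
    finally show "(\<Sum>l\<in>L. R l) = P"
      by simp
  qed
qed

end


section \<open>Finite joint spectra\<close>

lemma blinfun_apply_Rep_cop: "blinfun_apply (Rep_cop x) \<xi> = x \<rhd> \<xi>"
  by (simp add: app.rep_eq)

lemma Rep_cop_simps:
  "Rep_cop (x + y) = Rep_cop x + Rep_cop y" "Rep_cop (x - y) = Rep_cop x - Rep_cop y"
  "Rep_cop (x * y) = Rep_cop x o\<^sub>L Rep_cop y" "Rep_cop (c *\<^sub>C x) = c *\<^sub>C Rep_cop x"
  "Rep_cop 1 = id_blinfun" "Rep_cop 0 = 0"
  by (simp_all add: plus_cop.rep_eq minus_cop.rep_eq times_cop.rep_eq scaleC_cop.rep_eq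
      one_cop.rep_eq zero_cop.rep_eq)

text \<open>Inner products determine an operator, so the definite description in \<open>cadj\<close>
  resolves to the adjoint constructed from the Riesz theorem.\<close>

lemma cadj_Rep_cop: "cadj (Rep_cop x) = Rep_cop (adj x)"
  unfolding cadj_def
proof (rule the_equality)
  show "\<forall>\<xi> \<eta>. cinner (blinfun_apply (Rep_cop x) \<xi>) \<eta> = cinner \<xi> (blinfun_apply (Rep_cop (adj x)) \<eta>)"
    by (simp add: blinfun_apply_Rep_cop cinner_adj_right)
  fix s assume "\<forall>\<xi> \<eta>. cinner (blinfun_apply (Rep_cop x) \<xi>) \<eta> = cinner \<xi> (blinfun_apply s \<eta>)"
  then show "s = Rep_cop (adj x)"
    by (intro blinfun_eqI cinner_ext) (simp add: blinfun_apply_Rep_cop cinner_adj_right)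
qed

lemma cbounded_ops_cases: "T \<in> cbounded_ops \<Longrightarrow> \<exists>x. T = Rep_cop x"
  by (metis Abs_cop_inverse)

lemma hermitian_op_Rep_cop: "hermitian_op (Rep_cop x) \<longleftrightarrow> adj x = x"
  by (simp add: hermitian_op_def cadj_Rep_cop Rep_cop_inject Rep_cop)

lemma positive_op_Rep_cop: "positive_op (Rep_cop x) \<longleftrightarrow> pos x"
  by (simp add: positive_op_def pos_def blinfun_apply_Rep_cop Rep_cop)

lemma projection_op_Rep_cop: "projection_op (Rep_cop x) \<longleftrightarrow> is_proj x"
  by (simp add: projection_op_def is_proj_def hermitian_op_Rep_cop Rep_cop_simps(3) [symmetric]
      Rep_cop_inject)

section \<open>Approximate eigenvectors and characters\<close>

definition approx_eigenvalue :: "(nat \<Rightarrow> 'h::chilbert_space) \<Rightarrow> 'h cop \<Rightarrow> complex \<Rightarrow> bool"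
  where "approx_eigenvalue \<xi> x c \<longleftrightarrow> (\<lambda>n. (x \<rhd> \<xi> n) - c *\<^sub>C \<xi> n) \<longlonglongrightarrow> 0"

lemma approx_eigenvalue_add:
  assumes "approx_eigenvalue \<xi> x c" "approx_eigenvalue \<xi> y d"
  shows "approx_eigenvalue \<xi> (x + y) (c + d)"
  using tendsto_add [OF assms [unfolded approx_eigenvalue_def]]
  by (simp add: approx_eigenvalue_def app_add_left scaleC_add_left algebra_simps)

lemma approx_eigenvalue_scaleC:
  assumes "approx_eigenvalue \<xi> x c" shows "approx_eigenvalue \<xi> (d *\<^sub>C x) (d * c)"
  using bounded_linear.tendsto [OF bounded_linear_scaleC assms [unfolded approx_eigenvalue_def], of d]
  by (simp add: approx_eigenvalue_def app_scaleC_left scaleC_diff_right scaleC_scaleC)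

lemma approx_eigenvalue_one: "approx_eigenvalue \<xi> 1 1"
  by (simp add: approx_eigenvalue_def)

lemma approx_eigenvalue_mult:
  assumes "approx_eigenvalue \<xi> x c" "approx_eigenvalue \<xi> y d"
  shows "approx_eigenvalue \<xi> (x * y) (c * d)"
proof -
  have "(\<lambda>n. (x \<rhd> ((y \<rhd> \<xi> n) - d *\<^sub>C \<xi> n)) + d *\<^sub>C ((x \<rhd> \<xi> n) - c *\<^sub>C \<xi> n)) \<longlonglongrightarrow> (x \<rhd> 0) + d *\<^sub>C 0"
    using assms unfolding approx_eigenvalue_def
    by (intro tendsto_add bounded_linear.tendsto [OF bounded_linear_app]
        bounded_linear.tendsto [OF bounded_linear_scaleC])
  then show ?thesis
    by (simp add: approx_eigenvalue_def app_mult app_diff_right app_scaleC_right scaleC_diff_right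
        scaleC_scaleC mult.commute)
qed

text \<open>Evaluation at unit vectors far along the sequence. The estimate is the source of the
  uniqueness of the scalar and of its norm continuity in the operator.\<close>

lemma approx_eigenvalue_bound:
  assumes \<xi>: "\<And>n. norm (\<xi> n) = 1" and x: "approx_eigenvalue \<xi> x c" shows "cmod c \<le> norm x"
proof (rule field_le_epsilon)
  fix e :: real assume "e > 0"
  then obtain n where n: "norm ((x \<rhd> \<xi> n) - c *\<^sub>C \<xi> n) < e"
    using LIMSEQ_D [OF x [unfolded approx_eigenvalue_def], of e] by auto
  have "cmod c = norm (c *\<^sub>C \<xi> n)"
    by (simp add: norm_scaleC \<xi>)
  also have "\<dots> \<le> norm (x \<rhd> \<xi> n) + norm ((x \<rhd> \<xi> n) - c *\<^sub>C \<xi> n)"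
    using norm_triangle_ineq4 [of "x \<rhd> \<xi> n" "(x \<rhd> \<xi> n) - c *\<^sub>C \<xi> n"] by simp
  also have "\<dots> \<le> norm x + e"
    using norm_app [of x "\<xi> n"] n by (simp add: \<xi>)
  finally show "cmod c \<le> norm x + e" .
qed

lemma approx_eigenvalue_diff:
  assumes "approx_eigenvalue \<xi> x c" "approx_eigenvalue \<xi> y d"
  shows "approx_eigenvalue \<xi> (x - y) (c - d)"
proof -
  have "x - y = x + (-1) *\<^sub>C y"
    by simp
  then show ?thesis
    using approx_eigenvalue_add [OF assms(1) approx_eigenvalue_scaleC [OF assms(2), of "-1"]]
    by (simp only:) simp
qed

lemma approx_eigenvalue_unique:
  assumes "\<And>n. norm (\<xi> n) = 1" "approx_eigenvalue \<xi> x c" "approx_eigenvalue \<xi> x d" shows "c = d"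
  using approx_eigenvalue_bound [OF assms(1) approx_eigenvalue_diff [OF assms(2,3)]] by simp

text \<open>Differences of the scalars are bounded by differences of the operators, so they form a
  Cauchy sequence; the limit is checked with three errors of size \<open>e / 3\<close>.\<close>

lemma approx_eigenvalue_limit:
  assumes \<xi>: "\<And>n. norm (\<xi> n) = 1" and x: "\<And>k. approx_eigenvalue \<xi> (x k) (c k)" and l: "x \<longlonglongrightarrow> l"
  obtains d where "approx_eigenvalue \<xi> l d" "c \<longlonglongrightarrow> d"
proof -
  have "Cauchy c"
  proof (rule metric_CauchyI)
    fix e :: real assume "e > 0"
    then obtain M where "\<forall>m\<ge>M. \<forall>n\<ge>M. dist (x m) (x n) < e"
      using metric_CauchyD [OF LIMSEQ_imp_Cauchy [OF l]] by blast
    moreover have "dist (c m) (c n) \<le> dist (x m) (x n)" for m n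
      using approx_eigenvalue_bound [OF \<xi> approx_eigenvalue_diff [OF x [of m] x [of n]]]
      by (simp add: dist_norm)
    ultimately show "\<exists>M. \<forall>m\<ge>M. \<forall>n\<ge>M. dist (c m) (c n) < e"
      by (meson le_less_trans)
  qed
  then obtain d where d: "c \<longlonglongrightarrow> d"
    using Cauchy_convergent_iff convergent_def by blast
  have "approx_eigenvalue \<xi> l d"
    unfolding approx_eigenvalue_def
  proof (rule LIMSEQ_I)
    fix e :: real assume e: "e > 0"
    obtain k where k: "norm (x k - l) < e / 3" "norm (c k - d) < e / 3"
    proof -
      obtain a b where "\<forall>n\<ge>a. norm (x n - l) < e / 3" "\<forall>n\<ge>b. norm (c n - d) < e / 3"
        using LIMSEQ_D [OF l, of "e/3"] LIMSEQ_D [OF d, of "e/3"] e by auto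
      then show ?thesis
        using that [of "max a b"] by simp
    qed
    obtain M where M: "\<And>n. n \<ge> M \<Longrightarrow> norm ((x k \<rhd> \<xi> n) - c k *\<^sub>C \<xi> n) < e / 3"
      using LIMSEQ_D [OF x [of k, unfolded approx_eigenvalue_def], of "e/3"] e by auto
    have "norm ((l \<rhd> \<xi> n) - d *\<^sub>C \<xi> n) < e" if "n \<ge> M" for n
    proof -
      have "(l \<rhd> \<xi> n) - d *\<^sub>C \<xi> n =
          (((x k \<rhd> \<xi> n) - c k *\<^sub>C \<xi> n) - ((x k - l) \<rhd> \<xi> n)) + (c k - d) *\<^sub>C \<xi> n"
        by (simp add: app_diff_left scaleC_diff_left)
      also have "norm \<dots> \<le> norm ((x k \<rhd> \<xi> n) - c k *\<^sub>C \<xi> n) + norm ((x k - l) \<rhd> \<xi> n) + norm ((c k - d) *\<^sub>C \<xi> n)"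
        by (meson norm_triangle_ineq norm_triangle_ineq4 add_right_mono order_trans)
      also have "\<dots> < e / 3 + e / 3 + e / 3"
        using M [OF that] norm_app [of "x k - l" "\<xi> n"] k by (simp add: norm_scaleC \<xi>)
      finally show ?thesis
        by simp
    qed
    then show "\<exists>M. \<forall>n\<ge>M. norm ((l \<rhd> \<xi> n) - d *\<^sub>C \<xi> n - 0) < e"
      by auto
  qed
  then show ?thesis
    using that d by blast
qed

text \<open>Along an approximate joint eigenvector, the operators acting asymptotically by a scalar
  form a C*-algebra, and the scalar is a character of it.\<close>

lemma joint_spectrumI:
  fixes S :: "'n::finite \<Rightarrow> 'h::chilbert_space cop" and l :: "'n \<Rightarrow> real"
  assumes \<xi>: "\<And>n. norm (\<xi> n) = 1" and S: "\<And>i. adj (S i) = S i"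
    and l: "\<And>i. approx_eigenvalue \<xi> (S i) (complex_of_real (l i))"
  shows "(\<chi> i. complex_of_real (l i)) \<in> joint_spectrum (\<lambda>i. Rep_cop (S i))"
proof -
  \<comment> \<open>The condition on \<open>adj x\<close> is imposed separately, because an
    approximate eigenvector of \<open>x\<close> need not be one of \<open>adj x\<close>.\<close>
  define B where "B = Rep_cop ` {x. \<exists>c. approx_eigenvalue \<xi> x c \<and> approx_eigenvalue \<xi> (adj x) (cnj c)}"
  have star: "star_subalgebra B"
    unfolding star_subalgebra_def
  proof (intro conjI ballI allI)
    show "B \<subseteq> cbounded_ops"
      by (auto simp: B_def Rep_cop)
    have "approx_eigenvalue \<xi> 0 0"
      by (simp add: approx_eigenvalue_def)
    then show "0 \<in> B"
      unfolding B_def by (intro image_eqI [of _ _ 0]) (auto simp: Rep_cop_simps)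
    fix x assume "x \<in> B"
    then obtain x' c where x: "x = Rep_cop x'" "approx_eigenvalue \<xi> x' c" "approx_eigenvalue \<xi> (adj x') (cnj c)"
      by (auto simp: B_def)
    show "d *\<^sub>C x \<in> B" for d
      unfolding B_def using approx_eigenvalue_scaleC [OF x(2), of d] approx_eigenvalue_scaleC [OF x(3), of "cnj d"]
      by (intro image_eqI [of _ _ "d *\<^sub>C x'"]) (auto simp: Rep_cop_simps x(1))
    show "cadj x \<in> B"
      unfolding B_def using x by (intro image_eqI [of _ _ "adj x'"]) (auto simp: cadj_Rep_cop intro!: exI [of _ "cnj c"])
    fix y assume "y \<in> B"
    then obtain y' d where y: "y = Rep_cop y'" "approx_eigenvalue \<xi> y' d" "approx_eigenvalue \<xi> (adj y') (cnj d)"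
      by (auto simp: B_def)
    show "x + y \<in> B"
      unfolding B_def using approx_eigenvalue_add [OF x(2) y(2)] approx_eigenvalue_add [OF x(3) y(3)]
      by (intro image_eqI [of _ _ "x' + y'"]) (auto simp: Rep_cop_simps x(1) y(1) intro!: exI [of _ "c + d"])
    show "x o\<^sub>L y \<in> B"
      unfolding B_def using approx_eigenvalue_mult [OF x(2) y(2)] approx_eigenvalue_mult [OF y(3) x(3)]
      by (intro image_eqI [of _ _ "x' * y'"])
        (auto simp: Rep_cop_simps x(1) y(1) mult.commute intro!: exI [of _ "c * d"])
  qed
  have clo: "closed B"
    unfolding closed_sequential_limits
  proof (intro allI impI, elim conjE)
    fix T L assume TB: "\<forall>k. T k \<in> B" and lim: "T \<longlonglongrightarrow> L"
    then obtain x c where x: "\<And>k. T k = Rep_cop (x k)" "\<And>k. approx_eigenvalue \<xi> (x k) (c k)"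
      "\<And>k. approx_eigenvalue \<xi> (adj (x k)) (cnj (c k))"
      unfolding B_def image_iff by (simp add: Bex_def) metis
    have "L \<in> cbounded_ops"
      by (rule closed_sequentially [OF closed_cbounded_ops _ lim]) (simp add: x Rep_cop)
    then obtain y where y: "L = Rep_cop y"
      using cbounded_ops_cases by blast
    have "x \<longlonglongrightarrow> y"
      using lim by (simp add: lim_sequentially x y dist_cop_def norm_cop.rep_eq Rep_cop_simps dist_norm)
    then obtain d where d: "approx_eigenvalue \<xi> y d" "c \<longlonglongrightarrow> d"
      using approx_eigenvalue_limit [of \<xi> x c y, OF \<xi> x(2)] by blast
    obtain d' where d': "approx_eigenvalue \<xi> (adj y) d'" "(\<lambda>k. cnj (c k)) \<longlonglongrightarrow> d'"
      using approx_eigenvalue_limit [of \<xi> "\<lambda>k. adj (x k)" "\<lambda>k. cnj (c k)" "adj y",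
          OF \<xi> x(3) tendsto_adj [OF \<open>x \<longlonglongrightarrow> y\<close>]] by blast
    have "(\<lambda>k. cnj (c k)) \<longlonglongrightarrow> cnj d"
      using d(2) by (rule tendsto_cnj)
    then have "d' = cnj d"
      using d'(2) LIMSEQ_unique by blast
    then show "L \<in> B"
      unfolding B_def y using d(1) d'(1) by blast
  qed
  have id: "id_blinfun \<in> B"
    unfolding B_def
    by (intro image_eqI [of _ _ 1]) (auto simp: Rep_cop_simps approx_eigenvalue_one intro!: exI [of _ 1])
  have SB: "range (\<lambda>i. Rep_cop (S i)) \<subseteq> B"
    unfolding B_def using l S by (auto intro!: image_eqI [OF refl] exI)
  have sub: "cstar_generated (range (\<lambda>i. Rep_cop (S i))) \<subseteq> B"
    unfolding cstar_generated_def using star clo id SB by blast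
  \<comment> \<open>The choice is harmless: on \<open>B\<close> the scalar exists and is
    unique.\<close>
  define \<gamma> where "\<gamma> T = (SOME c. approx_eigenvalue \<xi> (Abs_cop T) c)" for T
  have \<gamma>: "\<gamma> (Rep_cop x) = c" if "approx_eigenvalue \<xi> x c" for x c
    unfolding \<gamma>_def Rep_cop_inverse
    by (rule approx_eigenvalue_unique [OF \<xi> someI [of "approx_eigenvalue \<xi> x"]]) (rule that)+
  have Bcases: "\<exists>y c. T = Rep_cop y \<and> approx_eigenvalue \<xi> y c"
    if "T \<in> cstar_generated (range (\<lambda>i. Rep_cop (S i)))" for T
    using subsetD [OF sub that] by (auto simp: B_def)
  have "algebra_character (cstar_generated (range (\<lambda>i. Rep_cop (S i)))) \<gamma>"
    unfolding algebra_character_def clinear_on_def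
  proof (intro conjI ballI allI)
    show "\<gamma> id_blinfun = 1"
      using \<gamma> [OF approx_eigenvalue_one] by (simp add: Rep_cop_simps)
    fix x assume "x \<in> cstar_generated (range (\<lambda>i. Rep_cop (S i)))"
    then obtain x' c where x: "x = Rep_cop x'" "approx_eigenvalue \<xi> x' c"
      using Bcases by blast
    show "\<gamma> (d *\<^sub>C x) = d *\<^sub>C \<gamma> x" for d
      using \<gamma> [OF approx_eigenvalue_scaleC [OF x(2)]] \<gamma> [OF x(2)]
      by (simp add: Rep_cop_simps x(1) scaleC_complex_def)
    fix y assume "y \<in> cstar_generated (range (\<lambda>i. Rep_cop (S i)))"
    then obtain y' d where y: "y = Rep_cop y'" "approx_eigenvalue \<xi> y' d"
      using Bcases by blast
    show "\<gamma> (x + y) = \<gamma> x + \<gamma> y"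
      using \<gamma> [OF approx_eigenvalue_add [OF x(2) y(2)]] \<gamma> [OF x(2)] \<gamma> [OF y(2)]
      by (simp add: Rep_cop_simps x(1) y(1))
    show "\<gamma> (x o\<^sub>L y) = \<gamma> x * \<gamma> y"
      using \<gamma> [OF approx_eigenvalue_mult [OF x(2) y(2)]] \<gamma> [OF x(2)] \<gamma> [OF y(2)]
      by (simp add: Rep_cop_simps x(1) y(1))
  qed
  moreover have "(\<chi> i. complex_of_real (l i)) = (\<chi> i. \<gamma> (Rep_cop (S i)))"
    by (simp add: \<gamma> [OF l])
  ultimately show ?thesis
    unfolding joint_spectrum_def by blast
qed

section \<open>Localization of commuting hermitian operators\<close>

lemma norm_split_projection:
  assumes f: "is_proj f" and y: "y * f = f * y" and c: "0 \<le> c" "norm (y * f) \<le> c" "norm (y * (1 - f)) \<le> c"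
  shows "norm y \<le> c"
proof (rule norm_cop_bound [OF c(1)])
  fix \<xi>
  \<comment> \<open>Each of the two orthogonal components grows at most by the factor
    \<open>c\<close>; Pythagoras recombines them.\<close>
  have le: "(norm (g \<rhd> (y \<rhd> \<xi>)))\<^sup>2 \<le> c\<^sup>2 * (norm (g \<rhd> \<xi>))\<^sup>2"
    if g: "is_proj g" "y * g = g * y" "norm (y * g) \<le> c" for g
  proof -
    have "g \<rhd> (y \<rhd> \<xi>) = (y * g) \<rhd> (g \<rhd> \<xi>)"
      by (metis app_mult g(1,2) is_projD(2) mult.assoc)
    then have "norm (g \<rhd> (y \<rhd> \<xi>)) \<le> c * norm (g \<rhd> \<xi>)"
      using norm_app [of "y * g" "g \<rhd> \<xi>"] g(3)
      by (smt (verit, best) mult_right_mono norm_ge_zero)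
    then show ?thesis
      using power_mono [of _ _ 2] by (fastforce simp: power_mult_distrib)
  qed
  have "(norm (y \<rhd> \<xi>))\<^sup>2 \<le> c\<^sup>2 * (norm (f \<rhd> \<xi>))\<^sup>2 + c\<^sup>2 * (norm ((1 - f) \<rhd> \<xi>))\<^sup>2"
    using le [OF f y c(2)] le [OF is_proj_compl [OF f] _ c(3)] y
    by (subst proj_pythagoras [OF f]) (simp add: algebra_simps)
  also have "\<dots> = (c * norm \<xi>)\<^sup>2"
    using proj_pythagoras [OF f, of \<xi>] by (simp add: power_mult_distrib distrib_left)
  finally show "norm (y \<rhd> \<xi>) \<le> c * norm \<xi>"
    by (rule power2_le_imp_le) (simp add: c(1))
qed

lemma norm_proj_le: "is_proj p \<Longrightarrow> norm p \<le> 1"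
  by (rule norm_cop_bound) (simp_all add: norm_proj_app)

lemma commute_mult:
  fixes t x y :: "'a::semigroup_mult"
  assumes "t * x = x * t" "t * y = y * t" shows "t * (x * y) = x * y * t"
proof -
  have "t * (x * y) = x * (t * y)"
    using assms(1) by (simp add: mult.assoc [symmetric])
  then show ?thesis
    by (simp add: assms(2) mult.assoc)
qed

lemma pos_mult_projection: "pos z \<Longrightarrow> is_proj g \<Longrightarrow> g * z = z * g \<Longrightarrow> pos (g * z)"
  using pos_conj [of z g] by (simp add: is_projD mult.assoc)

lemma is_proj_mult: "is_proj p \<Longrightarrow> is_proj q \<Longrightarrow> p * q = q * p \<Longrightarrow> is_proj (p * q)"
  by (simp add: is_proj_def) (metis mult.assoc)

text \<open>Bisection: the spectral projection of \<open>s\<close> at the midpoint splits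
  \<open>e\<close>, and by \<open>norm_split_projection\<close> the operator \<open>y\<close> keeps
  its norm on one of the halves. The commutation clause is what allows the step to be
  repeated.\<close>

lemma localize_step:
  fixes s y e :: "'h::chilbert_space cop" and a d :: real
  assumes s: "adj s = s" and ys: "y * s = s * y" and e: "is_proj e" "e * s = s * e" "e * y = y * e"
    and lo: "pos (e * (s - a *\<^sub>R 1))" and hi: "pos (e * ((a + d) *\<^sub>R 1 - s))"
  shows "\<exists>e' a'. is_proj e' \<and> e * e' = e' \<and> norm (y * e) \<le> norm (y * e') \<and>
    (\<forall>t. t * s = s * t \<longrightarrow> t * e = e * t \<longrightarrow> t * e' = e' * t) \<and>
    pos (e' * (s - a' *\<^sub>R 1)) \<and> pos (e' * ((a' + d / 2) *\<^sub>R 1 - s))"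
proof -
  let ?m = "a + d / 2"
  have "adj (s - ?m *\<^sub>R 1) = s - ?m *\<^sub>R 1"
    by (simp add: s)
  then obtain f where f: "is_proj f" "\<And>t. t * (s - ?m *\<^sub>R 1) = (s - ?m *\<^sub>R 1) * t \<Longrightarrow> t * f = f * t"
    "pos (f * (s - ?m *\<^sub>R 1))" "pos (- ((1 - f) * (s - ?m *\<^sub>R 1)))"
    using spectral_projection by blast
  have fcom: "t * f = f * t" if "t * s = s * t" for t
    by (rule f(2)) (simp add: algebra_simps that)
  have fs: "f * s = s * f" and fe: "e * f = f * e" and fy: "y * f = f * y"
    using fcom [of s] fcom [of e] fcom [of y] e ys by auto
  \<comment> \<open>Common end of both cases: \<open>g\<close> is the half that is kept,
    \<open>f\<close> or \<open>1 - f\<close>, and \<open>b\<close> is the left end of the new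
    interval.\<close>
  have step: ?thesis
    if g: "is_proj g" "\<And>t. t * s = s * t \<Longrightarrow> t * g = g * t" "norm (y * e) \<le> norm (y * (e * g))"
    and p: "pos (g * (e * (s - b *\<^sub>R 1)))" "pos (g * (e * ((b + d / 2) *\<^sub>R 1 - s)))" for g b
  proof -
    have ge: "e * g = g * e"
      by (rule g(2) [OF e(2)])
    have "t * (e * g) = e * g * t" if "t * s = s * t" "t * e = e * t" for t
      using g(2) [OF that(1)] that(2) by (metis mult.assoc)
    moreover have "e * (e * g) = e * g"
      by (rule proj_absorb [OF e(1)])
    ultimately show ?thesis
      using g(3) p is_proj_mult [OF e(1) g(1) ge]
      by (intro exI [of _ "e * g"] exI [of _ b]) (simp add: ge mult.assoc)
  qed
  have es: "e * (s - b *\<^sub>R 1) = (s - b *\<^sub>R 1) * e" "e * (b *\<^sub>R 1 - s) = (b *\<^sub>R 1 - s) * e" for b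
    by (simp_all add: algebra_simps e)
  have gz: "g * (e * z) = e * z * g" if "e * g = g * e" "g * z = z * g" for g z
    using that by (metis mult.assoc)
  have zg: "e * (g * z) = g * z * e" if "e * g = g * e" "e * z = z * e" for g z
    using that by (metis mult.assoc)
  show ?thesis
  proof (cases "norm (y * e) \<le> norm (y * (e * f))")
    case True
    show ?thesis
    proof (rule step [OF f(1) fcom True, of ?m])
      have "pos (e * (f * (s - ?m *\<^sub>R 1)))"
        by (rule pos_mult_projection [OF f(3) e(1) zg [OF fe es(1)]])
      then show "pos (f * (e * (s - ?m *\<^sub>R 1)))"
        by (simp only: mult.assoc [symmetric] fe)
      have "f * ((a + d) *\<^sub>R 1 - s) = ((a + d) *\<^sub>R 1 - s) * f"
        by (simp add: algebra_simps fs)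
      then have "pos (f * (e * ((a + d) *\<^sub>R 1 - s)))"
        by (intro pos_mult_projection hi f(1) gz fe)
      moreover have "?m + d / 2 = a + d"
        by simp
      ultimately show "pos (f * (e * ((?m + d / 2) *\<^sub>R 1 - s)))"
        by (simp only:)
    qed
  next
    case False
    have fc: "t * (1 - f) = (1 - f) * t" if "t * s = s * t" for t
      using fcom [OF that] by (simp add: algebra_simps)
    have "norm (y * e) \<le> max (norm (y * e * f)) (norm (y * e * (1 - f)))"
      by (rule norm_split_projection [OF f(1)]) (auto simp: mult.assoc fe fy intro: max.coboundedI1, metis fe fy mult.assoc)
    then have n: "norm (y * e) \<le> norm (y * (e * (1 - f)))"
      using False by (auto simp: mult.assoc max_def split: if_splits)
    show ?thesis
    proof (rule step [OF is_proj_compl [OF f(1)] fc n, of a])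
      have "(1 - f) * (s - a *\<^sub>R 1) = (s - a *\<^sub>R 1) * (1 - f)"
        by (simp add: algebra_simps fs)
      then show "pos ((1 - f) * (e * (s - a *\<^sub>R 1)))"
        by (intro pos_mult_projection lo is_proj_compl f(1) gz fc e)
      have "pos (e * ((1 - f) * (?m *\<^sub>R 1 - s)))"
      proof (rule pos_mult_projection [OF _ e(1) zg [OF fc [OF e(2)] es(2)]])
        show "pos ((1 - f) * (?m *\<^sub>R 1 - s))"
          using f(4) by (simp add: right_diff_distrib)
      qed
      then show "pos ((1 - f) * (e * (?m *\<^sub>R 1 - s)))"
        by (simp only: mult.assoc [symmetric] fc [OF e(2)])
    qed
  qed
qed

text \<open>Bisection starts from the interval between \<open>- K\<close> and \<open>K\<close> with
  \<open>K = norm s\<close> and stops at length at most \<open>\<epsilon>\<close>;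
  \<open>norm_hermitian_bound\<close> turns the order bounds into the norm bound.\<close>

lemma localize_single:
  fixes s y e :: "'h::chilbert_space cop"
  assumes s: "adj s = s" and ys: "y * s = s * y" and e: "is_proj e" "e * s = s * e" "e * y = y * e"
    and \<epsilon>: "0 < \<epsilon>"
  shows "\<exists>e' a. is_proj e' \<and> e * e' = e' \<and> norm (y * e) \<le> norm (y * e') \<and>
    (\<forall>t. t * s = s * t \<longrightarrow> t * e = e * t \<longrightarrow> t * e' = e' * t) \<and> norm ((s - a *\<^sub>R 1) * e') \<le> \<epsilon>"
proof -
  define K where "K = norm s"
  have bisect: "\<exists>e' a. is_proj e' \<and> e * e' = e' \<and> norm (y * e) \<le> norm (y * e') \<and>
    (\<forall>t. t * s = s * t \<longrightarrow> t * e = e * t \<longrightarrow> t * e' = e' * t) \<and>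
    pos (e' * (s - a *\<^sub>R 1)) \<and> pos (e' * ((a + 2 * K / 2 ^ n) *\<^sub>R 1 - s))" for n
  proof (induction n)
    case 0
    have "pos (s - (- K) *\<^sub>R 1)" "pos (K *\<^sub>R 1 - s)"
    proof -
      have b: "\<bar>Re (cinner \<xi> (s \<rhd> \<xi>))\<bar> \<le> K * (norm \<xi>)\<^sup>2" for \<xi>
        unfolding K_def by (rule Re_cinner_bound)
      show "pos (s - (- K) *\<^sub>R 1)"
        by (rule pos_hermitianI) (use b in \<open>auto simp: s app_diff_left app_add_left app_scaleR_left cinner_add_right
            cinner_diff_right cinner_scaleR_right cinner_self abs_le_iff simp del: of_real_power, smt (verit)\<close>)
      show "pos (K *\<^sub>R 1 - s)"
        by (rule pos_hermitianI) (use b in \<open>auto simp: s app_diff_left app_scaleR_left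
            cinner_diff_right cinner_scaleR_right cinner_self abs_le_iff simp del: of_real_power\<close>)
    qed
    moreover have "e * (s - (- K) *\<^sub>R 1) = (s - (- K) *\<^sub>R 1) * e" "e * (K *\<^sub>R 1 - s) = (K *\<^sub>R 1 - s) * e"
      by (simp_all add: algebra_simps e)
    ultimately have "pos (e * (s - (- K) *\<^sub>R 1))" "pos (e * (K *\<^sub>R 1 - s))"
      using pos_mult_projection e(1) by blast+
    then have "pos (e * (s - (- K) *\<^sub>R 1))" "pos (e * ((- K + 2 * K / 2 ^ 0) *\<^sub>R 1 - s))"
      by simp_all
    then show ?case
      using e by (intro exI [of _ e] exI [of _ "- K"]) (auto simp: is_projD)
  next
    case (Suc n)
    then obtain e1 a where e1: "is_proj e1" "e * e1 = e1" "norm (y * e) \<le> norm (y * e1)"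
      "\<And>t. t * s = s * t \<Longrightarrow> t * e = e * t \<Longrightarrow> t * e1 = e1 * t"
      "pos (e1 * (s - a *\<^sub>R 1))" "pos (e1 * ((a + 2 * K / 2 ^ n) *\<^sub>R 1 - s))"
      by blast
    have "e1 * s = s * e1" "e1 * y = y * e1"
      using e1(4) [of s] e1(4) [of y] e ys by auto
    from localize_step [OF s ys e1(1) this e1(5,6)] obtain e2 a2 where e2: "is_proj e2" "e1 * e2 = e2"
      "norm (y * e1) \<le> norm (y * e2)"
      "\<And>t. t * s = s * t \<Longrightarrow> t * e1 = e1 * t \<Longrightarrow> t * e2 = e2 * t"
      "pos (e2 * (s - a2 *\<^sub>R 1))" "pos (e2 * ((a2 + 2 * K / 2 ^ n / 2) *\<^sub>R 1 - s))"
      by blast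
    have "e * e2 = e2"
      using e1(2) e2(2) by (metis mult.assoc)
    then show ?case
      using e1 e2 by (intro exI [of _ e2] exI [of _ a2]) (auto simp: divide_divide_eq_left mult.commute)
  qed
  obtain n where n: "2 * K / 2 ^ n \<le> \<epsilon>"
  proof -
    have "(\<lambda>n. 2 * K / 2 ^ n) \<longlonglongrightarrow> 0"
      by (rule LIMSEQ_divide_realpow_zero) simp
    then obtain n0 where "norm (2 * K / 2 ^ n0 - 0) < \<epsilon>"
      using LIMSEQ_D [OF _ \<epsilon>] by blast
    then show ?thesis
      by (intro that [of n0]) (simp add: K_def)
  qed
  obtain e' a where e': "is_proj e'" "e * e' = e'" "norm (y * e) \<le> norm (y * e')"
    "\<forall>t. t * s = s * t \<longrightarrow> t * e = e * t \<longrightarrow> t * e' = e' * t"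
    "pos (e' * (s - a *\<^sub>R 1))" "pos (e' * ((a + 2 * K / 2 ^ n) *\<^sub>R 1 - s))"
    using bisect [of n] by blast
  have es: "e' * s = s * e'"
    using e'(4) e by metis
  have "norm ((s - a *\<^sub>R 1) * e') \<le> 2 * K / 2 ^ n"
  proof (rule norm_hermitian_bound)
    show "adj ((s - a *\<^sub>R 1) * e') = (s - a *\<^sub>R 1) * e'"
      by (simp add: s is_projD [OF e'(1)] algebra_simps es)
    show "0 \<le> 2 * K / 2 ^ n"
      by (simp add: K_def)
    fix \<xi>
    have eq: "(s - a *\<^sub>R 1) * e' = e' * (s - a *\<^sub>R 1)"
      by (simp add: algebra_simps es)
    have 1: "0 \<le> Re (cinner \<xi> ((e' * (s - a *\<^sub>R 1)) \<rhd> \<xi>))"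
      using e'(5) by (simp add: pos_iff)
    have "e' * (s - a *\<^sub>R 1) = (2 * K / 2 ^ n) *\<^sub>R e' - e' * ((a + 2 * K / 2 ^ n) *\<^sub>R 1 - s)"
      by (simp add: algebra_simps)
    then have "Re (cinner \<xi> ((e' * (s - a *\<^sub>R 1)) \<rhd> \<xi>)) =
        2 * K / 2 ^ n * (norm (e' \<rhd> \<xi>))\<^sup>2 - Re (cinner \<xi> ((e' * ((a + 2 * K / 2 ^ n) *\<^sub>R 1 - s)) \<rhd> \<xi>))"
      by (simp only: app_diff_left app_scaleR_left cinner_diff_right cinner_scaleR_right
          cinner_proj [OF e'(1)] minus_complex.simps of_real_mult [symmetric] Re_complex_of_real)
    also have "\<dots> \<le> 2 * K / 2 ^ n * (norm (e' \<rhd> \<xi>))\<^sup>2"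
      using e'(6) by (simp add: pos_iff)
    also have "\<dots> \<le> 2 * K / 2 ^ n * (norm \<xi>)\<^sup>2"
      using norm_proj_app [OF e'(1), of \<xi>] by (intro mult_left_mono power_mono) (auto simp: K_def)
    finally show "\<bar>Re (cinner \<xi> (((s - a *\<^sub>R 1) * e') \<rhd> \<xi>))\<bar> \<le> 2 * K / 2 ^ n * (norm \<xi>)\<^sup>2"
      using 1 by (simp only: eq)
  qed
  then show ?thesis
    using e' n by (intro exI [of _ e'] exI [of _ a]) auto
qed

text \<open>One operator at a time. Earlier estimates survive, since a further cut by a projection
  does not increase a norm, and \<open>e\<close> keeps commuting with \<open>y\<close> and with all
  \<open>S i\<close>.\<close>

lemma localize_tuple:
  fixes S :: "'n \<Rightarrow> 'h::chilbert_space cop"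
  assumes S: "\<And>i. adj (S i) = S i" "\<And>i j. S i * S j = S j * S i" and y: "\<And>i. y * S i = S i * y"
    and I: "finite I" and \<epsilon>: "0 < \<epsilon>"
  shows "\<exists>e. is_proj e \<and> norm y \<le> norm (y * e) \<and> (\<forall>t. (\<forall>i. t * S i = S i * t) \<longrightarrow> t * e = e * t) \<and>
    (\<forall>i\<in>I. \<exists>a::real. norm ((S i - a *\<^sub>R 1) * e) \<le> \<epsilon>)"
  using I
proof (induction I rule: finite_induct)
  case empty
  then show ?case by (intro exI [of _ 1]) auto
next
  case (insert i I)
  then obtain e where e: "is_proj e" "norm y \<le> norm (y * e)"
    "\<And>t. \<forall>i. t * S i = S i * t \<Longrightarrow> t * e = e * t" "\<forall>i\<in>I. \<exists>a::real. norm ((S i - a *\<^sub>R 1) * e) \<le> \<epsilon>"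
    by blast
  have "e * S i = S i * e" "e * y = y * e"
    using e(3) [of "S i"] e(3) [of y] S y by auto
  from localize_single [OF S(1) y e(1) this \<epsilon>] obtain e' a where e': "is_proj e'" "e * e' = e'"
    "norm (y * e) \<le> norm (y * e')" "\<And>t. t * S i = S i * t \<Longrightarrow> t * e = e * t \<Longrightarrow> t * e' = e' * t"
    "norm ((S i - a *\<^sub>R 1) * e') \<le> \<epsilon>"
    by blast
  have "\<exists>a::real. norm ((S j - a *\<^sub>R 1) * e') \<le> \<epsilon>" if j: "j \<in> I" for j
  proof -
    obtain b where b: "norm ((S j - b *\<^sub>R 1) * e) \<le> \<epsilon>"
      using bspec [OF e(4) j] by blast
    have "norm ((S j - b *\<^sub>R 1) * e') = norm ((S j - b *\<^sub>R 1) * e * e')"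
      using e'(2) by (simp add: mult.assoc)
    also have "\<dots> \<le> norm ((S j - b *\<^sub>R 1) * e) * norm e'"
      by (rule norm_mult_ineq)
    also have "\<dots> \<le> \<epsilon> * 1"
      using b norm_proj_le [OF e'(1)] \<epsilon> by (intro mult_mono) auto
    finally show ?thesis
      by auto
  qed
  then show ?case
    using e e' by (intro exI [of _ e']) (auto intro: order_trans)
qed

text \<open>Unit vectors are taken from the ranges of finer and finer localizing projections, where
  \<open>y\<close> keeps at least half of its norm. The approximate values stay bounded, so they
  converge along a subsequence.\<close>

lemma approx_joint_eigenvector:
  fixes S :: "'n::finite \<Rightarrow> 'h::chilbert_space cop"
  assumes S: "\<And>i. adj (S i) = S i" "\<And>i j. S i * S j = S j * S i" and y: "\<And>i. y * S i = S i * y"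
    and y0: "y \<noteq> 0"
  obtains \<xi> :: "nat \<Rightarrow> 'h" and l :: "'n \<Rightarrow> real" where "\<And>n. norm (\<xi> n) = 1"
    "\<And>n. norm y / 2 \<le> norm (y \<rhd> \<xi> n)" "\<And>i. approx_eigenvalue \<xi> (S i) (complex_of_real (l i))"
proof -
  have "\<exists>\<xi> (a :: real ^ 'n). norm \<xi> = 1 \<and> norm y / 2 \<le> norm (y \<rhd> \<xi>) \<and>
      (\<forall>i. norm ((S i \<rhd> \<xi>) - (a $ i) *\<^sub>R \<xi>) \<le> 1 / real (Suc n))" for n
  proof -
    obtain e where e: "is_proj e" "norm y \<le> norm (y * e)"
      "\<forall>i. \<exists>a::real. norm ((S i - a *\<^sub>R 1) * e) \<le> 1 / real (Suc n)"
      using localize_tuple [of S y UNIV "1 / real (Suc n)", OF S y] by auto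
    then obtain a :: "'n \<Rightarrow> real" where a: "\<And>i. norm ((S i - a i *\<^sub>R 1) * e) \<le> 1 / real (Suc n)"
      by metis
    \<comment> \<open>The norm need not be attained; half of it is exceeded by some vector.\<close>
    have "\<exists>\<eta>. norm y / 2 * norm \<eta> < norm ((y * e) \<rhd> \<eta>)"
    proof (rule ccontr)
      assume "\<not> ?thesis"
      then have "norm (y * e) \<le> norm y / 2"
        by (intro norm_cop_bound) (auto simp: not_less)
      moreover have "0 < norm y"
        using y0 by simp
      ultimately show False
        using e(2) by linarith
    qed
    then obtain \<eta> where \<eta>: "norm y / 2 * norm \<eta> < norm (y \<rhd> (e \<rhd> \<eta>))"
      by (auto simp: app_mult)
    define \<zeta> where "\<zeta> = e \<rhd> \<eta>"
    have "\<zeta> \<noteq> 0"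
    proof
      assume "\<zeta> = 0"
      then have "norm y / 2 * norm \<eta> < 0"
        using \<eta> by (simp add: \<zeta>_def)
      moreover have "0 \<le> norm y / 2 * norm \<eta>"
        by simp
      ultimately show False
        by linarith
    qed
    then have \<zeta>: "0 < norm \<zeta>"
      by simp
    have \<zeta>\<eta>: "norm \<zeta> \<le> norm \<eta>"
      unfolding \<zeta>_def by (rule norm_proj_app [OF e(1)])
    have e\<zeta>: "e \<rhd> \<zeta> = \<zeta>"
      by (simp add: \<zeta>_def app_mult [symmetric] is_projD [OF e(1)])
    define \<xi> where "\<xi> = (1 / norm \<zeta>) *\<^sub>R \<zeta>"
    have "norm y / 2 * norm \<zeta> \<le> norm (y \<rhd> \<zeta>)"
      using \<eta> mult_left_mono [OF \<zeta>\<eta>, of "norm y / 2"] by (simp add: \<zeta>_def)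
    then have "norm y / 2 \<le> norm (y \<rhd> \<xi>)"
      using \<zeta> by (simp add: \<xi>_def app_scaleR_right pos_le_divide_eq)
    moreover have n1: "norm \<xi> = 1"
      using \<zeta> by (simp add: \<xi>_def)
    moreover have "norm ((S i \<rhd> \<xi>) - a i *\<^sub>R \<xi>) \<le> 1 / real (Suc n)" for i
    proof -
      have "e \<rhd> \<xi> = \<xi>"
        by (simp add: \<xi>_def app_scaleR_right e\<zeta>)
      then have "(S i \<rhd> \<xi>) - a i *\<^sub>R \<xi> = ((S i - a i *\<^sub>R 1) * e) \<rhd> \<xi>"
        by (simp add: app_mult app_diff_left app_scaleR_left)
      then show ?thesis
        using norm_app [of "(S i - a i *\<^sub>R 1) * e" \<xi>] a [of i] n1 by simp
    qed
    ultimately show ?thesis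
      by (intro exI [of _ \<xi>] exI [of _ "\<chi> i. a i"]) simp
  qed
  then obtain \<xi> :: "nat \<Rightarrow> 'h" and a :: "nat \<Rightarrow> real ^ 'n" where \<xi>: "\<And>n. norm (\<xi> n) = 1"
    "\<And>n. norm y / 2 \<le> norm (y \<rhd> \<xi> n)"
    "\<And>n i. norm ((S i \<rhd> \<xi> n) - (a n $ i) *\<^sub>R \<xi> n) \<le> 1 / real (Suc n)"
    by metis
  have ab: "\<bar>a n $ i\<bar> \<le> norm (S i) + 1" for n i
  proof -
    have "\<bar>a n $ i\<bar> = norm ((S i \<rhd> \<xi> n) - ((S i \<rhd> \<xi> n) - (a n $ i) *\<^sub>R \<xi> n))"
      by (simp add: \<xi>)
    also have "\<dots> \<le> norm (S i \<rhd> \<xi> n) + norm ((S i \<rhd> \<xi> n) - (a n $ i) *\<^sub>R \<xi> n)"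
      by (rule norm_triangle_ineq4)
    also have "\<dots> \<le> norm (S i) * 1 + 1 / real (Suc n)"
      using norm_app [of "S i" "\<xi> n"] \<xi>(1) [of n] \<xi>(3) [of i n] by simp
    also have "1 / real (Suc n) \<le> 1"
      by simp
    finally show ?thesis
      by simp
  qed
  have "norm (a n) \<le> (\<Sum>i\<in>UNIV. norm (S i) + 1)" for n
    using norm_le_l1_cart [of "a n"] sum_mono [of UNIV "\<lambda>i. \<bar>a n $ i\<bar>" "\<lambda>i. norm (S i) + 1"] ab
    by (meson order_trans)
  then have "bounded (range a)"
    by (auto simp: bounded_iff)
  then obtain L r where r: "strict_mono (r::nat \<Rightarrow> nat)" and L: "(a \<circ> r) \<longlonglongrightarrow> L"
    using bounded_imp_convergent_subsequence by blast
  have "approx_eigenvalue (\<xi> \<circ> r) (S i) (complex_of_real (L $ i))" for i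
    unfolding approx_eigenvalue_def
  proof (rule Lim_null_comparison)
    have "(\<lambda>n. 1 / real (Suc n)) \<longlonglongrightarrow> 0"
      using LIMSEQ_inverse_real_of_nat by (simp add: inverse_eq_divide)
    then have 1: "(\<lambda>n. 1 / real (Suc (r n))) \<longlonglongrightarrow> 0"
      using LIMSEQ_subseq_LIMSEQ [OF _ r] by (fastforce simp: o_def)
    have "(\<lambda>n. \<bar>(a \<circ> r) n $ i - L $ i\<bar>) \<longlonglongrightarrow> \<bar>L $ i - L $ i\<bar>"
      by (intro tendsto_intros tendsto_vec_nth L)
    then show "(\<lambda>n. 1 / real (Suc (r n)) + \<bar>(a \<circ> r) n $ i - L $ i\<bar>) \<longlonglongrightarrow> 0"
      using tendsto_add [OF 1] by fastforce
    have "norm ((S i \<rhd> (\<xi> \<circ> r) n) - complex_of_real (L $ i) *\<^sub>C (\<xi> \<circ> r) n)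
        \<le> 1 / real (Suc (r n)) + \<bar>(a \<circ> r) n $ i - L $ i\<bar>" for n
    proof -
      have "(S i \<rhd> \<xi> (r n)) - complex_of_real (L $ i) *\<^sub>C \<xi> (r n) =
          ((S i \<rhd> \<xi> (r n)) - (a (r n) $ i) *\<^sub>R \<xi> (r n)) + (a (r n) $ i - L $ i) *\<^sub>R \<xi> (r n)"
        by (simp add: scaleR_scaleC [symmetric] scaleR_left_diff_distrib)
      then have "norm ((S i \<rhd> \<xi> (r n)) - complex_of_real (L $ i) *\<^sub>C \<xi> (r n))
          \<le> norm ((S i \<rhd> \<xi> (r n)) - (a (r n) $ i) *\<^sub>R \<xi> (r n)) + norm ((a (r n) $ i - L $ i) *\<^sub>R \<xi> (r n))"
        by (simp only: norm_triangle_ineq)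
      also have "\<dots> \<le> 1 / real (Suc (r n)) + \<bar>(a \<circ> r) n $ i - L $ i\<bar>"
        using \<xi>(3) [of i "r n"] by (intro add_mono) (simp_all add: \<xi>(1))
      finally show ?thesis
        by simp
    qed
    then show "\<forall>\<^sub>F n in sequentially. norm ((S i \<rhd> (\<xi> \<circ> r) n) - complex_of_real (L $ i) *\<^sub>C (\<xi> \<circ> r) n)
        \<le> 1 / real (Suc (r n)) + \<bar>(a \<circ> r) n $ i - L $ i\<bar>"
      by (simp add: always_eventually)
  qed
  then show ?thesis
    using that [of "\<xi> \<circ> r" "\<lambda>i. L $ i"] \<xi> by simp
qed

section \<open>Spectral partitions of commuting tuples\<close>

lemma finite_spectrum_annihilated:
  fixes S :: "'n::finite \<Rightarrow> 'h::chilbert_space cop"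
  assumes S: "\<And>i. adj (S i) = S i" "\<And>i j. S i * S j = S j * S i"
    and fin: "finite (joint_spectrum (\<lambda>i. Rep_cop (S i)))"
  obtains vs :: "real list" where "distinct vs" "prod_list (map (\<lambda>v. S i - v *\<^sub>R 1) vs) = 0"
proof -
  define V where "V = (\<lambda>x. Re (x $ i)) ` joint_spectrum (\<lambda>i. Rep_cop (S i))"
  obtain vs where vs: "distinct vs" "set vs = V"
    using finite_distinct_list [of V] fin by (auto simp: V_def)
  define y where "y = prod_list (map (\<lambda>v. S i - v *\<^sub>R 1) vs)"
  have com: "prod_list (map (\<lambda>v. S i - v *\<^sub>R 1) us) * S j = S j * prod_list (map (\<lambda>v. S i - v *\<^sub>R 1) us)" for us j
  proof (induction us)
    case (Cons u us)
    have "(S i - u *\<^sub>R 1) * S j = S j * (S i - u *\<^sub>R 1)"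
      by (simp add: algebra_simps S)
    then show ?case
      using commute_mult [of "S j"] Cons by simp
  qed simp
  \<comment> \<open>Otherwise there is an approximate joint eigenvector along which \<open>y\<close>
    is bounded below. Its value \<open>l i\<close> is a coordinate of a point of the joint spectrum,
    hence in \<open>vs\<close>, so one factor of \<open>y\<close> makes the approximate eigenvalue
    of \<open>y\<close> zero.\<close>
  have "y = 0"
  proof (rule ccontr)
    assume "y \<noteq> 0"
    have ys: "y * S j = S j * y" for j
      unfolding y_def by (rule com)
    obtain \<xi> l where \<xi>: "\<And>n. norm (\<xi> n) = 1" "\<And>n. norm y / 2 \<le> norm (y \<rhd> \<xi> n)"
      "\<And>i. approx_eigenvalue \<xi> (S i) (complex_of_real (l i))"
      by (rule approx_joint_eigenvector [of S y, OF S ys \<open>y \<noteq> 0\<close>]) blast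
    have "l i \<in> set vs"
      using joint_spectrumI [OF \<xi>(1) S(1) \<xi>(3)] vs by (force simp: V_def)
    have "approx_eigenvalue \<xi> (prod_list (map (\<lambda>v. S i - v *\<^sub>R 1) us))
        (prod_list (map (\<lambda>v. complex_of_real (l i) - complex_of_real v) us))" for us
    proof (induction us)
      case (Cons u us)
      have "approx_eigenvalue \<xi> (S i - u *\<^sub>R 1) (complex_of_real (l i) - complex_of_real u)"
        using approx_eigenvalue_diff [OF \<xi>(3) approx_eigenvalue_scaleC [OF approx_eigenvalue_one]]
        by (simp add: scaleR_scaleC)
      with Cons show ?case
        by (simp add: approx_eigenvalue_mult)
    qed (simp add: approx_eigenvalue_one)
    moreover have "prod_list (map (\<lambda>v. complex_of_real (l i) - complex_of_real v) vs) = 0"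
      using \<open>l i \<in> set vs\<close> by (auto simp: prod_list_zero_iff)
    ultimately have "approx_eigenvalue \<xi> y 0"
      unfolding y_def by metis
    then have "(\<lambda>n. norm (y \<rhd> \<xi> n)) \<longlonglongrightarrow> 0"
      by (simp add: approx_eigenvalue_def tendsto_norm_zero)
    then have "norm y / 2 \<le> 0"
      by (rule LIMSEQ_le_const) (use \<xi>(2) in blast)
    with \<open>y \<noteq> 0\<close> show False
      by simp
  qed
  then show ?thesis
    using that vs(1) by (simp add: y_def)
qed

text \<open>The \<open>q v\<close> are the eigenprojections of \<open>s\<close>. They commute with
  the commutant of \<open>s\<close> because eigenspaces are invariant under it; completeness is an
  induction over the factors of the annihilating product.\<close>

lemma spectral_partition_single:
  fixes s :: "'h::chilbert_space cop" and vs :: "real list"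
  assumes s: "adj s = s" and vs: "distinct vs" "prod_list (map (\<lambda>v. s - v *\<^sub>R 1) vs) = 0"
  obtains q :: "real \<Rightarrow> 'h cop" where "\<And>v. is_proj (q v)" "\<And>v w. v \<noteq> w \<Longrightarrow> q v * q w = 0"
    "(\<Sum>v\<in>set vs. q v) = 1" "\<And>v. s * q v = v *\<^sub>R q v" "\<And>v t. t * s = s * t \<Longrightarrow> t * q v = q v * t"
proof -
  have "\<exists>q. is_proj q \<and> s * q = v *\<^sub>R q \<and> (\<forall>t. t * s = s * t \<longrightarrow> t * q = q * t) \<and>
      (\<forall>\<xi>. s \<rhd> \<xi> = v *\<^sub>R \<xi> \<longrightarrow> q \<rhd> \<xi> = \<xi>)" for v :: real
  proof -
    define W where "W = {\<xi>. (s - v *\<^sub>R 1) \<rhd> \<xi> = 0}"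
    have W_iff: "\<xi> \<in> W \<longleftrightarrow> s \<rhd> \<xi> = v *\<^sub>R \<xi>" for \<xi>
      by (simp add: W_def app_diff_left app_scaleR_left)
    have W: "closed_csubspace W"
      unfolding closed_csubspace_def W_def
      by (auto simp: app_add_right app_scaleC_right
          intro!: closed_Collect_eq linear_continuous_on bounded_linear_app)
    obtain q where q: "is_proj q" and qW: "\<And>\<xi>. q \<rhd> \<xi> \<in> W" and qid: "\<And>\<xi>. \<xi> \<in> W \<Longrightarrow> q \<rhd> \<xi> = \<xi>"
      by (rule projection_onto [OF W]) blast
    have inv: "q * t * q = t * q" if "t * s = s * t" for t
    proof (rule cop_eqI)
      fix \<xi>
      have "s \<rhd> (t \<rhd> (q \<rhd> \<xi>)) = t \<rhd> (s \<rhd> (q \<rhd> \<xi>))"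
        by (simp only: app_mult [symmetric] that mult.assoc [symmetric])
      then have "t \<rhd> (q \<rhd> \<xi>) \<in> W"
        using qW [of \<xi>] by (simp add: W_iff app_scaleR_right)
      then show "(q * t * q) \<rhd> \<xi> = (t * q) \<rhd> \<xi>"
        by (simp add: app_mult qid)
    qed
    have "t * q = q * t" if "t * s = s * t" for t
    proof (rule commute_projection [OF q inv [OF that] inv])
      show "adj t * s = s * adj t"
        using arg_cong [OF that, of adj] by (simp add: s)
    qed
    moreover have "s * q = v *\<^sub>R q"
      by (rule cop_eqI) (use qW in \<open>simp add: W_iff app_mult app_scaleR_left\<close>)
    ultimately show ?thesis
      using q qid W_iff by blast
  qed
  then obtain q where q: "\<And>v. is_proj (q v)" "\<And>v. s * q v = v *\<^sub>R q v"
    "\<And>v t. t * s = s * t \<Longrightarrow> t * q v = q v * t" "\<And>v \<xi>. s \<rhd> \<xi> = v *\<^sub>R \<xi> \<Longrightarrow> q v \<rhd> \<xi> = \<xi>"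
    by metis
  have orth: "q v * q w = 0" if "v \<noteq> w" for v w
  proof -
    have "q v * (s * q w) = s * q v * q w"
      using q(3) [of s v] by (simp add: mult.assoc [symmetric])
    then have "w *\<^sub>R (q v * q w) = v *\<^sub>R (q v * q w)"
      by (simp add: q(2))
    then have "(w - v) *\<^sub>R (q v * q w) = 0"
      by (simp add: scaleR_left_diff_distrib)
    then show ?thesis
      using that by simp
  qed
  have decomp: "(\<Sum>v\<in>set us. q v) \<rhd> \<xi> = \<xi>"
    if "distinct us" "prod_list (map (\<lambda>v. s - v *\<^sub>R 1) us) \<rhd> \<xi> = 0" for us \<xi>
    using that
  proof (induction us arbitrary: \<xi>)
    case (Cons v us)
    let ?Q = "\<Sum>w\<in>set us. q w"
    let ?\<eta> = "(s - v *\<^sub>R 1) \<rhd> \<xi>"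
    have "(s - v *\<^sub>R 1) * prod_list (map (\<lambda>v. s - v *\<^sub>R 1) us) = prod_list (map (\<lambda>v. s - v *\<^sub>R 1) us) * (s - v *\<^sub>R 1)"
    proof (induction us)
      case (Cons u us)
      have "(s - v *\<^sub>R 1) * (s - u *\<^sub>R 1) = (s - u *\<^sub>R 1) * (s - v *\<^sub>R 1)"
        by (simp add: algebra_simps)
      then show ?case
        using commute_mult [of "s - v *\<^sub>R 1"] Cons by simp
    qed simp
    then have "prod_list (map (\<lambda>v. s - v *\<^sub>R 1) us) \<rhd> ?\<eta> = 0"
      using Cons.prems by (simp add: app_mult [symmetric])
    then have \<eta>: "?Q \<rhd> ?\<eta> = ?\<eta>"
      using Cons by simp
    \<comment> \<open>A preimage of \<open>?\<eta>\<close> under \<open>s - v *\<^sub>R 1\<close>,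
      which acts on the eigenspace of \<open>w\<close> as the nonzero scalar \<open>w - v\<close>.
      Hence \<open>\<xi> - \<zeta>\<close> is an eigenvector for \<open>v\<close>, or zero.\<close>
    define \<zeta> where "\<zeta> = (\<Sum>w\<in>set us. (1 / (w - v)) *\<^sub>R (q w \<rhd> ?\<eta>))"
    have sq: "(s - v *\<^sub>R 1) \<rhd> ((1 / (w - v)) *\<^sub>R (q w \<rhd> ?\<eta>)) = q w \<rhd> ?\<eta>" if "w \<in> set us" for w
    proof -
      have w: "w \<noteq> v"
        using that Cons.prems by auto
      have "(s - v *\<^sub>R 1) * q w = (w - v) *\<^sub>R q w"
        by (simp add: left_diff_distrib q(2) scaleR_left_diff_distrib)
      then have "(s - v *\<^sub>R 1) \<rhd> (q w \<rhd> ?\<eta>) = (w - v) *\<^sub>R (q w \<rhd> ?\<eta>)"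
        by (metis app_mult app_scaleR_left)
      then show ?thesis
        using w by (simp only: app_scaleR_right) simp
    qed
    have "(s - v *\<^sub>R 1) \<rhd> \<zeta> = (\<Sum>w\<in>set us. (s - v *\<^sub>R 1) \<rhd> ((1 / (w - v)) *\<^sub>R (q w \<rhd> ?\<eta>)))"
      unfolding \<zeta>_def by (rule linear_sum [OF bounded_linear.linear [OF bounded_linear_app]])
    also have "\<dots> = ?\<eta>"
      using \<eta> by (simp add: sq app_sum_left)
    finally have "(s - v *\<^sub>R 1) \<rhd> (\<xi> - \<zeta>) = 0"
      by (simp add: app_diff_right)
    then have 1: "q v \<rhd> (\<xi> - \<zeta>) = \<xi> - \<zeta>"
      by (intro q(4)) (simp add: app_diff_left app_scaleR_left)
    have vns: "v \<notin> set us"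
      using Cons.prems by simp
    have Qq: "?Q * q w = (if w \<in> set us then q w else 0)" for w
    proof -
      have "?Q * q w = (\<Sum>u\<in>set us. if u = w then q w else 0)"
        unfolding sum_distrib_right by (rule sum.cong) (auto simp: orth is_projD q(1))
      then show ?thesis
        by simp
    qed
    have Tq: "(q v + ?Q) * q w = q w" if "w = v \<or> w \<in> set us" for w
      using that vns Qq [of w] orth [of v w] by (auto simp: distrib_right is_projD q(1))
    have "(q v + ?Q) \<rhd> \<zeta> = (\<Sum>w\<in>set us. (q v + ?Q) \<rhd> ((1 / (w - v)) *\<^sub>R (q w \<rhd> ?\<eta>)))"
      unfolding \<zeta>_def by (rule linear_sum [OF bounded_linear.linear [OF bounded_linear_app]])
    also have "\<dots> = \<zeta>"
    proof -
      have "(q v + ?Q) \<rhd> (q w \<rhd> ?\<eta>) = q w \<rhd> ?\<eta>" if "w \<in> set us" for w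
        using Tq [of w] that by (metis app_mult)
      then show ?thesis
        unfolding \<zeta>_def by (intro sum.cong refl) (simp only: app_scaleR_right)
    qed
    finally have 2: "(q v + ?Q) \<rhd> \<zeta> = \<zeta>" .
    have "(q v + ?Q) \<rhd> (\<xi> - \<zeta>) = \<xi> - \<zeta>"
      using Tq [of v] 1 by (metis app_mult)
    with 2 have "(q v + ?Q) \<rhd> \<xi> = \<xi>"
      by (simp add: app_diff_right)
    then show ?case
      using vns by simp
  qed simp
  have "(\<Sum>v\<in>set vs. q v) = 1"
    by (rule cop_eqI) (simp add: decomp vs)
  then show ?thesis
    using that q orth by blast
qed

text \<open>Common refinement, one coordinate at a time. The projections of different coordinates
  commute because each commutes with everything that commutes with the tuple.\<close>

lemma spectral_partition:
  fixes S :: "'n \<Rightarrow> 'h::chilbert_space cop"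
  assumes S: "\<And>i. adj (S i) = S i" "\<And>i j. S i * S j = S j * S i"
    and ann: "\<And>i. \<exists>vs::real list. distinct vs \<and> prod_list (map (\<lambda>v. S i - v *\<^sub>R 1) vs) = 0"
    and I: "finite I"
  shows "\<exists>Q. finite Q \<and> (\<forall>q\<in>Q. is_proj q \<and> (\<forall>t. (\<forall>i. t * S i = S i * t) \<longrightarrow> t * q = q * t) \<and>
      (\<forall>i\<in>I. \<exists>v::real. S i * q = v *\<^sub>R q)) \<and> (\<forall>p\<in>Q. \<forall>q\<in>Q. p \<noteq> q \<longrightarrow> p * q = 0) \<and> \<Sum>Q = 1"
  using I
proof (induction I rule: finite_induct)
  case empty
  then show ?case
    by (intro exI [of _ "{1}"]) auto
next
  case (insert i I)
  from insert.IH obtain Q where Q1: "finite Q" "\<Sum>Q = 1" and Q2: "\<forall>p\<in>Q. \<forall>q\<in>Q. p \<noteq> q \<longrightarrow> p * q = 0"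
    and Q3: "\<forall>q\<in>Q. is_proj q \<and> (\<forall>t. (\<forall>i. t * S i = S i * t) \<longrightarrow> t * q = q * t) \<and>
      (\<forall>i\<in>I. \<exists>v::real. S i * q = v *\<^sub>R q)"
    by (elim exE conjE)
  have Q: "is_proj q" "\<forall>i. t * S i = S i * t \<Longrightarrow> t * q = q * t"
    "i \<in> I \<Longrightarrow> \<exists>v::real. S i * q = v *\<^sub>R q" if "q \<in> Q" for q t i
    using bspec [OF Q3 that] by (fast, fast, fast)
  have Qo: "p * q = 0" if "p \<in> Q" "q \<in> Q" "p \<noteq> q" for p q
    using Q2 that by fast
  obtain vs :: "real list" where vs: "distinct vs" "prod_list (map (\<lambda>v. S i - v *\<^sub>R 1) vs) = 0"
    using ann by blast
  obtain r where r: "\<And>v. is_proj (r v)" "\<And>v w. v \<noteq> w \<Longrightarrow> r v * r w = 0"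
    "(\<Sum>v\<in>set vs. r v) = 1" "\<And>v. S i * r v = v *\<^sub>R r v" "\<And>v t. t * S i = S i * t \<Longrightarrow> t * r v = r v * t"
    by (rule spectral_partition_single [OF S(1) vs]) blast
  have rcom: "r v * S j = S j * r v" for v j
    using r(5) [of "S j"] S(2) by simp
  have qr: "r v * q = q * r v" if "q \<in> Q" for q v
    using Q(2) [OF that, of "r v"] rcom by simp
  define h where "h = (\<lambda>(q, v). q * r v)"
  have orth: "h a * h b = 0" if ab0: "a \<in> Q \<times> set vs" "b \<in> Q \<times> set vs" "a \<noteq> b" for a b
  proof -
    obtain q v q' v' where ab: "a = (q, v)" "b = (q', v')" "q \<in> Q" "q' \<in> Q"
      using ab0 by auto
    have "h a * h b = q * q' * (r v * r v')"
    proof -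
      have "h a * h b = q * (r v * q') * r v'"
        by (simp add: ab h_def mult.assoc)
      also have "\<dots> = q * q' * (r v * r v')"
        by (simp add: qr [OF ab(4)] mult.assoc)
      finally show ?thesis .
    qed
    then show ?thesis
      using ab0(3) ab Qo r(2) by (cases "q = q'") auto
  qed
  have hp: "is_proj (h a)" if ha: "a \<in> Q \<times> set vs" for a
  proof -
    obtain q v where a: "a = (q, v)" "q \<in> Q"
      using ha by auto
    show ?thesis
      using is_proj_mult [OF Q(1) [OF a(2)] r(1) qr [OF a(2), symmetric]] by (simp add: a(1) h_def)
  qed
  show ?case
  proof (intro exI [of _ "h ` (Q \<times> set vs)"] conjI ballI impI allI)
    show "finite (h ` (Q \<times> set vs))"
      using Q1 by simp
    show "\<Sum>(h ` (Q \<times> set vs)) = 1"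
    proof -
      \<comment> \<open>The partition is a set, so equal products collapse; by orthogonality such a
        product is zero, and the sum is unaffected.\<close>
      have "\<Sum>(h ` (Q \<times> set vs)) = (\<Sum>a\<in>Q \<times> set vs. h a)"
      proof (subst sum.reindex_nontrivial)
        fix a b assume "a \<in> Q \<times> set vs" "b \<in> Q \<times> set vs" "a \<noteq> b" "h a = h b"
        then show "h a = 0"
          using orth [of a b] hp [of a] by (simp add: is_proj_def)
      qed (use Q1 in auto)
      also have "\<dots> = (\<Sum>q\<in>Q. \<Sum>v\<in>set vs. q * r v)"
        by (simp add: h_def sum.cartesian_product)
      also have "\<dots> = 1"
        by (simp add: sum_distrib_left [symmetric] r(3) Q1)
      finally show ?thesis .
    qed
    fix p assume "p \<in> h ` (Q \<times> set vs)"
    then obtain q v where p: "p = q * r v" "q \<in> Q" "v \<in> set vs" "p = h (q, v)"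
      by (auto simp: h_def)
    show "is_proj p"
      unfolding p(4) by (rule hp) (use p in simp)
    show "t * p = p * t" if "\<forall>i. t * S i = S i * t" for t
      unfolding p(1) by (rule commute_mult) (use Q(2) [OF p(2) that] r(5) [of t v] that in auto)
    show "\<exists>w::real. S j * p = w *\<^sub>R p" if j: "j \<in> insert i I" for j
    proof (cases "j = i")
      case True
      have "S i * p = q * (S i * r v)"
        using Q(2) [OF p(2), of "S i"] S(2) by (simp add: p(1) mult.assoc [symmetric])
      then show ?thesis
        using True by (auto simp: r(4) p(1))
    next
      case False
      then obtain w :: real where "S j * q = w *\<^sub>R q"
        using j Q(3) [OF p(2), of j] by blast
      then show ?thesis
        by (auto simp: p(1) mult.assoc [symmetric])
    qed
    fix p' assume "p' \<in> h ` (Q \<times> set vs)" and ne: "p \<noteq> p'"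
    then obtain b where b: "b \<in> Q \<times> set vs" "p' = h b"
      by blast
    show "p * p' = 0"
      unfolding p(4) b(2)
    proof (rule orth)
      show "(q, v) \<in> Q \<times> set vs" "(q, v) \<noteq> b"
        using p b ne by auto
    qed (rule b)
  qed
qed


section \<open>The multivariable Schur-Horn theorem\<close>

context tracial_factor
begin

text \<open>The unitary is the sum of the equivalences from \<open>comparison\<close>; orthogonality
  of both families removes the cross terms.\<close>

lemma equal_trace_partitions_conjugate:
  assumes L: "finite L"
    and q: "\<And>l. l \<in> L \<Longrightarrow> q l \<in> N" "\<And>l. l \<in> L \<Longrightarrow> is_proj (q l)"
      "\<And>l m. l \<in> L \<Longrightarrow> m \<in> L \<Longrightarrow> l \<noteq> m \<Longrightarrow> q l * q m = 0" "(\<Sum>l\<in>L. q l) = 1"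
    and r: "\<And>l. l \<in> L \<Longrightarrow> r l \<in> N" "\<And>l. l \<in> L \<Longrightarrow> is_proj (r l)"
      "\<And>l m. l \<in> L \<Longrightarrow> m \<in> L \<Longrightarrow> l \<noteq> m \<Longrightarrow> r l * r m = 0" "(\<Sum>l\<in>L. r l) = 1"
    and tr: "\<And>l. l \<in> L \<Longrightarrow> tr (q l) = tr (r l)"
  obtains U where "U \<in> N" "adj U * U = 1" "U * adj U = 1" "\<And>l. l \<in> L \<Longrightarrow> U * q l * adj U = r l"
proof -
  have "\<exists>u. u \<in> N \<and> adj u * u = q l \<and> u * adj u = r l" if "l \<in> L" for l
    using comparison [OF q(1,2) r(1,2) tr] that by metis
  then obtain u where u: "\<And>l. l \<in> L \<Longrightarrow> u l \<in> N" "\<And>l. l \<in> L \<Longrightarrow> adj (u l) * u l = q l"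
    "\<And>l. l \<in> L \<Longrightarrow> u l * adj (u l) = r l"
    by metis
  have uq: "u l * q l = u l" if "l \<in> L" for l
    using partial_isometry_initial [of "u l"] u(2) [OF that] q(2) [OF that] by simp
  have ru: "r l * u l = u l" if "l \<in> L" for l
    using uq [OF that] u(2,3) [OF that] by (metis mult.assoc)
  have qu': "q l * adj (u l) = adj (u l)" and u'r: "adj (u l) * r l = adj (u l)" if "l \<in> L" for l
    using arg_cong [OF uq [OF that], of adj] arg_cong [OF ru [OF that], of adj] q(2) [OF that] r(2) [OF that]
    by (simp_all add: is_projD)
  have o1: "adj (u l) * u m = (if l = m then q l else 0)" if "l \<in> L" "m \<in> L" for l m
  proof -
    have "adj (u l) * u m = adj (u l) * (r l * r m) * u m"
      using u'r [OF that(1)] ru [OF that(2)] by (metis mult.assoc)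
    then show ?thesis
      using u(2) r(3) that by auto
  qed
  have o2: "u l * adj (u m) = (if l = m then r l else 0)" if "l \<in> L" "m \<in> L" for l m
  proof -
    have "u l * adj (u m) = u l * (q l * q m) * adj (u m)"
      using uq [OF that(1)] qu' [OF that(2)] by (metis mult.assoc)
    then show ?thesis
      using u(3) q(3) that by auto
  qed
  define U where "U = (\<Sum>l\<in>L. u l)"
  have "adj U * U = (\<Sum>l\<in>L. \<Sum>m\<in>L. if l = m then q l else 0)"
    unfolding U_def adj_sum sum_product by (intro sum.cong refl) (simp add: o1)
  then have 1: "adj U * U = 1"
    using L q(4) by simp
  have "U * adj U = (\<Sum>l\<in>L. \<Sum>m\<in>L. if l = m then r l else 0)"
    unfolding U_def adj_sum sum_product by (intro sum.cong refl) (simp add: o2)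
  then have 2: "U * adj U = 1"
    using L r(4) by simp
  have Uq: "U * q l = u l" if l: "l \<in> L" for l
  proof -
    have "u m * q l = (if m = l then u l else 0)" if "m \<in> L" for m
    proof -
      have "u m * q l = u m * (q m * q l)"
        using uq [OF that] by (simp add: mult.assoc [symmetric])
      then show ?thesis
        using uq q that l by (auto simp: is_projD)
    qed
    then show ?thesis
      using L l by (simp add: U_def sum_distrib_right)
  qed
  have "U * q l * adj U = r l" if "l \<in> L" for l
  proof -
    have "U * q l * adj U = U * q l * adj (U * q l)"
      using q(2) [OF that] by (simp add: is_projD mult.assoc proj_absorb)
    then show ?thesis
      by (simp only: Uq [OF that] u(3) [OF that])
  qed
  moreover have "U \<in> N"
    unfolding U_def by (rule N_sum) (rule u)
  ultimately show ?thesis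
    using that 1 2 by blast
qed

end

context masa_expectation
begin

text \<open>The weights see \<open>D q\<close> only through its trace against \<open>p\<close>, and
  \<open>p * D q\<close> need not be a multiple of \<open>p\<close>. Averages suffice because each
  \<open>a i\<close> is scalar on \<open>p\<close>.\<close>

theorem schur_horn:
  fixes a s :: "'n::finite \<Rightarrow> 'h cop"
  assumes aA: "\<And>i. a i \<in> A" and sN: "\<And>i. s i \<in> N"
    and p: "finite Pa" "\<And>p. p \<in> Pa \<Longrightarrow> p \<in> A" "\<And>p. p \<in> Pa \<Longrightarrow> is_proj p" "\<And>p. p \<in> Pa \<Longrightarrow> p \<noteq> 0"
      "\<And>p p'. p \<in> Pa \<Longrightarrow> p' \<in> Pa \<Longrightarrow> p \<noteq> p' \<Longrightarrow> p * p' = 0" "(\<Sum>p\<in>Pa. p) = 1"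
      "\<And>i p. p \<in> Pa \<Longrightarrow> \<exists>v::real. a i * p = v *\<^sub>R p"
    and q: "finite Qs" "\<And>q. q \<in> Qs \<Longrightarrow> q \<in> N" "\<And>q. q \<in> Qs \<Longrightarrow> is_proj q"
      "\<And>q q'. q \<in> Qs \<Longrightarrow> q' \<in> Qs \<Longrightarrow> q \<noteq> q' \<Longrightarrow> q * q' = 0" "(\<Sum>q\<in>Qs. q) = 1"
      "\<And>i q. q \<in> Qs \<Longrightarrow> \<exists>v::real. s i * q = v *\<^sub>R q"
    and D: "\<And>x. x \<in> N \<Longrightarrow> D x \<in> N" "\<And>x y. x \<in> N \<Longrightarrow> y \<in> N \<Longrightarrow> D (x + y) = D x + D y"
      "\<And>r x. x \<in> N \<Longrightarrow> D (r *\<^sub>R x) = r *\<^sub>R D x" "D 1 = 1"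
      "\<And>x. x \<in> N \<Longrightarrow> pos x \<Longrightarrow> pos (D x)" "\<And>x. x \<in> N \<Longrightarrow> tr (D x) = tr x"
    and Ds: "\<And>i. D (s i) = a i"
  obtains U where "U \<in> N" "adj U * U = 1" "U * adj U = 1" "\<And>i. E (U * s i * adj U) = a i"
proof -
  have pN: "p \<in> N" if "p \<in> Pa" for p
    by (rule A_sub_N [OF p(2) [OF that]])
  have D0: "D 0 = 0"
    using D(3) [of 0 0] by simp
  have Dsum: "D (\<Sum>i\<in>I. x i) = (\<Sum>i\<in>I. D (x i))" if "\<And>i. i \<in> I \<Longrightarrow> x i \<in> N" for I and x :: "'h cop \<Rightarrow> 'h cop"
    using that by (induction I rule: infinite_finite_induct) (simp_all add: D0 D N_sum)
  have trP: "0 < tr p" if "p \<in> Pa" for p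
    by (rule tr_pos [OF pN [OF that] pos_proj [OF p(3) [OF that]] p(4) [OF that]])
  define c where "c p q = tr (p * D q) / tr p" for p q
  have c0: "0 \<le> c p q" if "p \<in> Pa" "q \<in> Qs" for p q
  proof -
    have Dq: "D q \<in> N" "pos (D q)"
      using q that D by (auto simp: pos_proj)
    \<comment> \<open>The trace against \<open>p\<close> equals that of the compression of the
      positive operator \<open>D q\<close> by \<open>p\<close>.\<close>
    have "tr (p * D q) = tr (p * (p * D q))"
      using p(3) [OF that(1)] by (simp add: proj_absorb)
    also have "\<dots> = tr (adj p * D q * p)"
      using p(3) pN that Dq(1) by (subst tr_comm) (simp_all add: N_mult is_projD)
    finally have "0 \<le> tr (p * D q)"
      using Dq pN that p(3) by (simp add: tr_nonneg pos_conj N_intros)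
    then show ?thesis
      using trP [OF that(1)] by (simp add: c_def)
  qed
  have pDs: "(\<Sum>q\<in>Qs. v q * tr (p * D q)) = tr (p * D (\<Sum>q\<in>Qs. v q *\<^sub>R q))" if "p \<in> Pa" for v p
  proof -
    have "p * D (\<Sum>q\<in>Qs. v q *\<^sub>R q) = (\<Sum>q\<in>Qs. v q *\<^sub>R (p * D q))"
      using q(2) by (simp add: Dsum N_scaleR D sum_distrib_left)
    then show ?thesis
      using q(2) D pN [OF that] by (simp add: tr_sum N_intros tr_simps)
  qed
  have c1: "(\<Sum>q\<in>Qs. c p q) = 1" if "p \<in> Pa" for p
    using pDs [OF that, of "\<lambda>_. 1"] trP [OF that]
    by (simp add: c_def sum_divide_distrib [symmetric] q(5) D(4))
  have "\<exists>R. (\<forall>q\<in>Qs. R q \<in> N \<and> is_proj (R q) \<and> R q * p = R q \<and> E (R q) = c p q *\<^sub>R p \<and>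
      (\<forall>q'\<in>Qs. q \<noteq> q' \<longrightarrow> R q * R q' = 0)) \<and> (\<Sum>q\<in>Qs. R q) = p" if pP: "p \<in> Pa" for p
  proof -
    obtain R where "\<And>l. l \<in> Qs \<Longrightarrow> R l \<in> N" "\<And>l. l \<in> Qs \<Longrightarrow> is_proj (R l)" "\<And>l. l \<in> Qs \<Longrightarrow> R l * p = R l"
      "\<And>l m. l \<in> Qs \<Longrightarrow> m \<in> Qs \<Longrightarrow> l \<noteq> m \<Longrightarrow> R l * R m = 0"
      "\<And>l. l \<in> Qs \<Longrightarrow> E (R l) = c p l *\<^sub>R p" "(\<Sum>l\<in>Qs. R l) = p"
      by (rule scalar_expectation_partition [OF p(2,3) [OF pP] q(1) c0 [OF pP] c1 [OF pP]]) blast+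
    then show ?thesis
      by blast
  qed
  then obtain R where R: "\<And>p. p \<in> Pa \<Longrightarrow> (\<forall>q\<in>Qs. R p q \<in> N \<and> is_proj (R p q) \<and> R p q * p = R p q \<and>
      E (R p q) = c p q *\<^sub>R p \<and> (\<forall>q'\<in>Qs. q \<noteq> q' \<longrightarrow> R p q * R p q' = 0)) \<and> (\<Sum>q\<in>Qs. R p q) = p"
    by metis
  have RR: "R p x * R p' y = 0" if "p \<in> Pa" "p' \<in> Pa" "x \<in> Qs" "y \<in> Qs" "p \<noteq> p' \<or> x \<noteq> y" for p p' x y
  proof (cases "p = p'")
    case True
    then show ?thesis
      using R [OF that(1)] that by blast
  next
    case False
    have 1: "R p x * p = R p x" "p' * R p' y = R p' y"
      using R [OF that(1)] R [OF that(2)] that proj_sub_iff p(3) by metis+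
    have "R p x * R p' y = R p x * p * (p' * R p' y)"
      by (simp only: 1)
    also have "\<dots> = R p x * (p * p') * R p' y"
      by (simp only: mult.assoc)
    also have "p * p' = 0"
      by (rule p(5) [OF that(1,2) False])
    finally show ?thesis
      by simp
  qed
  define r where "r x = (\<Sum>p\<in>Pa. R p x)" for x
  have rN: "r x \<in> N" if "x \<in> Qs" for x
    unfolding r_def by (rule N_sum) (use R that in blast)
  have rp: "is_proj (r x)" if "x \<in> Qs" for x
    unfolding r_def by (rule is_proj_sum [OF p(1)]) (use R RR that in blast)+
  have rr: "r x * r y = 0" if "x \<in> Qs" "y \<in> Qs" "x \<noteq> y" for x y
    unfolding r_def sum_product by (intro sum.neutral ballI) (use RR that in blast)
  have r1: "(\<Sum>x\<in>Qs. r x) = 1"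
    unfolding r_def using R p(6) by (subst sum.swap) simp
  have Er: "E (r x) = (\<Sum>p\<in>Pa. c p x *\<^sub>R p)" if "x \<in> Qs" for x
  proof -
    have "E (r x) = (\<Sum>p\<in>Pa. E (R p x))"
      unfolding r_def by (rule E_sum) (use R that in blast)
    also have "\<dots> = (\<Sum>p\<in>Pa. c p x *\<^sub>R p)"
      by (rule sum.cong) (use R that in blast)+
    finally show ?thesis .
  qed
  \<comment> \<open>The factors \<open>tr p\<close> cancel the denominators of \<open>c\<close>;
    what remains is the trace of \<open>D x\<close>, which \<open>D\<close> preserves.\<close>
  have rt: "tr x = tr (r x)" if x: "x \<in> Qs" for x
  proof -
    have "tr (r x) = (\<Sum>p\<in>Pa. tr (c p x *\<^sub>R p))"
      using tr_E [OF rN [OF x]] pN by (simp add: Er [OF x] tr_sum N_scaleR)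
    also have "\<dots> = (\<Sum>p\<in>Pa. tr (p * D x))"
    proof (rule sum.cong)
      fix p assume "p \<in> Pa"
      then show "tr (c p x *\<^sub>R p) = tr (p * D x)"
        using trP [of p] pN [of p] by (simp add: tr_simps c_def)
    qed simp
    also have "\<dots> = tr ((\<Sum>p\<in>Pa. p) * D x)"
      using pN D(1) [OF q(2) [OF x]] by (simp add: sum_distrib_right tr_sum N_mult)
    also have "\<dots> = tr x"
      using D(6) [OF q(2) [OF x]] by (simp add: p(6))
    finally show ?thesis
      by simp
  qed
  obtain U where U: "U \<in> N" "adj U * U = 1" "U * adj U = 1" "\<And>x. x \<in> Qs \<Longrightarrow> U * x * adj U = r x"
    by (rule equal_trace_partitions_conjugate [of Qs "\<lambda>x. x" r]) (use q rN rp rr r1 rt in auto)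
  have "E (U * s i * adj U) = a i" for i
  proof -
    have "\<forall>x\<in>Qs. \<exists>v::real. s i * x = v *\<^sub>R x"
      using q(6) by blast
    then obtain v :: "'h cop \<Rightarrow> real" where v: "\<And>x. x \<in> Qs \<Longrightarrow> s i * x = v x *\<^sub>R x"
      by metis
    have "\<forall>p\<in>Pa. \<exists>w::real. a i * p = w *\<^sub>R p"
      using p(7) by blast
    then obtain w :: "'h cop \<Rightarrow> real" where w: "\<And>p. p \<in> Pa \<Longrightarrow> a i * p = w p *\<^sub>R p"
      by metis
    have s: "s i = (\<Sum>x\<in>Qs. v x *\<^sub>R x)"
    proof -
      have "s i = s i * (\<Sum>x\<in>Qs. x)"
        by (simp add: q(5))
      then show ?thesis
        by (simp add: sum_distrib_left v)
    qed
    have "U * s i * adj U = (\<Sum>x\<in>Qs. v x *\<^sub>R r x)"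
      by (simp add: s sum_distrib_left sum_distrib_right U(4))
    then have "E (U * s i * adj U) = (\<Sum>x\<in>Qs. v x *\<^sub>R E (r x))"
      using rN by (simp add: E_sum E_scaleR N_scaleR)
    also have "\<dots> = (\<Sum>x\<in>Qs. \<Sum>p\<in>Pa. (v x * c p x) *\<^sub>R p)"
      by (intro sum.cong refl) (simp add: Er scaleR_sum_right)
    also have "\<dots> = (\<Sum>p\<in>Pa. (\<Sum>x\<in>Qs. v x * c p x) *\<^sub>R p)"
      by (subst sum.swap) (simp add: scaleR_sum_left)
    also have "\<dots> = (\<Sum>p\<in>Pa. a i * p)"
    proof (rule sum.cong)
      fix p assume pP: "p \<in> Pa"
      \<comment> \<open>By linearity the weighted sum of the eigenvalues of \<open>s i\<close> is
        the mean of \<open>D (s i) = a i\<close> over \<open>p\<close>, that is, the eigenvalue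
        \<open>w p\<close>.\<close>
      have "(\<Sum>x\<in>Qs. v x * c p x) = tr (p * D (s i)) / tr p"
        using pDs [OF pP, of v] by (simp add: c_def sum_divide_distrib [symmetric] s)
      also have "p * D (s i) = w p *\<^sub>R p"
        using A_commute [OF p(2) [OF pP] aA [of i]] by (simp add: Ds w [OF pP])
      also have "tr (w p *\<^sub>R p) / tr p = w p"
        using trP [OF pP] pN [OF pP] by (simp add: tr_simps)
      finally show "(\<Sum>x\<in>Qs. v x * c p x) *\<^sub>R p = a i * p"
        by (simp add: w [OF pP])
    qed simp
    also have "\<dots> = a i"
      by (simp add: sum_distrib_left [symmetric] p(6))
    finally show ?thesis .
  qed
  then show ?thesis
    using that U by blast
qed

end

section \<open>Transfer of the notions of the statement to \<open>cop\<close>\<close>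

lemma commutant_Rep_cop: "commutant (Rep_cop ` X) = Rep_cop ` comm X"
proof (intro set_eqI iffI)
  fix T assume T: "T \<in> commutant (Rep_cop ` X)"
  then obtain t where "T = Rep_cop t"
    using cbounded_ops_cases by (auto simp: commutant_def)
  then show "T \<in> Rep_cop ` comm X"
    using T by (auto simp: commutant_def comm_def Rep_cop_simps(3) [symmetric] Rep_cop_inject)
next
  fix T assume "T \<in> Rep_cop ` comm X"
  then show "T \<in> commutant (Rep_cop ` X)"
    by (auto simp: commutant_def comm_def Rep_cop_simps(3) [symmetric] Rep_cop_inject Rep_cop)
qed

lemma von_neumann_Rep_cop:
  assumes "von_neumann_algebra (Rep_cop ` N)" shows "von_neumann N"
proof
  show "adj x \<in> N" if "x \<in> N" for x
    using assms that by (force simp: von_neumann_algebra_def cadj_Rep_cop Rep_cop_inject)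
  have "Rep_cop ` comm (comm N) = Rep_cop ` N"
    using assms by (simp add: von_neumann_algebra_def commutant_Rep_cop)
  then show "comm (comm N) = N"
    by (metis inj_image_eq_iff injI Rep_cop_inject)
qed

text \<open>The clause that is more than translation is normality: the range of an increasing
  sequence is directed, and its strong limit is its least upper bound because positivity passes to
  strong limits.\<close>

lemma tracial_factor_Rep_cop:
  assumes II1: "type_II1_factor (Rep_cop ` N)" and tr: "normalized_trace (Rep_cop ` N) \<tau>"
  shows "tracial_factor N (\<lambda>x. \<tau> (Rep_cop x))"
proof -
  have fac: "factor (Rep_cop ` N)"
    and ab: "\<And>p. abelian_projection (Rep_cop ` N) p \<Longrightarrow> p = 0"
    using II1 by (auto simp: type_II1_factor_def)
  interpret von_neumann N
    using fac by (intro von_neumann_Rep_cop) (simp add: factor_def)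
  have lin: "clinear_on (Rep_cop ` N) \<tau>" and norm: "normal_functional (Rep_cop ` N) \<tau>"
    and fa: "\<And>x. x \<in> Rep_cop ` N \<Longrightarrow> positive_op x \<Longrightarrow> \<tau> x = 0 \<Longrightarrow> x = 0"
    using tr by (auto simp: normalized_trace_def)
  show ?thesis
  proof unfold_locales
    show "\<exists>c. x = c *\<^sub>C 1" if "x \<in> N" "x \<in> comm N" for x
    proof -
      have "Rep_cop x \<in> Rep_cop ` N \<inter> commutant (Rep_cop ` N)"
        using that by (simp add: commutant_Rep_cop)
      then obtain c where "Rep_cop x = c *\<^sub>C id_blinfun"
        using fac by (auto simp: factor_def)
      then have "x = c *\<^sub>C 1"
        by (simp add: Rep_cop_simps [symmetric] Rep_cop_inject)
      then show ?thesis ..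
    qed
    show "p = 0" if "p \<in> N" "is_proj p"
      "\<And>x y. x \<in> N \<Longrightarrow> y \<in> N \<Longrightarrow> (p * x * p) * (p * y * p) = (p * y * p) * (p * x * p)" for p
    proof -
      have "abelian_projection (Rep_cop ` N) (Rep_cop p)"
        using that by (auto simp: abelian_projection_def projection_op_Rep_cop
            Rep_cop_simps(3) [symmetric] Rep_cop_inject)
      then have "Rep_cop p = Rep_cop 0"
        using ab by (simp add: Rep_cop_simps)
      then show ?thesis
        by (simp add: Rep_cop_inject)
    qed
    show "\<tau> (Rep_cop (x + y)) = \<tau> (Rep_cop x) + \<tau> (Rep_cop y)" if "x \<in> N" "y \<in> N" for x y
      using lin that by (simp add: clinear_on_def Rep_cop_simps)
    show "\<tau> (Rep_cop (c *\<^sub>C x)) = c * \<tau> (Rep_cop x)" if "x \<in> N" for x c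
      using lin that by (simp add: clinear_on_def Rep_cop_simps scaleC_complex_def)
    show "\<tau> (Rep_cop 1) = 1"
      using tr by (simp add: normalized_trace_def Rep_cop_simps)
    show "\<tau> (Rep_cop x) \<in> \<real>\<^sub>\<ge>\<^sub>0" if "x \<in> N" "pos x" for x
      using tr that by (simp add: normalized_trace_def positive_op_Rep_cop)
    show "\<tau> (Rep_cop (x * y)) = \<tau> (Rep_cop (y * x))" if "x \<in> N" "y \<in> N" for x y
      using tr that by (simp add: normalized_trace_def Rep_cop_simps)
    show "x = 0" if "x \<in> N" "pos x" "\<tau> (Rep_cop x) = 0" for x
    proof -
      have "Rep_cop x = Rep_cop 0"
        using fa [of "Rep_cop x"] that by (simp add: positive_op_Rep_cop Rep_cop_simps)
      then show ?thesis
        by (simp add: Rep_cop_inject)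
    qed
    show "Re (\<tau> (Rep_cop s)) \<le> r" if X: "\<And>n. X n \<in> N" "\<And>n. adj (X n) = X n"
      "\<And>m n. m \<le> n \<Longrightarrow> pos (X n - X m)" "slim X s" "\<And>n. Re (\<tau> (Rep_cop (X n))) \<le> r" for X s r
    proof -
      have le: "pos (s - X n)" for n
      proof (rule slim_pos)
        have "slim (\<lambda>k. X (k + n)) s"
          unfolding slim_def
          by (intro allI LIMSEQ_ignore_initial_segment [where f = "\<lambda>k. X k \<rhd> _"])
            (use X(4) in \<open>simp add: slim_def\<close>)
        then show "slim (\<lambda>k. X (k + n) - X n) (s - X n)"
          by (intro slim_diff slim_const)
        show "pos (X (k + n) - X n)" for k
          by (rule X(3)) simp
      qed
      have sN: "s \<in> N"
        by (rule N_slim [OF X(4) X(1)])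
      have s: "adj s = s"
        using pos_hermitian [OF le [of 0]] X(2) [of 0] by simp
      let ?X = "range (\<lambda>n. Rep_cop (X n))"
      have least: "positive_op (t - Rep_cop s)"
        if t: "t \<in> Rep_cop ` N" "\<forall>x\<in>?X. positive_op (t - x)" for t
      proof -
        obtain t' where t': "t = Rep_cop t'"
          using t(1) by blast
        have "pos (t' - X n)" for n
          using t(2) by (simp add: t' Rep_cop_simps(2) [symmetric] positive_op_Rep_cop)
        then have "pos (t' - s)"
          using slim_pos [OF slim_diff [OF slim_const X(4)]] by blast
        then show ?thesis
          by (simp add: t' Rep_cop_simps(2) [symmetric] positive_op_Rep_cop)
      qed
      have dir: "\<exists>z\<in>?X. positive_op (z - x) \<and> positive_op (z - y)" if xy: "x \<in> ?X" "y \<in> ?X" for x y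
      proof -
        obtain m n where "x = Rep_cop (X m)" "y = Rep_cop (X n)"
          using xy by blast
        then show ?thesis
          using X(3) [of m "max m n"] X(3) [of n "max m n"]
          by (auto intro!: bexI [of _ "Rep_cop (X (max m n))"]
              simp: Rep_cop_simps(2) [symmetric] positive_op_Rep_cop)
      qed
      have "?X \<noteq> {} \<and> ?X \<subseteq> {x \<in> Rep_cop ` N. hermitian_op x} \<and>
          (\<forall>x\<in>?X. \<forall>y\<in>?X. \<exists>z\<in>?X. positive_op (z - x) \<and> positive_op (z - y)) \<and>
          Rep_cop s \<in> Rep_cop ` N \<and> hermitian_op (Rep_cop s) \<and> (\<forall>x\<in>?X. positive_op (Rep_cop s - x)) \<and>
          (\<forall>t\<in>Rep_cop ` N. hermitian_op t \<and> (\<forall>x\<in>?X. positive_op (t - x)) \<longrightarrow> positive_op (t - Rep_cop s))"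
        using X(1,2) sN s le least dir
        by (auto simp: hermitian_op_Rep_cop Rep_cop_simps(2) [symmetric] positive_op_Rep_cop)
      with norm have "\<forall>r. (\<forall>x\<in>?X. Re (\<tau> x) \<le> r) \<longrightarrow> Re (\<tau> (Rep_cop s)) \<le> r"
        unfolding normal_functional_def by blast
      then show ?thesis
        using X(5) by blast
    qed
  qed
qed

text \<open>A masa is its own relative commutant: a hermitian element commuting with it generates, together
  with it, an abelian algebra, which is contained in the bicommutant of a commuting self-adjoint set.\<close>

lemma (in von_neumann) masa_relative_commutant:
  assumes masa: "masa (Rep_cop ` N) (Rep_cop ` A)"
    and x: "x \<in> N" "\<And>a. a \<in> A \<Longrightarrow> x * a = a * x"
  shows "x \<in> A"
proof -
  have star: "star_subalgebra (Rep_cop ` A)" and sub: "A \<subseteq> N"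
    and com: "\<And>a b. a \<in> A \<Longrightarrow> b \<in> A \<Longrightarrow> a * b = b * a"
    and max: "\<And>B. abelian_star_subalgebra (Rep_cop ` N) B \<Longrightarrow> Rep_cop ` A \<subseteq> B \<Longrightarrow> B = Rep_cop ` A"
    using masa by (auto simp: masa_def abelian_star_subalgebra_def Rep_cop_simps(3) [symmetric] Rep_cop_inject
        inj_image_subset_iff inj_on_def)
  have Aadj: "adj a \<in> A" if "a \<in> A" for a
    using star that by (force simp: star_subalgebra_def cadj_Rep_cop Rep_cop_inject)
  have Aadd: "a + b \<in> A" if "a \<in> A" "b \<in> A" for a b
    using star that by (force simp: star_subalgebra_def Rep_cop_simps [symmetric] Rep_cop_inject)
  have Asc: "c *\<^sub>C a \<in> A" if "a \<in> A" for a c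
    using star that by (force simp: star_subalgebra_def Rep_cop_simps [symmetric] Rep_cop_inject)
  have herm: "h \<in> A" if h: "h \<in> N" "adj h = h" "\<And>a. a \<in> A \<Longrightarrow> h * a = a * h" for h
  proof -
    define Y where "Y = insert h A"
    define B where "B = comm (comm Y)"
    have YN: "Y \<subseteq> N" and YY: "Y \<subseteq> comm Y"
      using h sub com by (auto simp: Y_def comm_def)
    have anti: "comm Z \<subseteq> comm W" if "W \<subseteq> Z" for W Z :: "'h cop set"
      using that by (auto simp: comm_def)
    have YB: "Y \<subseteq> B"
      by (auto simp: B_def comm_def)
    have BN: "B \<subseteq> N"
      unfolding B_def using anti [OF anti [OF YN]] bicommutant by simp
    have BY: "B \<subseteq> comm Y"
      unfolding B_def by (rule anti [OF YY])
    have Bcom: "b * b' = b' * b" if "b \<in> B" "b' \<in> B" for b b'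
      using that BY by (auto simp: B_def comm_def)
    have Yadj: "adj y \<in> Y" if "y \<in> Y" for y
      using that h Aadj by (auto simp: Y_def)
    have cY: "adj t \<in> comm Y" if "t \<in> comm Y" for t
      unfolding comm_def
    proof (intro CollectI ballI)
      fix y assume "y \<in> Y"
      then have "t * adj y = adj y * t"
        using that Yadj by (auto simp: comm_def)
      from arg_cong [OF this, of adj] show "adj t * y = y * adj t"
        by simp
    qed
    have Badj: "adj b \<in> B" if "b \<in> B" for b
      unfolding B_def comm_def [of "comm Y"]
    proof (intro CollectI ballI)
      fix t assume "t \<in> comm Y"
      then have "b * adj t = adj t * b"
        using that cY by (auto simp: B_def comm_def)
      from arg_cong [OF this, of adj] show "adj b * t = t * adj b"
        by simp
    qed
    have Bmult: "b * b' \<in> B" if "b \<in> B" "b' \<in> B" for b b'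
      using that unfolding B_def comm_def [of "comm Y"]
      by (intro CollectI ballI) (rule commute_mult [symmetric], auto)
    have "0 \<in> B"
      by (auto simp: B_def comm_def)
    moreover have "b + b' \<in> B" if "b \<in> B" "b' \<in> B" for b b'
      using that by (auto simp: B_def comm_def distrib_left distrib_right)
    moreover have "c *\<^sub>C b \<in> B" if "b \<in> B" for b c
      using that by (auto simp: B_def comm_def scaleC_mult)
    ultimately have "star_subalgebra (Rep_cop ` B)"
      unfolding star_subalgebra_def using Bmult Badj
      by (auto simp: Rep_cop_simps [symmetric] cadj_Rep_cop Rep_cop intro!: imageI)
    then have "abelian_star_subalgebra (Rep_cop ` N) (Rep_cop ` B)"
      unfolding abelian_star_subalgebra_def using BN Bcom
      by (auto simp: Rep_cop_simps [symmetric] Rep_cop_inject)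
    moreover have "Rep_cop ` A \<subseteq> Rep_cop ` B"
      using YB by (auto simp: Y_def)
    ultimately have "Rep_cop ` B = Rep_cop ` A"
      by (rule max)
    moreover have "Rep_cop h \<in> Rep_cop ` B"
      using YB by (auto simp: Y_def)
    ultimately show ?thesis
      by (auto simp: Rep_cop_inject)
  qed
  have x': "adj x * a = a * adj x" if "a \<in> A" for a
    using arg_cong [OF x(2) [OF Aadj [OF that]], of adj] by simp
  have 1: "x + adj x \<in> A"
    by (rule herm) (simp_all add: N_intros x x' distrib_left distrib_right add.commute)
  have 2: "\<i> *\<^sub>C (x - adj x) \<in> A"
    by (rule herm) (simp_all add: N_intros x x' left_diff_distrib right_diff_distrib scaleC_mult
        scaleC_diff_right)
  \<comment> \<open>Decomposition into hermitian and skew parts, each covered by the hermitian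
    case.\<close>
  have "x = (1/2) *\<^sub>C ((x + adj x) + (- \<i>) *\<^sub>C (\<i> *\<^sub>C (x - adj x)))"
    using scaleC_add_left [of "1/2" "1/2" x]
    by (simp add: scaleC_scaleC scaleC_add_right scaleC_diff_right)
  then show ?thesis
    using Asc [OF Aadd [OF 1 Asc [OF 2]]] by metis
qed

theorem theorem23:
  fixes \<M> \<A> :: "('h::chilbert_space \<Rightarrow>\<^sub>L 'h) set"
    and \<tau> :: "('h \<Rightarrow>\<^sub>L 'h) \<Rightarrow> complex"
    and E :: "('h \<Rightarrow>\<^sub>L 'h) \<Rightarrow> ('h \<Rightarrow>\<^sub>L 'h)"
    and A S :: "'n::finite \<Rightarrow> ('h \<Rightarrow>\<^sub>L 'h)"
  assumes "type_II1_factor \<M>"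
    and "normalized_trace \<M> \<tau>"
    and "masa \<M> \<A>"
    and "trace_preserving_expectation \<M> \<tau> \<A> E"
    and "\<forall>i. A i \<in> \<A>"
    and "\<forall>i. S i \<in> \<M>"
    and "commuting_hermitian A"
    and "commuting_hermitian S"
    and "finite (joint_spectrum A)"
    and "finite (joint_spectrum S)"
    and "majorized \<M> \<tau> A S"
  shows "\<exists>U\<in>\<M>. unitary_op U \<and> (\<forall>i. E (U o\<^sub>L S i o\<^sub>L cadj U) = A i)"
proof -
  define N where "N = {x. Rep_cop x \<in> \<M>}"
  define B where "B = {x. Rep_cop x \<in> \<A>}"
  have vna: "von_neumann_algebra \<M>"
    using assms(1) by (simp add: type_II1_factor_def factor_def)
  have AM: "\<A> \<subseteq> \<M>" and star: "star_subalgebra \<A>"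
    and Acom: "\<And>x y. x \<in> \<A> \<Longrightarrow> y \<in> \<A> \<Longrightarrow> x o\<^sub>L y = y o\<^sub>L x"
    using assms(3) by (auto simp: masa_def abelian_star_subalgebra_def)
  have Mc: "\<M> \<subseteq> cbounded_ops"
    using vna by (simp add: von_neumann_algebra_def)
  have M: "\<M> = Rep_cop ` N" and \<A>: "\<A> = Rep_cop ` B"
    using Mc AM cbounded_ops_cases by (auto simp: N_def B_def image_iff) blast+
  interpret F: tracial_factor N "\<lambda>x. \<tau> (Rep_cop x)"
    using assms(1,2) unfolding M by (rule tracial_factor_Rep_cop)
  define E' where "E' x = Abs_cop (E (Rep_cop x))" for x
  have E: "E (Rep_cop x) \<in> \<A>" if "x \<in> N" for x
    using assms(4) that by (simp add: trace_preserving_expectation_def N_def)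
  have RE: "Rep_cop (E' x) = E (Rep_cop x)" if "x \<in> N" for x
    using E [OF that] AM Mc by (auto simp: E'_def Abs_cop_inverse)
  have lin: "clinear_on \<M> E" and Efix: "\<And>a. a \<in> \<A> \<Longrightarrow> E a = a"
    and Ebi: "\<And>a x b. a \<in> \<A> \<Longrightarrow> x \<in> \<M> \<Longrightarrow> b \<in> \<A> \<Longrightarrow> E (a o\<^sub>L x o\<^sub>L b) = a o\<^sub>L E x o\<^sub>L b"
    and Etr: "\<And>x. x \<in> \<M> \<Longrightarrow> \<tau> (E x) = \<tau> x"
    using assms(4) by (auto simp: trace_preserving_expectation_def)
  have BN: "B \<subseteq> N"
    using AM by (auto simp: B_def N_def)
  interpret masa_expectation N "\<lambda>x. \<tau> (Rep_cop x)" B E'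
  proof unfold_locales
    show "x \<in> B \<longleftrightarrow> x \<in> N \<and> (\<forall>a\<in>B. x * a = a * x)" for x
    proof
      assume x: "x \<in> B"
      have "x * a = a * x" if "a \<in> B" for a
        using Acom [of "Rep_cop x" "Rep_cop a"] x that
        by (simp add: B_def Rep_cop_simps(3) [symmetric] Rep_cop_inject)
      then show "x \<in> N \<and> (\<forall>a\<in>B. x * a = a * x)"
        using x BN by blast
    next
      assume "x \<in> N \<and> (\<forall>a\<in>B. x * a = a * x)"
      then show "x \<in> B"
        using F.masa_relative_commutant [OF assms(3) [unfolded M \<A>]] by blast
    qed
    show "adj x \<in> B" if "x \<in> B" for x
      using star that by (simp add: star_subalgebra_def B_def cadj_Rep_cop [symmetric])
    show "E' x \<in> B" if "x \<in> N" for x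
      using E [OF that] by (simp add: B_def RE [OF that])
    have inj: "x = y" if "Rep_cop x = Rep_cop y" for x y :: "'h cop"
      using that by (simp add: Rep_cop_inject)
    show "E' (x + y) = E' x + E' y" if "x \<in> N" "y \<in> N" for x y
      using lin that by (intro inj) (simp add: RE F.N_add Rep_cop_simps, simp add: clinear_on_def N_def)
    show "E' (c *\<^sub>C x) = c *\<^sub>C E' x" if "x \<in> N" for x c
      using lin that by (intro inj) (simp add: RE F.N_scaleC Rep_cop_simps, simp add: clinear_on_def N_def)
    show "E' a = a" if "a \<in> B" for a
      using Efix that BN by (intro inj) (auto simp: RE B_def)
    show "E' (a * x * b) = a * E' x * b" if "a \<in> B" "x \<in> N" "b \<in> B" for a x b
    proof (rule inj)
      have "a \<in> N" "b \<in> N"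
        using that BN by auto
      then show "Rep_cop (E' (a * x * b)) = Rep_cop (a * E' x * b)"
        using Ebi [of "Rep_cop a" "Rep_cop x" "Rep_cop b"] that
        by (simp add: RE F.N_mult Rep_cop_simps) (simp add: B_def N_def)
    qed
    show "\<tau> (Rep_cop (E' x)) = \<tau> (Rep_cop x)" if "x \<in> N" for x
      using Etr that by (simp add: RE N_def)
  qed
  obtain D where D: "doubly_stochastic \<M> \<tau> D" "\<And>i. D (S i) = A i"
    using assms(11) by (auto simp: majorized_def)
  define D' where "D' x = Abs_cop (D (Rep_cop x))" for x
  have DM: "D (Rep_cop x) \<in> \<M>" if "x \<in> N" for x
    using D(1) that by (simp add: doubly_stochastic_def N_def)
  have RD: "Rep_cop (D' x) = D (Rep_cop x)" if "x \<in> N" for x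
    using DM [OF that] Mc by (auto simp: D'_def Abs_cop_inverse)
  define a s where "a i = Abs_cop (A i)" and "s i = Abs_cop (S i)" for i
  have Ra: "Rep_cop (a i) = A i" and Rs: "Rep_cop (s i) = S i" for i
    using assms(5,6) AM Mc by (auto simp: a_def s_def Abs_cop_inverse subset_iff)
  have aB: "a i \<in> B" and sN: "s i \<in> N" for i
    using assms(5,6) by (simp_all add: B_def N_def Ra Rs)
  have herm: "adj (x i) = x i" "x i * x j = x j * x i"
    "\<exists>vs::real list. distinct vs \<and> prod_list (map (\<lambda>v. x i - v *\<^sub>R 1) vs) = 0"
    if "\<And>i. Rep_cop (x i) = X i" "commuting_hermitian X" "finite (joint_spectrum X)"
    for x and X :: "'n \<Rightarrow> 'h \<Rightarrow>\<^sub>L 'h" and i j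
  proof -
    have X: "X = (\<lambda>i. Rep_cop (x i))"
      using that(1) by auto
    have 1: "adj (x i) = x i" and 2: "x i * x j = x j * x i" for i j
      using that(2) by (simp_all add: commuting_hermitian_def X hermitian_op_Rep_cop
          Rep_cop_simps(3) [symmetric] Rep_cop_inject)
    from 1 2 show "adj (x i) = x i" "x i * x j = x j * x i" .
    show "\<exists>vs::real list. distinct vs \<and> prod_list (map (\<lambda>v. x i - v *\<^sub>R 1) vs) = 0"
      using finite_spectrum_annihilated [of x i, OF 1 2] that(3) unfolding X by metis
  qed
  note ha = herm [of a, OF Ra assms(7,9)] and hs = herm [of s, OF Rs assms(8,10)]
  obtain Pa where Pa: "finite Pa" "\<forall>q\<in>Pa. is_proj q \<and> (\<forall>t. (\<forall>i. t * a i = a i * t) \<longrightarrow> t * q = q * t) \<and>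
      (\<forall>i\<in>UNIV. \<exists>v::real. a i * q = v *\<^sub>R q)" "\<forall>p\<in>Pa. \<forall>q\<in>Pa. p \<noteq> q \<longrightarrow> p * q = 0" "\<Sum>Pa = 1"
    using spectral_partition [of a UNIV] ha by auto
  obtain Qs where Qs: "finite Qs" "\<forall>q\<in>Qs. is_proj q \<and> (\<forall>t. (\<forall>i. t * s i = s i * t) \<longrightarrow> t * q = q * t) \<and>
      (\<forall>i\<in>UNIV. \<exists>v::real. s i * q = v *\<^sub>R q)" "\<forall>p\<in>Qs. \<forall>q\<in>Qs. p \<noteq> q \<longrightarrow> p * q = 0" "\<Sum>Qs = 1"
    using spectral_partition [of s UNIV] hs by auto
  \<comment> \<open>Spectral projections commute with whatever commutes with the tuple, in
    particular with the commutant of \<open>N\<close>. The same argument with the elements of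
    \<open>B\<close> places those of \<open>a\<close> in the masa.\<close>
  have QN: "q \<in> N" if "q \<in> Qs" for q
  proof (rule F.memI)
    fix t assume "t \<in> comm N"
    then have "\<forall>i. t * s i = s i * t"
      using F.commD sN by blast
    then show "q * t = t * q"
      using Qs(2) that by metis
  qed
  have PB: "q \<in> B" if "q \<in> Pa" for q
  proof (rule A_I)
    show "q \<in> N"
    proof (rule F.memI)
      fix t assume "t \<in> comm N"
      then have "\<forall>i. t * a i = a i * t"
        using F.commD aB BN by blast
      then show "q * t = t * q"
        using Pa(2) that by metis
    qed
    fix b assume "b \<in> B"
    then have "\<forall>i. b * a i = a i * b"
      using A_commute aB by blast
    then show "q * b = b * q"
      using Pa(2) that by metis
  qed
  have inj: "x = y" if "Rep_cop x = Rep_cop y" for x y :: "'h cop"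
    using that by (simp add: Rep_cop_inject)
  have dl: "clinear_on \<M> D" and d1: "D id_blinfun = id_blinfun"
    and dpos: "\<And>x. x \<in> \<M> \<Longrightarrow> positive_op x \<Longrightarrow> positive_op (D x)" and dtr: "\<And>x. x \<in> \<M> \<Longrightarrow> \<tau> (D x) = \<tau> x"
    using D(1) by (auto simp: doubly_stochastic_def)
  obtain U where U: "U \<in> N" "adj U * U = 1" "U * adj U = 1" "\<And>i. E' (U * s i * adj U) = a i"
  \<comment> \<open>The refinement may produce the zero projection; it is dropped from
    \<open>Pa\<close> because the weights divide by \<open>tr p\<close>.\<close>
  proof (rule schur_horn [of a s "Pa - {0}" Qs D'])
    show "(\<Sum>p\<in>Pa - {0}. p) = 1"
      using Pa(1,4) sum.mono_neutral_left [of Pa "Pa - {0}" "\<lambda>p. p"] by auto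
    show "D' x \<in> N" if "x \<in> N" for x
      using DM [OF that] by (simp add: N_def [of] RD [OF that])
    show "D' (x + y) = D' x + D' y" if "x \<in> N" "y \<in> N" for x y
      using dl that by (intro inj) (simp add: RD F.N_add Rep_cop_simps, simp add: clinear_on_def N_def)
    show "D' (r *\<^sub>R x) = r *\<^sub>R D' x" if "x \<in> N" for r x
      using dl that by (intro inj)
        (simp add: scaleR_scaleC RD F.N_scaleC Rep_cop_simps, simp add: clinear_on_def N_def)
    show "D' 1 = 1"
      by (rule inj) (simp add: RD Rep_cop_simps d1)
    show "pos (D' x)" if "x \<in> N" "pos x" for x
      using dpos [of "Rep_cop x"] that by (simp add: RD [symmetric] positive_op_Rep_cop) (simp add: N_def positive_op_Rep_cop RD)
    show "F.tr (D' x) = F.tr x" if "x \<in> N" for x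
      using dtr [of "Rep_cop x"] that by (simp add: F.tr_def RD) (simp add: N_def)
    show "D' (s i) = a i" for i
      by (rule inj) (simp add: RD sN Rs D(2) Ra)
  qed (use Pa Qs QN PB aB sN in auto)
  have UM: "Rep_cop U \<in> \<M>"
    using U(1) by (simp add: N_def)
  moreover have "unitary_op (Rep_cop U)"
    by (simp add: unitary_op_def Rep_cop cadj_Rep_cop Rep_cop_simps(3,5) [symmetric] U)
  moreover have "E (Rep_cop U o\<^sub>L S i o\<^sub>L cadj (Rep_cop U)) = A i" for i
  proof -
    have "U * s i * adj U \<in> N"
      by (simp add: F.N_intros U(1) sN)
    from RE [OF this] show ?thesis
      by (simp add: U(4) Ra Rs Rep_cop_simps cadj_Rep_cop)
  qed
  ultimately show ?thesis
    by blast
qed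

end
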